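(* Let $k\ge -1$ be an integer and let $J\subseteq\mathcal L(X)$ be a nonempty upper set. If $k=-1$, assume in addition that $\mathcal H\subseteq J$, i.e. $J$ contains all hyperplanes of $X$. Then for every normal selector function $E$, \[\mathcal P(X,k,J)=\ker\mathcal I(X,k,J)\subseteq\ker\mathcal I'(X,k,J,E).\] Furthermore, if $k\in\{-1,0\}$, then the ideal $\mathcal I'(X,k,J,E)$ does not depend on the choice of the normal selector function $E$, and \[\mathcal P(X,k,J)=\ker\mathcal I(X,k,J)=\ker\mathcal I'(X,k,J,E).\]
   Context: Let $\mathbb{K}$ be a field of characteristic zero, $V$ a $\mathbb{K}$-vector space of finite dimension $r\ge 1$, and $U=V^*$. Let $X=(x_1,\dots,x_N)$ be a finite sequence of vectors in $U$ that spans $U$. Subsequences $Y\subseteq X$ are taken with respect to indices, and $X\setminus Y$ denotes the subsequence of entries of $X$ whose indices are not in $Y$. $\operatorname{rank}(Y)$ is the dimension of the span of $Y$, and $\operatorname{clos}(Y)=\{x\in X:\operatorname{rank}(Y\cup x)=\operatorname{rank}(Y)\}$. A flat is a $C\subseteq X$ with $\operatorname{clos}(C)=C$; a hyperplane is a flat of rank $r-1$; $\mathcal H$ is the set of hyperplanes; $\mathcal L(X)$ is the lattice of flats ordered by inclusion. An upper set $J\subseteq\mathcal L(X)$ is a set of flats such that $C\in J$ and $C\subseteq C'\in\mathcal L(X)$ imply $C'\in J$. $\chi=\chi_J$ is the indicator function of $J$, extended to all $A\subseteq X$ by $\chi(A)=\chi(\operatorname{clos}(A))$. A maximal missing flat is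 a flat $C\notin J$ that is maximal with this property. For $\eta\in V$, the set $\{x\in X:\eta(x)=0\}$ is a flat, the flat defined by $\eta$, and $\eta$ is called a defining normal of it. For a flat $C$ put $m(C)=|X\setminus C|$; for $\eta\in V$ put $m(\eta)=m(C)$ and $\chi(\eta)=\chi(C)$ where $C$ is the flat defined by $\eta$. A normal selector function is a map $E$ assigning to each flat a defining normal of it. $\operatorname{Sym}(U)$ and $\operatorname{Sym}(V)$ are the symmetric algebras with their natural grading. For $u\in U$, $p_u$ denotes its image in $\operatorname{Sym}(U)$ and $p_Y=\prod_{x\in Y}p_x$; for $v\in V$, $D_v$ denotes its image in $\operatorname{Sym}(V)$. $\operatorname{Sym}(V)$ acts on $\operatorname{Sym}(U)$ as differential operators, where $D_v$ acts as the unique derivation with $D_v(u)=v(u)$ for $u\in U$. For a homogeneous ideal $\mathcal I\subseteq\operatorname{Sym}(V)$, $\ker\mathcal I=\{f\in\operatorname{Sym}(U): q\cdot f=0\text{ for all }q\in\mathcal I\}$. For an integer $k\ge-1$, a nonempty upper set $J$ and a normal selector function $E$ define $\mathcal I'(X,k,J,E)=\operatorname{ideal}\{D_{E(C)}^{m(C)+k+\chi(C)}: C\text{ a hyperplane or a maximal missing flat}\}$, $\mathcal I(X,k,J)=\operatorname{ideal}\{D_\eta^{m(\eta)+k+\chi(\eta)}:\eta\in V\setminus\{0\}\}\subseteq\operatorname{Sym}(V)$, and $\mathcal P(X,k,J)=\operatorname{span}S(X,k,J)\subseteq\operatorname{Sym}(U)$, where for $k\ge1$, $S(X,k,J)=\{f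 p_Y: Y\subseteq X,\ f\in\operatorname{Sym}(U),\ \deg f\le\chi(X\setminus Y)+k-1\}$; $S(X,0,J)=\{p_Y: Y\subseteq X,\ \operatorname{clos}(X\setminus Y)\in J\}$; and $S(X,-1,J)=\{p_Y: Y\subseteq X,\ |Y\setminus C|<m(C)-1+\chi(C)\text{ for all }C\in\mathcal L(X)\setminus\{X\}\}$. *)

theory Defs
  imports Complex_Main "HOL-Library.Poly_Mapping" "HOL-Library.Function_Algebras"
begin

text \<open>
  \<open>V\<close> is the whole type \<open>'v\<close> with scalar multiplication \<open>scale\<close> over the field \<open>'k\<close>.  Its dual
  \<open>U\<close> consists of the linear functionals, inside the vector space of all functions
  \<open>'v \<Rightarrow> 'k\<close> with pointwise operations.
\<close>

definition fun_scale :: "'k::field \<Rightarrow> ('v \<Rightarrow> 'k) \<Rightarrow> 'v \<Rightarrow> 'k"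
  where "fun_scale c u = (\<lambda>v. c * u v)"

definition dual_space :: "('k::field \<Rightarrow> 'v::ab_group_add \<Rightarrow> 'v) \<Rightarrow> ('v \<Rightarrow> 'k) set"
  where "dual_space scale = {u. Vector_Spaces.linear scale (*) u}"


subsection \<open>Symmetric algebras\<close>

text \<open>
  \<open>Sym(V)\<close> is the polynomial ring over \<open>'k\<close> in the elements of a basis \<open>B\<close> of \<open>V\<close>, and \<open>Sym(U)\<close>
  is the polynomial ring in the elements of the dual basis of \<open>U = V\<^sup>*\<close>.  The dual basis vector
  belonging to \<open>b \<in> B\<close> is named \<open>b\<close> as well, so that both rings have the same carrier \<open>sym_alg B\<close>.
  The canonical maps \<open>V \<rightarrow> Sym(V)\<close> and \<open>U \<rightarrow> Sym(U)\<close> are \<open>sym_V scale B\<close> (written \<open>v \<mapsto> D\<^sub>v\<close> in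
  mathematics) and \<open>sym_U B\<close> (written \<open>u \<mapsto> p\<^sub>u\<close>).
\<close>

type_synonym ('v, 'k) poly_alg = "('v \<Rightarrow>\<^sub>0 nat) \<Rightarrow>\<^sub>0 'k"

definition sym_alg :: "'v set \<Rightarrow> ('v, 'k::field) poly_alg set"
  where "sym_alg B = {f. \<forall>m \<in> Poly_Mapping.keys f. Poly_Mapping.keys m \<subseteq> B}"

definition sym_const :: "'k::field \<Rightarrow> ('v, 'k) poly_alg"
  where "sym_const c = Poly_Mapping.single 0 c"

definition sym_var :: "'v \<Rightarrow> ('v, 'k::field) poly_alg"
  where "sym_var b = Poly_Mapping.single (Poly_Mapping.single b 1) 1"

definition sym_V ::
    "('k::field \<Rightarrow> 'v::ab_group_add \<Rightarrow> 'v) \<Rightarrow> 'v set \<Rightarrow> 'v \<Rightarrow> ('v, 'k) poly_alg"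
  where "sym_V scale B v = (\<Sum>b\<in>B. sym_const (module.representation scale B v b) * sym_var b)"

definition sym_U :: "'v set \<Rightarrow> ('v \<Rightarrow> 'k::field) \<Rightarrow> ('v, 'k) poly_alg"
  where "sym_U B u = (\<Sum>b\<in>B. sym_const (u b) * sym_var b)"

definition sym_span :: "('v, 'k::field) poly_alg set \<Rightarrow> ('v, 'k) poly_alg set"
  where "sym_span = module.span (\<lambda>c f. sym_const c * f)"

definition sym_degree :: "('v, 'k::field) poly_alg \<Rightarrow> nat"
  where "sym_degree f =
    Max (insert 0 ((\<lambda>m. \<Sum>b\<in>Poly_Mapping.keys m. Poly_Mapping.lookup m b) ` Poly_Mapping.keys f))"

definition sym_ideal :: "'v set \<Rightarrow> ('v, 'k::field) poly_alg set \<Rightarrow> ('v, 'k) poly_alg set"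
  where "sym_ideal B G =
    {\<Sum>g\<in>F. q g * g | F q. finite F \<and> F \<subseteq> G \<and> (\<forall>g\<in>F. q g \<in> sym_alg B)}"

text \<open>
  The action of \<open>Sym(V)\<close> on \<open>Sym(U)\<close>: a monomial \<open>a\<close> acts as the iterated partial derivative
  \<open>\<partial>\<^sup>a\<close>, which sends a monomial \<open>m\<close> to \<open>m - a\<close> times a product of falling factorials.  If
  \<open>a b > m b\<close> for some \<open>b\<close>, this product has a factor \<open>m b - m b = 0\<close>, so the truncated
  subtraction is harmless.  The lemmas below show that this is the module action
  in which every \<open>D\<^sub>v\<close> acts as the unique derivation with \<open>D\<^sub>v(p\<^sub>u) = u(v)\<close>.
\<close>

definition diff_coeff :: "('v \<Rightarrow>\<^sub>0 nat) \<Rightarrow> ('v \<Rightarrow>\<^sub>0 nat) \<Rightarrow> nat"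
  where "diff_coeff a m =
    (\<Prod>b\<in>Poly_Mapping.keys a. \<Prod>i<Poly_Mapping.lookup a b. Poly_Mapping.lookup m b - i)"

definition sym_act :: "('v, 'k::field) poly_alg \<Rightarrow> ('v, 'k) poly_alg \<Rightarrow> ('v, 'k) poly_alg"
  where "sym_act q f =
    (\<Sum>a\<in>Poly_Mapping.keys q. \<Sum>m\<in>Poly_Mapping.keys f.
       Poly_Mapping.single (m - a)
         (Poly_Mapping.lookup q a * Poly_Mapping.lookup f m * of_nat (diff_coeff a m)))"

definition sym_ker :: "'v set \<Rightarrow> ('v, 'k::field) poly_alg set \<Rightarrow> ('v, 'k) poly_alg set"
  where "sym_ker B I = {f \<in> sym_alg B. \<forall>q\<in>I. sym_act q f = 0}"

lemma poly_mapping_sum_single: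
  fixes p :: "'a \<Rightarrow>\<^sub>0 'b::comm_monoid_add"
  shows "p = (\<Sum>k\<in>Poly_Mapping.keys p. Poly_Mapping.single k (Poly_Mapping.lookup p k))"
proof (rule poly_mapping_eqI)
  fix i
  show "Poly_Mapping.lookup p i =
    Poly_Mapping.lookup (\<Sum>k\<in>Poly_Mapping.keys p. Poly_Mapping.single k (Poly_Mapping.lookup p k)) i"
    by (auto simp: lookup_sum lookup_single when_def sum.delta' not_in_keys_iff_lookup_eq_zero
        cong: if_cong)
qed

lemma poly_mapping_induct_single [case_names zero single add]:
  fixes p :: "'a \<Rightarrow>\<^sub>0 'b::comm_monoid_add"
  assumes "P 0" and "\<And>m c. P (Poly_Mapping.single m c)" and "\<And>f g. P f \<Longrightarrow> P g \<Longrightarrow> P (f + g)"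
  shows "P p"
proof -
  have "P (\<Sum>k\<in>A. Poly_Mapping.single k (Poly_Mapping.lookup p k))" if "finite A" for A
    using that by induction (simp_all add: assms)
  then show ?thesis by (subst poly_mapping_sum_single) simp
qed

lemma sym_act_superset:
  assumes "finite A" "Poly_Mapping.keys q \<subseteq> A" "finite M" "Poly_Mapping.keys f \<subseteq> M"
  shows "sym_act q f =
    (\<Sum>a\<in>A. \<Sum>m\<in>M. Poly_Mapping.single (m - a)
       (Poly_Mapping.lookup q a * Poly_Mapping.lookup f m * of_nat (diff_coeff a m)))"
proof -
  have "sym_act q f = (\<Sum>a\<in>Poly_Mapping.keys q. \<Sum>m\<in>M. Poly_Mapping.single (m - a)
       (Poly_Mapping.lookup q a * Poly_Mapping.lookup f m * of_nat (diff_coeff a m)))"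
    unfolding sym_act_def
    by (intro sum.cong refl sum.mono_neutral_left)
      (use assms in \<open>auto simp: not_in_keys_iff_lookup_eq_zero\<close>)
  also have "\<dots> = (\<Sum>a\<in>A. \<Sum>m\<in>M. Poly_Mapping.single (m - a)
       (Poly_Mapping.lookup q a * Poly_Mapping.lookup f m * of_nat (diff_coeff a m)))"
    by (intro sum.mono_neutral_left)
      (use assms in \<open>auto simp: not_in_keys_iff_lookup_eq_zero\<close>)
  finally show ?thesis .
qed

lemma sym_act_add_left: "sym_act (q + q') f = sym_act q f + sym_act q' f"
proof -
  let ?A = "Poly_Mapping.keys q \<union> Poly_Mapping.keys q'"
  have "Poly_Mapping.keys (q + q') \<subseteq> ?A" by (rule keys_add)
  then show ?thesis
    by (subst (1 2 3) sym_act_superset[where A = ?A and M = "Poly_Mapping.keys f"])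
      (auto simp: lookup_add distrib_right single_add sum.distrib)
qed

lemma sym_act_add_right: "sym_act q (f + f') = sym_act q f + sym_act q f'"
proof -
  let ?M = "Poly_Mapping.keys f \<union> Poly_Mapping.keys f'"
  have "Poly_Mapping.keys (f + f') \<subseteq> ?M" by (rule keys_add)
  then show ?thesis
    by (subst (1 2 3) sym_act_superset[where A = "Poly_Mapping.keys q" and M = ?M])
      (auto simp: lookup_add distrib_right distrib_left single_add sum.distrib)
qed

lemma sym_act_0_left [simp]: "sym_act 0 f = 0"
  by (simp add: sym_act_def)

lemma sym_act_0_right [simp]: "sym_act q 0 = 0"
  by (simp add: sym_act_def)

lemma sym_act_sum_left: "sym_act (\<Sum>i\<in>I. q i) f = (\<Sum>i\<in>I. sym_act (q i) f)"
  by (induction I rule: infinite_finite_induct) (simp_all add: sym_act_add_left)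

lemma sym_act_sum_right: "sym_act q (\<Sum>i\<in>I. f i) = (\<Sum>i\<in>I. sym_act q (f i))"
  by (induction I rule: infinite_finite_induct) (simp_all add: sym_act_add_right)

lemma sym_act_single:
  "sym_act (Poly_Mapping.single a x) (Poly_Mapping.single m y) =
   Poly_Mapping.single (m - a) (x * y * of_nat (diff_coeff a m))"
  by (subst sym_act_superset[where A = "{a}" and M = "{m}"]) auto

lemma diff_coeff_superset:
  assumes "finite B" "Poly_Mapping.keys a \<subseteq> B"
  shows "diff_coeff a m = (\<Prod>b\<in>B. \<Prod>i<Poly_Mapping.lookup a b. Poly_Mapping.lookup m b - i)"
  unfolding diff_coeff_def
  by (intro prod.mono_neutral_left) (use assms in \<open>auto simp: not_in_keys_iff_lookup_eq_zero\<close>)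

lemma falling_add:
  fixes n :: nat
  shows "(\<Prod>i<s + t. n - i) = (\<Prod>i<t. n - i) * (\<Prod>i<s. n - t - i)"
  by (induction s) (simp_all add: mult.assoc add.commute)

lemma diff_coeff_add: "diff_coeff (a + a') m = diff_coeff a' m * diff_coeff a (m - a')"
proof -
  let ?B = "Poly_Mapping.keys a \<union> Poly_Mapping.keys a'"
  have "Poly_Mapping.keys (a + a') \<subseteq> ?B" by (rule keys_add)
  then show ?thesis
    by (subst (1 2 3) diff_coeff_superset[where B = ?B])
      (auto simp: lookup_add lookup_minus falling_add prod.distrib)
qed

lemma sym_act_const: "sym_act (sym_const c) f = sym_const c * f"
proof (induction f rule: poly_mapping_induct_single)
  case (single m y)
  show ?case by (simp add: sym_const_def sym_act_single mult_single diff_coeff_def)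
qed (simp_all add: sym_act_add_right distrib_left)

lemma sym_act_one: "sym_act 1 f = f"
  using sym_act_const[of 1 f] by (simp add: sym_const_def)

lemma sym_act_mult: "sym_act (q * q') f = sym_act q (sym_act q' f)"
proof (induction f rule: poly_mapping_induct_single)
  case (single m y)
  show ?case
  proof (induction q rule: poly_mapping_induct_single)
    case (single a x)
    show ?case
    proof (induction q' rule: poly_mapping_induct_single)
      case (single a' x')
      have "m - (a + a') = m - a' - a" by (simp add: add.commute diff_diff_add)
      then show ?case
        unfolding mult_single sym_act_single diff_coeff_add by (simp add: mult_ac)
    qed (simp_all add: sym_act_add_left sym_act_add_right distrib_left)
  qed (simp_all add: sym_act_add_left distrib_right)
qed (simp_all add: sym_act_add_right)

lemma sym_act_var_single:
  "sym_act (sym_var b) (Poly_Mapping.single m y) =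
   Poly_Mapping.single (m - Poly_Mapping.single b 1) (y * of_nat (Poly_Mapping.lookup m b))"
  by (simp add: sym_var_def sym_act_single diff_coeff_def)

lemma sym_act_var_Leibniz:
  "sym_act (sym_var b) (f * g) = sym_act (sym_var b) f * g + f * sym_act (sym_var b) g"
proof (induction f rule: poly_mapping_induct_single)
  case (single m y)
  show ?case
  proof (induction g rule: poly_mapping_induct_single)
    case (single n z)
    let ?e = "Poly_Mapping.single b (1::nat)"
    have 1: "m - ?e + n = m + n - ?e" if "Poly_Mapping.lookup m b \<noteq> 0" for m n :: "'a \<Rightarrow>\<^sub>0 nat"
      using that
      by (intro poly_mapping_eqI) (auto simp: lookup_add lookup_minus lookup_single when_def)
    have 2: "Poly_Mapping.single (m - ?e + n) (c * of_nat (Poly_Mapping.lookup m b)) =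
        Poly_Mapping.single (m + n - ?e) (c * of_nat (Poly_Mapping.lookup m b))"
      for m n :: "'a \<Rightarrow>\<^sub>0 nat" and c :: 'b
    proof (cases "Poly_Mapping.lookup m b = 0")
      case False
      then show ?thesis by (simp only: 1 not_False_eq_True)
    qed simp
    show ?case
      using 2[of m n "y * z"] 2[of n m "y * z"]
      by (simp add: sym_act_var_single mult_single lookup_add distrib_left single_add
          add.commute mult_ac)
  qed (simp_all add: sym_act_add_right distrib_left)
qed (simp_all add: sym_act_add_right distrib_right)

lemma sym_act_const_mult: "sym_act q (sym_const c * f) = sym_const c * sym_act q f"
  using sym_act_mult[of q "sym_const c" f] sym_act_mult[of "sym_const c" q f]
  by (simp add: sym_act_const mult.commute)

lemma sym_act_V: "sym_act (sym_V scale B v) f =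
  (\<Sum>b\<in>B. sym_const (module.representation scale B v b) * sym_act (sym_var b) f)"
  by (simp add: sym_V_def sym_act_sum_left sym_act_mult sym_act_const)

lemma sym_act_V_Leibniz:
  "sym_act (sym_V scale B v) (f * g) =
   sym_act (sym_V scale B v) f * g + f * sym_act (sym_V scale B v) g"
  by (simp add: sym_act_V sym_act_var_Leibniz distrib_left sum.distrib sum_distrib_left
      sum_distrib_right mult_ac)

lemma sym_act_var_var:
  "sym_act (sym_var b) (sym_var b') = sym_const (if b = b' then 1 else (0::'k::field))"
  unfolding sym_var_def[of b'] by (simp add: sym_act_var_single sym_const_def lookup_single)

lemma sym_act_V_U:
  assumes "finite_dimensional_vector_space scale B" and "u \<in> dual_space scale"
  shows "sym_act (sym_V scale B v) (sym_U B u) = sym_const (u v)"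
proof -
  interpret finite_dimensional_vector_space scale B by fact
  interpret u: Vector_Spaces.linear scale "(*)" u using assms(2) by (simp add: dual_space_def)
  have *: "sym_act (sym_var b) (sym_U B u) = sym_const (u b)" if "b \<in> B" for b
  proof -
    have "sym_act (sym_var b) (sym_U B u) =
        (\<Sum>b'\<in>B. sym_const (u b') * sym_act (sym_var b) (sym_var b'))"
      by (simp add: sym_U_def sym_act_sum_right sym_act_const_mult)
    also have "\<dots> = (\<Sum>b'\<in>B. if b' = b then sym_const (u b) else 0)"
      by (intro sum.cong) (auto simp: sym_act_var_var sym_const_def mult_single)
    finally show ?thesis using that finite_Basis by simp
  qed
  have "u v = u (\<Sum>b\<in>B. scale (representation B v b) b)"
    using sum_representation_eq[OF independent_Basis, of v B] finite_Basis
    by (simp add: span_Basis)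
  also have "\<dots> = (\<Sum>b\<in>B. representation B v b * u b)"
    by (simp add: u.sum u.scale)
  finally have "u v = \<dots>" .
  moreover have "sym_const (\<Sum>b\<in>A. h b) = (\<Sum>b\<in>A. sym_const (h b) :: ('b, 'a) poly_alg)"
    if "finite A" for A :: "'b set" and h
    using that by induction (simp_all add: sym_const_def single_add)
  ultimately show ?thesis
    using finite_Basis
    by (simp add: sym_act_V *) (simp add: sym_const_def mult_single)
qed

lemma sym_alg_induct [consumes 1, case_names const var_mult add]:
  assumes f: "f \<in> sym_alg B"
    and const: "\<And>c. P (sym_const c)"
    and var_mult: "\<And>b f. b \<in> B \<Longrightarrow> f \<in> sym_alg B \<Longrightarrow> P f \<Longrightarrow> P (sym_var b * f)"
    and add: "\<And>f g. f \<in> sym_alg B \<Longrightarrow> g \<in> sym_alg B \<Longrightarrow> P f \<Longrightarrow> P g \<Longrightarrow> P (f + g)"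
  shows "P f"
proof -
  have mono: "Poly_Mapping.single m c \<in> sym_alg B \<and> P (Poly_Mapping.single m c)"
    if "Poly_Mapping.keys m \<subseteq> B" for m c
    using that
  proof (induction "\<Sum>b\<in>Poly_Mapping.keys m. Poly_Mapping.lookup m b" arbitrary: m)
    case 0
    then have "m = 0"
      by (intro poly_mapping_eqI) (auto simp: in_keys_iff)
    then show ?case using const[of c] by (auto simp: sym_alg_def sym_const_def)
  next
    case (Suc n)
    then obtain b where b: "b \<in> Poly_Mapping.keys m" by fastforce
    let ?e = "Poly_Mapping.single b (1::nat)"
    define m' where "m' = m - ?e"
    have m: "m = ?e + m'"
      using b unfolding m'_def
      by (intro poly_mapping_eqI)
        (auto simp: lookup_add lookup_minus lookup_single when_def in_keys_iff)
    have sub: "Poly_Mapping.keys m' \<subseteq> Poly_Mapping.keys m"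
      unfolding m'_def by (auto simp: in_keys_iff lookup_minus)
    have "(\<Sum>b\<in>Poly_Mapping.keys m'. Poly_Mapping.lookup m' b) =
        (\<Sum>b\<in>Poly_Mapping.keys m. Poly_Mapping.lookup m' b)"
      using sub by (intro sum.mono_neutral_left) (auto simp: in_keys_iff)
    moreover have "(\<Sum>b\<in>Poly_Mapping.keys m. Poly_Mapping.lookup m b) =
        1 + (\<Sum>b\<in>Poly_Mapping.keys m. Poly_Mapping.lookup m' b)"
    proof -
      have "Poly_Mapping.lookup m c = (if b = c then 1 else 0) + Poly_Mapping.lookup m' c" for c
        by (subst m) (simp add: lookup_add lookup_single when_def)
      then show ?thesis using b by (simp add: sum.distrib)
    qed
    ultimately have "n = (\<Sum>b\<in>Poly_Mapping.keys m'. Poly_Mapping.lookup m' b)"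
      using Suc.hyps(2) by simp
    from Suc.hyps(1)[OF this] sub Suc.prems
    have "Poly_Mapping.single m' c \<in> sym_alg B" "P (Poly_Mapping.single m' c)" by auto
    moreover have "Poly_Mapping.single m c = sym_var b * Poly_Mapping.single m' c"
      unfolding sym_var_def mult_single by (subst m) simp
    moreover have "Poly_Mapping.single m c \<in> sym_alg B"
      using Suc.prems by (simp add: sym_alg_def)
    ultimately show ?case
      using var_mult[of b "Poly_Mapping.single m' c"] b Suc.prems by auto
  qed
  have "(\<Sum>k\<in>A. Poly_Mapping.single k (Poly_Mapping.lookup f k)) \<in> sym_alg B \<and>
      P (\<Sum>k\<in>A. Poly_Mapping.single k (Poly_Mapping.lookup f k))"
    if "finite A" "A \<subseteq> Poly_Mapping.keys f" for A
    using that
  proof induction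
    case empty
    show ?case using const[of 0] by (simp add: sym_alg_def sym_const_def)
  next
    case (insert k A)
    have closed: "g + h \<in> sym_alg B" if "g \<in> sym_alg B" "h \<in> sym_alg B"
      for g h :: "('a, 'b) poly_alg"
      using that keys_add[of g h] unfolding sym_alg_def by blast
    have "Poly_Mapping.keys k \<subseteq> B" using insert.prems f by (simp add: sym_alg_def)
    from mono[OF this, of "Poly_Mapping.lookup f k"] insert show ?case
      by (simp add: closed add)
  qed
  from this[of "Poly_Mapping.keys f"] show ?thesis
    by (subst poly_mapping_sum_single) simp
qed

lemma sym_act_V_unique:
  assumes fd: "finite_dimensional_vector_space scale B"
    and add: "\<And>f g. f \<in> sym_alg B \<Longrightarrow> g \<in> sym_alg B \<Longrightarrow> \<delta> (f + g) = \<delta> f + \<delta> g"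
    and Leibniz: "\<And>f g. f \<in> sym_alg B \<Longrightarrow> g \<in> sym_alg B \<Longrightarrow> \<delta> (f * g) = \<delta> f * g + f * \<delta> g"
    and const: "\<And>c. \<delta> (sym_const c) = 0"
    and U: "\<And>u. u \<in> dual_space scale \<Longrightarrow> \<delta> (sym_U B u) = sym_const (u v)"
    and f: "f \<in> sym_alg B"
  shows "\<delta> f = sym_act (sym_V scale B v) f"
proof -
  interpret finite_dimensional_vector_space scale B by fact
  have 0: "sym_act (sym_V scale B v) (sym_const c) = 0" for c
  proof -
    have "sym_act (sym_var b) (sym_const c) = 0" if "b \<in> B" for b
      unfolding sym_const_def by (simp add: sym_act_var_single)
    then show ?thesis by (simp add: sym_act_V)
  qed
  have var: "(sym_var b :: ('b, 'a) poly_alg) \<in> sym_alg B \<and> \<delta> (sym_var b) = sym_act (sym_V scale B v) (sym_var b)"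
    if b: "b \<in> B" for b
  proof -
    let ?u = "\<lambda>w. representation B w b"
    have u: "?u \<in> dual_space scale"
      unfolding dual_space_def
      by (simp add: linear_representation independent_Basis span_Basis)
    have "sym_U B ?u = (\<Sum>b'\<in>B. if b' = b then sym_var b else 0)"
      unfolding sym_U_def
      by (intro sum.cong) (auto simp: representation_basis independent_Basis sym_const_def)
    also have "\<dots> = sym_var b" using b finite_Basis by simp
    finally have "sym_U B ?u = sym_var b" .
    with U[OF u] sym_act_V_U[OF fd u, of v] b show ?thesis
      by (simp add: sym_alg_def sym_var_def)
  qed
  show ?thesis
    using f
  proof (induction rule: sym_alg_induct)
    case (const c)
    show ?case by (simp add: assms(4) 0)
  next
    case (var_mult b f)
    then show ?case
      using var[of b] Leibniz[of "sym_var b" f] by (simp add: sym_act_V_Leibniz)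
  next
    case (add f g)
    then show ?case by (simp add: assms(2) sym_act_add_right)
  qed
qed


subsection \<open>Flats\<close>

text \<open>
  The sequence \<open>X\<close> is a list of functionals; subsequences of \<open>X\<close> are identified with their sets
  of indices \<open>Y \<subseteq> ground X\<close>.  Ranks are dimensions of spans in the space of functions
  \<open>'v \<Rightarrow> 'k\<close>.
\<close>

definition ground :: "('v \<Rightarrow> 'k) list \<Rightarrow> nat set"
  where "ground X = {..<length X}"

definition rank :: "('v \<Rightarrow> 'k::field) list \<Rightarrow> nat set \<Rightarrow> nat"
  where "rank X Y = vector_space.dim fun_scale ((\<lambda>i. X ! i) ` Y)"

definition clos :: "('v \<Rightarrow> 'k::field) list \<Rightarrow> nat set \<Rightarrow> nat set"
  where "clos X Y = {i \<in> ground X. rank X (insert i Y) = rank X Y}"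

definition flats :: "('v \<Rightarrow> 'k::field) list \<Rightarrow> nat set set"
  where "flats X = {C. C \<subseteq> ground X \<and> clos X C = C}"

definition hyperplanes ::
    "('k::field \<Rightarrow> 'v::ab_group_add \<Rightarrow> 'v) \<Rightarrow> ('v \<Rightarrow> 'k) list \<Rightarrow> nat set set"
  where "hyperplanes scale X = {C \<in> flats X. rank X C + 1 = vector_space.dim scale UNIV}"

definition upper_set :: "('v \<Rightarrow> 'k::field) list \<Rightarrow> nat set set \<Rightarrow> bool"
  where "upper_set X J \<longleftrightarrow>
    J \<subseteq> flats X \<and> (\<forall>C\<in>J. \<forall>C'\<in>flats X. C \<subseteq> C' \<longrightarrow> C' \<in> J)"

definition max_missing_flats :: "('v \<Rightarrow> 'k::field) list \<Rightarrow> nat set set \<Rightarrow> nat set set"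
  where "max_missing_flats X J =
    {C \<in> flats X. C \<notin> J \<and> (\<forall>C'\<in>flats X. C' \<notin> J \<longrightarrow> C \<subseteq> C' \<longrightarrow> C' = C)}"

definition chi :: "('v \<Rightarrow> 'k::field) list \<Rightarrow> nat set set \<Rightarrow> nat set \<Rightarrow> int"
  where "chi X J A = (if clos X A \<in> J then 1 else 0)"

definition codeg :: "('v \<Rightarrow> 'k) list \<Rightarrow> nat set \<Rightarrow> int"
  where "codeg X C = int (card (ground X - C))"

definition flat_of :: "('v \<Rightarrow> 'k::field) list \<Rightarrow> 'v \<Rightarrow> nat set"
  where "flat_of X \<eta> = {i \<in> ground X. (X ! i) \<eta> = 0}"

definition normal_selector :: "('v \<Rightarrow> 'k::field) list \<Rightarrow> (nat set \<Rightarrow> 'v) \<Rightarrow> bool"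
  where "normal_selector X E \<longleftrightarrow> (\<forall>C\<in>flats X. flat_of X (E C) = C)"


subsection \<open>Power ideals and the spaces \<open>\<P>\<close>\<close>

text \<open>
  Both ideals only use flats \<open>C \<noteq> ground X\<close> (if \<open>X\<close> spans \<open>U\<close>, and \<open>J\<close> is a nonempty upper set),
  so \<open>codeg X C \<ge> 1\<close> and the exponents are nonnegative for \<open>k \<ge> -1\<close>.
\<close>

definition exponent :: "('v \<Rightarrow> 'k::field) list \<Rightarrow> int \<Rightarrow> nat set set \<Rightarrow> nat set \<Rightarrow> nat"
  where "exponent X k J C = nat (codeg X C + k + chi X J C)"

definition power_ideal ::
    "('k::field \<Rightarrow> 'v::ab_group_add \<Rightarrow> 'v) \<Rightarrow> 'v set \<Rightarrow> ('v \<Rightarrow> 'k) list \<Rightarrow> int \<Rightarrow> nat set set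
      \<Rightarrow> ('v, 'k) poly_alg set"
  where "power_ideal scale B X k J =
    sym_ideal B {sym_V scale B \<eta> ^ exponent X k J (flat_of X \<eta>) | \<eta>. \<eta> \<noteq> 0}"

definition power_ideal' ::
    "('k::field \<Rightarrow> 'v::ab_group_add \<Rightarrow> 'v) \<Rightarrow> 'v set \<Rightarrow> ('v \<Rightarrow> 'k) list \<Rightarrow> int \<Rightarrow> nat set set
      \<Rightarrow> (nat set \<Rightarrow> 'v) \<Rightarrow> ('v, 'k) poly_alg set"
  where "power_ideal' scale B X k J E =
    sym_ideal B {sym_V scale B (E C) ^ exponent X k J C | C.
      C \<in> hyperplanes scale X \<union> max_missing_flats X J}"

definition prod_U :: "'v set \<Rightarrow> ('v \<Rightarrow> 'k::field) list \<Rightarrow> nat set \<Rightarrow> ('v, 'k) poly_alg"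
  where "prod_U B X Y = (\<Prod>i\<in>Y. sym_U B (X ! i))"

text \<open>Only the values of \<open>k \<ge> -1\<close> are meaningful; the last case is \<open>k = -1\<close>.\<close>

definition P_gens ::
    "'v set \<Rightarrow> ('v \<Rightarrow> 'k::field) list \<Rightarrow> int \<Rightarrow> nat set set \<Rightarrow> ('v, 'k) poly_alg set"
  where "P_gens B X k J =
    (if k \<ge> 1 then
       {f * prod_U B X Y | f Y. Y \<subseteq> ground X \<and> f \<in> sym_alg B \<and>
          int (sym_degree f) \<le> chi X J (ground X - Y) + k - 1}
     else if k = 0 then
       {prod_U B X Y | Y. Y \<subseteq> ground X \<and> clos X (ground X - Y) \<in> J}
     else
       {prod_U B X Y | Y. Y \<subseteq> ground X \<and>
          (\<forall>C\<in>flats X - {ground X}. int (card (Y - C)) < codeg X C - 1 + chi X J C)})"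

definition P_space ::
    "'v set \<Rightarrow> ('v \<Rightarrow> 'k::field) list \<Rightarrow> int \<Rightarrow> nat set set \<Rightarrow> ('v, 'k) poly_alg set"
  where "P_space B X k J = sym_span (P_gens B X k J)"

end

theory Submission
  imports Defs "HOL-Library.FuncSet" "HOL-Computational_Algebra.Polynomial"
begin

text \<open>
  An element \<open>f\<close> of \<open>Sym(U)\<close> is a polynomial function on \<open>V\<close>, and \<open>D\<^sub>\<eta>\<^sup>e\<close> kills \<open>f\<close> iff \<open>f\<close> has degree
  less than \<open>e\<close> along every line in direction \<open>\<eta>\<close>; hence \<open>\<P> \<subseteq> ker \<I>\<close> is a count of linear factors.
  For \<open>ker \<I> \<subseteq> \<P>\<close> one removes the vectors of \<open>X\<close> one by one.  Restricting \<open>f\<close> to the hyperplane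
  \<open>x = 0\<close> of \<open>V\<close> is a contraction; subtracting an element of \<open>\<P>\<close> with the same restriction leaves
  \<open>x h\<close>, and \<open>h\<close> satisfies the degree conditions of the deletion: along \<open>\<eta>\<close> with \<open>x(\<eta>) \<noteq> 0\<close> the
  degree drops by one, and the other directions are limits of such, unless \<open>x\<close> is redundant there.
  For \<open>k = 0\<close> the conditions at hyperplanes and maximal missing flats alone survive both steps.
  For \<open>k = -1\<close> all spaces agree with those for \<open>k = 0\<close> and \<open>J = {X}\<close>.  Independence of the normal
  selector follows because a homogeneous ideal is determined by its kernel.
\<close>

section \<open>Polynomials as functions\<close>

text \<open>Minors are never built as new arrangements. The pair \<open>C\<close>, \<open>A\<close>
  stands for contracting \<open>C\<close> and keeping only \<open>A\<close>: the ring stays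
  \<open>sym_alg B\<close>, functions are compared only on the subspace \<open>perp C\<close>, and
  the indicator of the minor is \<open>S \<mapsto> c (C \<union> S)\<close> for one fixed monotone
  0/1 function \<open>c\<close>. Lifting from a contraction is then the identity on polynomials. The
  obstacle is the deletion of \<open>i\<close> when x_i vanishes at \<eta>: the number of
  functionals nonzero at \<eta> stays the same, but the indicator can fall from 1 to 0, so a bound
  one better than the one known for \<open>f\<close> is needed. Tilting \<eta> to make x_i nonzero
  while keeping the other zeros supplies it. When only hyperplanes and maximal missing flats are
  tested, tilted directions need not be among the tested ones. There k = 0 enters twice: a bound of
  1 means constancy along a direction, which lets directions be sheared, and a bound of 0 in a
  single direction already forces the zero function.\<close>

lemma sym_alg_const [simp]: "sym_const c \<in> sym_alg B"
  by (simp add: sym_alg_def sym_const_def)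

lemma sym_alg_zero [simp]: "0 \<in> sym_alg B"
  by (simp add: sym_alg_def)

lemma sym_alg_one [simp]: "1 \<in> sym_alg B"
  using sym_alg_const[of 1 B] by (simp add: sym_const_def)

lemma sym_alg_var [simp]: "b \<in> B \<Longrightarrow> sym_var b \<in> sym_alg B"
  by (simp add: sym_alg_def sym_var_def)

lemma sym_alg_add [intro]: "f \<in> sym_alg B \<Longrightarrow> g \<in> sym_alg B \<Longrightarrow> f + g \<in> sym_alg B"
  using keys_add[of f g] by (auto simp: sym_alg_def)

lemma sym_alg_mult [intro]:
  assumes "f \<in> sym_alg B" "g \<in> sym_alg B"
  shows "f * g \<in> sym_alg B"
proof -
  have "Poly_Mapping.keys m \<subseteq> B" if "m \<in> Poly_Mapping.keys (f * g)" for m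
  proof -
    obtain a b where "a \<in> Poly_Mapping.keys f" "b \<in> Poly_Mapping.keys g" "m = a + b"
      using \<open>m \<in> Poly_Mapping.keys (f * g)\<close> keys_mult[of f g] by blast
    then show ?thesis
      using assms keys_add[of a b] unfolding sym_alg_def by blast
  qed
  then show ?thesis by (auto simp: sym_alg_def)
qed

lemma sym_alg_uminus [intro]: "f \<in> sym_alg B \<Longrightarrow> - f \<in> sym_alg B"
  by (simp add: sym_alg_def keys_minus)

lemma sym_alg_diff [intro]: "f \<in> sym_alg B \<Longrightarrow> g \<in> sym_alg B \<Longrightarrow> f - g \<in> sym_alg B"
  using sym_alg_add[of f B "- g"] sym_alg_uminus[of g B] by simp

lemma sym_alg_sum [intro]: "(\<And>i. i \<in> I \<Longrightarrow> f i \<in> sym_alg B) \<Longrightarrow> (\<Sum>i\<in>I. f i) \<in> sym_alg B"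
  by (induction I rule: infinite_finite_induct) auto

lemma sym_alg_prod [intro]: "(\<And>i. i \<in> I \<Longrightarrow> f i \<in> sym_alg B) \<Longrightarrow> (\<Prod>i\<in>I. f i) \<in> sym_alg B"
  by (induction I rule: infinite_finite_induct) auto

lemma sym_alg_power [intro]: "f \<in> sym_alg B \<Longrightarrow> f ^ n \<in> sym_alg B"
  by (induction n) auto

lemma sym_alg_sym_U [simp]: "sym_U B u \<in> sym_alg B"
  unfolding sym_U_def by (intro sym_alg_sum sym_alg_mult) auto

lemma sym_alg_sym_V [simp]: "sym_V scale B v \<in> sym_alg B"
  unfolding sym_V_def by (intro sym_alg_sum sym_alg_mult) auto

lemma sym_alg_prod_U [simp]: "prod_U B X Y \<in> sym_alg B"
  unfolding prod_U_def by (intro sym_alg_prod) auto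

lemma sym_const_add: "sym_const (a + b) = sym_const a + sym_const b"
  by (simp add: sym_const_def single_add)

lemma sym_const_mult: "sym_const (a * b) = sym_const a * sym_const b"
  by (simp add: sym_const_def mult_single)

lemma sym_const_0 [simp]: "sym_const 0 = 0"
  by (simp add: sym_const_def)

lemma sym_const_1 [simp]: "sym_const 1 = 1"
  by (simp add: sym_const_def)

lemma vector_space_sym: "vector_space (\<lambda>c (f :: ('v, 'k::field) poly_alg). sym_const c * f)"
  by unfold_locales (simp_all add: sym_const_add sym_const_mult distrib_left distrib_right mult_ac)

interpretation sym: vector_space "\<lambda>c (f :: ('v, 'k::field) poly_alg). sym_const c * f"
  rewrites "module.span (\<lambda>c (f :: ('v, 'k::field) poly_alg). sym_const c * f) = sym_span"
  by (rule vector_space_sym) (simp add: sym_span_def)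

lemma sym_span_sym_alg: "G \<subseteq> sym_alg B \<Longrightarrow> sym_span G \<subseteq> sym_alg B"
  by (intro sym.span_minimal) (auto simp: sym.subspace_def)

section \<open>Evaluation of polynomials at a point\<close>

definition monom_val :: "('v \<Rightarrow> 'k::field) \<Rightarrow> ('v \<Rightarrow>\<^sub>0 nat) \<Rightarrow> 'k"
  where "monom_val \<phi> m = (\<Prod>b\<in>Poly_Mapping.keys m. \<phi> b ^ Poly_Mapping.lookup m b)"

definition sym_eval :: "('v \<Rightarrow> 'k::field) \<Rightarrow> ('v, 'k) poly_alg \<Rightarrow> 'k"
  where "sym_eval \<phi> f = (\<Sum>m\<in>Poly_Mapping.keys f. Poly_Mapping.lookup f m * monom_val \<phi> m)"

lemma monom_val_superset:
  assumes "finite A" "Poly_Mapping.keys m \<subseteq> A"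
  shows "monom_val \<phi> m = (\<Prod>b\<in>A. \<phi> b ^ Poly_Mapping.lookup m b)"
  unfolding monom_val_def
  by (intro prod.mono_neutral_left) (use assms in \<open>auto simp: not_in_keys_iff_lookup_eq_zero\<close>)

lemma monom_val_add: "monom_val \<phi> (m + n) = monom_val \<phi> m * monom_val \<phi> n"
proof -
  let ?A = "Poly_Mapping.keys m \<union> Poly_Mapping.keys n"
  have "Poly_Mapping.keys (m + n) \<subseteq> ?A" by (rule keys_add)
  then show ?thesis
    by (subst (1 2 3) monom_val_superset[where A = ?A])
      (auto simp: lookup_add power_add prod.distrib)
qed

lemma sym_eval_superset:
  assumes "finite A" "Poly_Mapping.keys f \<subseteq> A"
  shows "sym_eval \<phi> f = (\<Sum>m\<in>A. Poly_Mapping.lookup f m * monom_val \<phi> m)"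
  unfolding sym_eval_def
  by (intro sum.mono_neutral_left) (use assms in \<open>auto simp: not_in_keys_iff_lookup_eq_zero\<close>)

lemma sym_eval_add [simp]: "sym_eval \<phi> (f + g) = sym_eval \<phi> f + sym_eval \<phi> g"
proof -
  let ?A = "Poly_Mapping.keys f \<union> Poly_Mapping.keys g"
  have "Poly_Mapping.keys (f + g) \<subseteq> ?A" by (rule keys_add)
  then show ?thesis
    by (subst (1 2 3) sym_eval_superset[where A = ?A])
      (auto simp: lookup_add distrib_right sum.distrib)
qed

lemma sym_eval_0 [simp]: "sym_eval \<phi> 0 = 0"
  by (simp add: sym_eval_def)

lemma sym_eval_single: "sym_eval \<phi> (Poly_Mapping.single m c) = c * monom_val \<phi> m"
  by (subst sym_eval_superset[where A = "{m}"]) auto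

lemma sym_eval_mult [simp]: "sym_eval \<phi> (f * g) = sym_eval \<phi> f * sym_eval \<phi> g"
proof (induction f rule: poly_mapping_induct_single)
  case (single m c)
  show ?case
    by (induction g rule: poly_mapping_induct_single)
      (simp_all add: mult_single sym_eval_single monom_val_add distrib_left)
qed (simp_all add: distrib_right)

lemma sym_eval_const [simp]: "sym_eval \<phi> (sym_const c) = c"
  by (simp add: sym_const_def sym_eval_single monom_val_def)

lemma sym_eval_1 [simp]: "sym_eval \<phi> 1 = 1"
  using sym_eval_const[of \<phi> 1] by simp

lemma sym_eval_var [simp]: "sym_eval \<phi> (sym_var b) = \<phi> b"
  by (simp add: sym_var_def sym_eval_single monom_val_def)

lemma sym_eval_uminus [simp]: "sym_eval \<phi> (- f) = - sym_eval \<phi> f"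
  using sym_eval_add[of \<phi> f "- f"] by (simp add: add_eq_0_iff2 del: sym_eval_add)

lemma sym_eval_diff [simp]: "sym_eval \<phi> (f - g) = sym_eval \<phi> f - sym_eval \<phi> g"
  using sym_eval_add[of \<phi> f "- g"] by simp

lemma sym_eval_sum [simp]: "sym_eval \<phi> (\<Sum>i\<in>I. f i) = (\<Sum>i\<in>I. sym_eval \<phi> (f i))"
  by (induction I rule: infinite_finite_induct) simp_all

lemma sym_eval_prod [simp]: "sym_eval \<phi> (\<Prod>i\<in>I. f i) = (\<Prod>i\<in>I. sym_eval \<phi> (f i))"
  by (induction I rule: infinite_finite_induct) simp_all

lemma sym_eval_zero:
  fixes f :: "('v, 'k::field) poly_alg"
  shows "sym_eval (\<lambda>_. 0) f = Poly_Mapping.lookup f 0"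
proof -
  have "monom_val (\<lambda>_. 0) m = (if m = 0 then 1 else (0::'k))" for m :: "'v \<Rightarrow>\<^sub>0 nat"
  proof (cases "m = 0")
    case False
    then obtain b where "b \<in> Poly_Mapping.keys m" by fastforce
    then have "monom_val (\<lambda>_. 0 :: 'k) m = 0"
      unfolding monom_val_def by (intro prod_zero) (auto simp: in_keys_iff)
    with False show ?thesis by simp
  qed (simp add: monom_val_def)
  then show ?thesis
    by (simp add: sym_eval_def if_distrib[of "\<lambda>x. _ * x"] not_in_keys_iff_lookup_eq_zero cong: if_cong)
qed

section \<open>Total degree and homogeneous components\<close>

definition monom_deg :: "('v \<Rightarrow>\<^sub>0 nat) \<Rightarrow> nat"
  where "monom_deg m = (\<Sum>b\<in>Poly_Mapping.keys m. Poly_Mapping.lookup m b)"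

lemma monom_deg_add: "monom_deg (m + n) = monom_deg m + monom_deg n"
proof -
  have superset: "monom_deg m = (\<Sum>b\<in>A. Poly_Mapping.lookup m b)"
    if "finite A" "Poly_Mapping.keys m \<subseteq> A" for A and m :: "'a \<Rightarrow>\<^sub>0 nat"
    unfolding monom_deg_def
    by (intro sum.mono_neutral_left) (use that in \<open>auto simp: not_in_keys_iff_lookup_eq_zero\<close>)
  let ?A = "Poly_Mapping.keys m \<union> Poly_Mapping.keys n"
  have "Poly_Mapping.keys (m + n) \<subseteq> ?A" by (rule keys_add)
  then show ?thesis
    by (subst (1 2 3) superset[where A = ?A]) (auto simp: lookup_add sum.distrib)
qed

lemma sym_degree_le_iff: "sym_degree f \<le> d \<longleftrightarrow> (\<forall>m\<in>Poly_Mapping.keys f. monom_deg m \<le> d)"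
  unfolding sym_degree_def monom_deg_def by (subst Max_le_iff) auto

lemma sym_degree_const [simp]: "sym_degree (sym_const c) = 0"
proof -
  have "sym_degree (sym_const c) \<le> 0"
    unfolding sym_degree_le_iff by (simp add: sym_const_def monom_deg_def)
  then show ?thesis by simp
qed

lemma sym_degree_0 [simp]: "sym_degree 0 = 0"
  using sym_degree_const[of 0] by simp

lemma sym_degree_1 [simp]: "sym_degree 1 = 0"
  using sym_degree_const[of 1] by simp

lemma sym_degree_0_const:
  assumes "sym_degree f = 0"
  obtains c where "f = sym_const c"
proof -
  have "Poly_Mapping.keys f \<subseteq> {0}"
  proof
    fix m assume "m \<in> Poly_Mapping.keys f"
    then have "monom_deg m = 0" using sym_degree_le_iff[of f 0] assms by simp
    then have "m = 0" by (intro poly_mapping_eqI) (auto simp: monom_deg_def in_keys_iff)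
    then show "m \<in> {0}" by simp
  qed
  then have "f = sym_const (Poly_Mapping.lookup f 0)"
    by (intro poly_mapping_eqI) (auto simp: sym_const_def lookup_single when_def in_keys_iff)
  then show ?thesis by (rule that)
qed

lemma sym_degree_add: "sym_degree f \<le> d \<Longrightarrow> sym_degree g \<le> d \<Longrightarrow> sym_degree (f + g) \<le> d"
  using keys_add[of f g] by (auto simp: sym_degree_le_iff)

lemma sym_degree_sum: "(\<And>i. i \<in> I \<Longrightarrow> sym_degree (f i) \<le> d) \<Longrightarrow> sym_degree (\<Sum>i\<in>I. f i) \<le> d"
  by (induction I rule: infinite_finite_induct) (auto intro: sym_degree_add)

lemma sym_degree_mult: "sym_degree (f * g) \<le> sym_degree f + sym_degree g"
  unfolding sym_degree_le_iff
proof
  fix m assume "m \<in> Poly_Mapping.keys (f * g)"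
  then obtain a b where ab: "a \<in> Poly_Mapping.keys f" "b \<in> Poly_Mapping.keys g" "m = a + b"
    using keys_mult[of f g] by blast
  then show "monom_deg m \<le> sym_degree f + sym_degree g"
    using sym_degree_le_iff[of f "sym_degree f"] sym_degree_le_iff[of g "sym_degree g"]
    by (auto simp: monom_deg_add intro: add_mono)
qed

lemma sym_degree_var: "sym_degree (sym_var b :: ('v, 'k::field) poly_alg) = 1"
proof -
  have "Poly_Mapping.keys (sym_var b :: ('v, 'k) poly_alg) = {Poly_Mapping.single b 1}"
    by (simp add: sym_var_def)
  then show ?thesis by (simp add: sym_degree_def)
qed

text \<open>Homogeneity is recorded as scaling behaviour of values, since the components are later
  read off along lines through 0.\<close>

lemma sym_homogeneous_decomp:
  assumes "f \<in> sym_alg B"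
  obtains N F where "f = (\<Sum>d<N. F d)"
    and "\<And>d. F d \<in> sym_alg B" and "\<And>d. sym_degree (F d) \<le> d"
    and "\<And>d \<phi> t. sym_eval (\<lambda>b. t * \<phi> b) (F d) = t ^ d * sym_eval \<phi> (F d)"
proof -
  \<comment> \<open>Vanishing from \<open>N\<close> on is added to the claim so that two
    decompositions can be padded to a common length in the additive step.\<close>
  have "\<exists>N F. f = (\<Sum>d<N. F d) \<and> (\<forall>d. F d \<in> sym_alg B) \<and> (\<forall>d. sym_degree (F d) \<le> d)
      \<and> (\<forall>d \<phi> t. sym_eval (\<lambda>b. t * \<phi> b) (F d) = t ^ d * sym_eval \<phi> (F d))
      \<and> (\<forall>d\<ge>N. F d = 0)"
    using assms
  proof (induction rule: sym_alg_induct)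
    case (const c)
    show ?case
      by (intro exI[of _ 1] exI[of _ "\<lambda>d. if d = 0 then sym_const c else 0"]) simp
  next
    case (var_mult b f)
    then obtain N F where F: "f = (\<Sum>d<N. F d)" "\<forall>d. F d \<in> sym_alg B" "\<forall>d. sym_degree (F d) \<le> d"
      "\<forall>d \<phi> t. sym_eval (\<lambda>b. t * \<phi> b) (F d) = t ^ d * sym_eval \<phi> (F d)" "\<forall>d\<ge>N. F d = 0" by blast
    define G where "G d = (case d of 0 \<Rightarrow> 0 | Suc d \<Rightarrow> sym_var b * F d)" for d
    have "sym_var b * f = (\<Sum>d<Suc N. G d)"
      by (simp only: sum.lessThan_Suc_shift F(1) sum_distrib_left) (simp add: G_def)
    moreover have "G d \<in> sym_alg B" for d
      using F(2) var_mult(1) by (auto simp: G_def split: nat.split)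
    moreover have "sym_degree (G d) \<le> d" for d
    proof (cases d)
      case (Suc e)
      have "sym_degree (sym_var b * F e) \<le> 1 + e"
        using sym_degree_mult[of "sym_var b" "F e"] F(3)[rule_format, of e]
        unfolding sym_degree_var by linarith
      then show ?thesis by (simp add: G_def Suc)
    qed (simp add: G_def)
    moreover have "sym_eval (\<lambda>b. t * \<phi> b) (G d) = t ^ d * sym_eval \<phi> (G d)" for d \<phi> t
      using F(4) by (simp add: G_def split: nat.split)
    moreover have "\<forall>d\<ge>Suc N. G d = 0"
      using F(5) by (simp add: G_def split: nat.split)
    ultimately show ?case by (intro exI[of _ "Suc N"] exI[of _ G]) simp
  next
    case (add f g)
    from add.IH(1) obtain N F where
      F: "f = (\<Sum>d<N. F d)" "\<forall>d. F d \<in> sym_alg B" "\<forall>d. sym_degree (F d) \<le> d"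
      "\<forall>d \<phi> t. sym_eval (\<lambda>b. t * \<phi> b) (F d) = t ^ d * sym_eval \<phi> (F d)" "\<forall>d\<ge>N. F d = 0"
      by (elim exE conjE) rule
    from add.IH(2) obtain N' F' where
      F': "g = (\<Sum>d<N'. F' d)" "\<forall>d. F' d \<in> sym_alg B" "\<forall>d. sym_degree (F' d) \<le> d"
      "\<forall>d \<phi> t. sym_eval (\<lambda>b. t * \<phi> b) (F' d) = t ^ d * sym_eval \<phi> (F' d)" "\<forall>d\<ge>N'. F' d = 0"
      by (elim exE conjE) rule
    have "f = (\<Sum>d<max N N'. F d)"
      unfolding F(1) using F(5) by (intro sum.mono_neutral_left) auto
    moreover have "g = (\<Sum>d<max N N'. F' d)"
      unfolding F'(1) using F'(5) by (intro sum.mono_neutral_left) auto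
    ultimately show ?case
      using F(2-) F'(2-)
      by (intro exI[of _ "max N N'"] exI[of _ "\<lambda>d. F d + F' d"])
        (auto simp: sum.distrib distrib_left intro: sym_degree_add)
  qed
  then show ?thesis using that by blast
qed

section \<open>Directional derivatives\<close>

lemma sym_act_V_const [simp]: "sym_act (sym_V scale B v) (sym_const c) = 0"
  unfolding sym_act_V by (rule sum.neutral) (simp add: sym_const_def sym_act_var_single)

lemma sym_act_V_sym_alg:
  assumes "f \<in> sym_alg B"
  shows "sym_act (sym_V scale B v) f \<in> sym_alg B"
  using assms
proof (induction rule: sym_alg_induct)
  case (var_mult b f)
  have "sym_act (sym_V scale B v) (sym_var b) \<in> sym_alg B"
    unfolding sym_act_V by (intro sym_alg_sum sym_alg_mult) (simp_all add: sym_act_var_var)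
  with var_mult show ?case
    unfolding sym_act_V_Leibniz by (intro sym_alg_add sym_alg_mult) simp_all
qed (auto simp: sym_act_add_right)

text \<open>Truncated subtraction puts a factor 0 into a falling factorial as soon as an exponent of
  \<open>a\<close> exceeds that of \<open>m\<close>, so a nonzero coefficient means that
  \<open>a\<close> divides \<open>m\<close>.\<close>

lemma diff_coeff_neq_0_imp_add:
  assumes "diff_coeff a m \<noteq> 0"
  shows "m = a + (m - a)"
proof (rule poly_mapping_eqI)
  fix b
  have "Poly_Mapping.lookup a b \<le> Poly_Mapping.lookup m b"
  proof (rule ccontr)
    assume "\<not> ?thesis"
    then have "b \<in> Poly_Mapping.keys a"
      "(\<Prod>i<Poly_Mapping.lookup a b. Poly_Mapping.lookup m b - i) = 0"
      by (auto simp: in_keys_iff intro!: bexI[of _ "Poly_Mapping.lookup m b"])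
    with assms show False by (auto simp: diff_coeff_def)
  qed
  then show "Poly_Mapping.lookup m b = Poly_Mapping.lookup (a + (m - a)) b"
    by (simp add: lookup_add lookup_minus)
qed

lemma diff_coeff_self: "diff_coeff m m \<noteq> 0"
  by (auto simp: diff_coeff_def)

text \<open>Only \<open>m\<close> itself is sent to a nonzero constant by the derivative belonging
  to \<open>m\<close>, with factor m!. In characteristic zero this makes the pairing of operators
  with polynomials nondegenerate.\<close>

lemma lookup_sym_act_single:
  "Poly_Mapping.lookup (sym_act (Poly_Mapping.single m 1) f) 0
    = Poly_Mapping.lookup f m * of_nat (diff_coeff m m)"
proof -
  have "Poly_Mapping.lookup (sym_act (Poly_Mapping.single m 1) f) 0
      = (\<Sum>m'\<in>Poly_Mapping.keys f. Poly_Mapping.lookup (Poly_Mapping.single (m' - m)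
          (Poly_Mapping.lookup f m' * of_nat (diff_coeff m m'))) 0)"
    by (simp add: sym_act_def lookup_sum)
  also have "\<dots> = (\<Sum>m'\<in>Poly_Mapping.keys f.
      if m' = m then Poly_Mapping.lookup f m * of_nat (diff_coeff m m) else 0)"
  proof (intro sum.cong refl)
    fix m'
    have "m' = m" if "m' - m = 0" "diff_coeff m m' \<noteq> 0"
      using diff_coeff_neq_0_imp_add[OF that(2)] that(1) by simp
    then show "Poly_Mapping.lookup (Poly_Mapping.single (m' - m)
        (Poly_Mapping.lookup f m' * of_nat (diff_coeff m m'))) 0
      = (if m' = m then Poly_Mapping.lookup f m * of_nat (diff_coeff m m) else 0)"
      by (cases "diff_coeff m m' = 0") (auto simp: lookup_single when_def diff_coeff_self)
  qed
  also have "\<dots> = Poly_Mapping.lookup f m * of_nat (diff_coeff m m)"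
    by (simp add: in_keys_iff)
  finally show ?thesis .
qed

lemma coeff_funpow_pderiv:
  "coeff ((pderiv ^^ n) p) i = (\<Prod>j<n. of_nat (Suc (i + j))) * coeff p (i + n)"
proof (induction n arbitrary: i)
  case (Suc n)
  have "(\<Prod>j<Suc n. of_nat (Suc (i + j))) = of_nat (Suc i) * (\<Prod>j<n. of_nat (Suc (Suc i + j)) :: 'a)"
    unfolding prod.lessThan_Suc_shift by simp
  then show ?case
    by (simp add: coeff_pderiv Suc mult.assoc del: of_nat_Suc prod.lessThan_Suc)
qed simp

text \<open>The factors picked up by repeated differentiation are positive integers, hence nonzero
  in characteristic zero.\<close>

lemma funpow_pderiv_eq_0_iff:
  fixes p :: "'a :: field_char_0 poly"
  shows "(pderiv ^^ n) p = 0 \<longleftrightarrow> (\<forall>i\<ge>n. coeff p i = 0)"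
proof -
  have "(\<Prod>j<n. of_nat (Suc (i + j)) :: 'a) \<noteq> 0" for i
    by (subst prod_zero_iff) (simp_all del: of_nat_Suc)
  then have "(pderiv ^^ n) p = 0 \<longleftrightarrow> (\<forall>i. coeff p (i + n) = 0)"
    by (simp add: poly_eq_iff coeff_funpow_pderiv del: of_nat_Suc)
  also have "\<dots> \<longleftrightarrow> (\<forall>i\<ge>n. coeff p i = 0)"
    by (metis add.commute le_Suc_ex le_add2)
  finally show ?thesis .
qed

locale polynomial_functions = finite_dimensional_vector_space scale B
  for scale :: "'k::field_char_0 \<Rightarrow> 'v::ab_group_add \<Rightarrow> 'v" (infixr "*s" 75) and B :: "'v set"
begin

definition ev :: "('v, 'k) poly_alg \<Rightarrow> 'v \<Rightarrow> 'k"
  where "ev f v = sym_eval (\<lambda>b. representation B v b) f"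

lemma representation_add' [simp]:
  "representation B (v + w) b = representation B v b + representation B w b"
  by (simp add: representation_add independent_Basis span_Basis)

lemma representation_scale' [simp]: "representation B (c *s v) b = c * representation B v b"
  by (simp add: representation_scale independent_Basis span_Basis)

lemma ev_simps [simp]:
  "ev (f + g) v = ev f v + ev g v" "ev (f - g) v = ev f v - ev g v"
  "ev (f * g) v = ev f v * ev g v" "ev 0 v = 0" "ev 1 v = 1" "ev (sym_const c) v = c"
  "ev (sym_var b) v = representation B v b"
  "ev (\<Sum>i\<in>I. F i) v = (\<Sum>i\<in>I. ev (F i) v)" "ev (\<Prod>i\<in>I. F i) v = (\<Prod>i\<in>I. ev (F i) v)"
  by (simp_all add: ev_def)

lemma dual_add: "u \<in> dual_space (*s) \<Longrightarrow> u (v + w) = u v + u w"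
  and dual_scale: "u \<in> dual_space (*s) \<Longrightarrow> u (c *s v) = c * u v"
  unfolding dual_space_def mem_Collect_eq module_hom_iff_linear[symmetric]
  by (simp_all add: module_hom.add module_hom.scale)

lemma dual_0: "u \<in> dual_space (*s) \<Longrightarrow> u 0 = 0"
  using dual_scale[of u 0 0] by simp

lemma dual_diff: "u \<in> dual_space (*s) \<Longrightarrow> u (v - w) = u v - u w"
  using dual_add[of u "v - w" w] by simp

lemma dual_sum: "u \<in> dual_space (*s) \<Longrightarrow> u (\<Sum>i\<in>I. F i) = (\<Sum>i\<in>I. u (F i))"
  by (induction I rule: infinite_finite_induct) (simp_all add: dual_0 dual_add)

lemma sum_representation: "(\<Sum>b\<in>B. representation B v b *s b) = v"
  by (intro sum_representation_eq independent_Basis finite_Basis) (simp_all add: span_Basis)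

lemma ev_sym_U [simp]:
  assumes "u \<in> dual_space (*s)"
  shows "ev (sym_U B u) v = u v"
proof -
  have "u v = u (\<Sum>b\<in>B. representation B v b *s b)"
    by (simp only: sum_representation)
  also have "\<dots> = (\<Sum>b\<in>B. u b * representation B v b)"
    by (simp add: dual_sum dual_scale assms mult.commute)
  finally show ?thesis by (simp add: sym_U_def)
qed

text \<open>On a line in direction \<open>w\<close> the derivation becomes the formal derivative.
  Value and derivative are treated together because the product rule needs both.\<close>

lemma ev_line_poly:
  assumes "f \<in> sym_alg B"
  obtains p where "\<And>t. ev f (v + t *s w) = poly p t"
    and "\<And>t. ev (sym_act (sym_V (*s) B w) f) (v + t *s w) = poly (pderiv p) t"
proof -
  have "\<exists>p. \<forall>t. ev f (v + t *s w) = poly p t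
      \<and> ev (sym_act (sym_V (*s) B w) f) (v + t *s w) = poly (pderiv p) t"
    using assms
  proof (induction rule: sym_alg_induct)
    case (const c)
    show ?case by (intro exI[of _ "[:c:]"]) (simp add: pderiv_pCons)
  next
    case (var_mult b f)
    then obtain p where p: "\<And>t. ev f (v + t *s w) = poly p t"
      "\<And>t. ev (sym_act (sym_V (*s) B w) f) (v + t *s w) = poly (pderiv p) t" by blast
    let ?q = "[:representation B v b, representation B w b:]"
    have "ev (sym_act (sym_V (*s) B w) (sym_var b)) z = representation B w b" for z
    proof -
      have "ev (sym_act (sym_V (*s) B w) (sym_var b)) z
          = (\<Sum>b'\<in>B. if b' = b then representation B w b else 0)"
        by (simp only: sym_act_V sym_act_var_var ev_simps) (intro sum.cong, auto)
      then show ?thesis using var_mult(1) finite_Basis by simp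
    qed
    note b = this
    have q: "poly (pderiv (?q * p)) t =
        representation B w b * poly p t + poly ?q t * poly (pderiv p) t" for t
      unfolding pderiv_mult by (simp add: pderiv_pCons algebra_simps)
    show ?case
      by (intro exI[of _ "?q * p"] allI conjI; (simp only: q sym_act_V_Leibniz ev_simps b p)?)
        (simp_all add: p algebra_simps)
  next
    case (add f g)
    then obtain p q where
      "\<And>t. ev f (v + t *s w) = poly p t"
      "\<And>t. ev (sym_act (sym_V (*s) B w) f) (v + t *s w) = poly (pderiv p) t"
      "\<And>t. ev g (v + t *s w) = poly q t"
      "\<And>t. ev (sym_act (sym_V (*s) B w) g) (v + t *s w) = poly (pderiv q) t" by blast
    then show ?case
      by (intro exI[of _ "p + q"]) (simp add: sym_act_add_right pderiv_add)
  qed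
  then show ?thesis using that by blast
qed

lemma ev_line_pderiv:
  assumes "f \<in> sym_alg B" and p: "\<And>t. ev f (v + t *s w) = poly p t"
  shows "ev (sym_act (sym_V (*s) B w ^ n) f) (v + t *s w) = poly ((pderiv ^^ n) p) t
    \<and> sym_act (sym_V (*s) B w ^ n) f \<in> sym_alg B"
proof (induction n arbitrary: t)
  case 0
  show ?case using assms by (simp add: sym_act_one)
next
  case (Suc n)
  let ?g = "sym_act (sym_V (*s) B w ^ n) f"
  have g: "?g \<in> sym_alg B" using Suc by blast
  obtain q where q: "\<And>t. ev ?g (v + t *s w) = poly q t"
    "\<And>t. ev (sym_act (sym_V (*s) B w) ?g) (v + t *s w) = poly (pderiv q) t"
    using ev_line_poly[OF g, of v w] by blast
  have "poly q = poly ((pderiv ^^ n) p)" using Suc q(1) by (intro ext) metis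
  then have "q = (pderiv ^^ n) p" by (simp only: poly_eq_poly_eq_iff)
  with q(2) sym_act_V_sym_alg[OF g] show ?case
    by (simp add: sym_act_mult)
qed

lemma sym_V_basis: "b \<in> B \<Longrightarrow> sym_V (*s) B b = sym_var b"
proof -
  assume b: "b \<in> B"
  have "sym_V (*s) B b = (\<Sum>b'\<in>B. if b' = b then sym_var b else 0)"
    unfolding sym_V_def
    by (intro sum.cong) (auto simp: representation_basis independent_Basis b)
  then show ?thesis using b finite_Basis by simp
qed

text \<open>
  If a polynomial vanishes as a function, so do all its derivatives, and their values at 0 are
  nonzero multiples of the coefficients.
\<close>

lemma ev_inject:
  assumes f: "f \<in> sym_alg B" and g: "g \<in> sym_alg B" and eq: "\<And>v. ev f v = ev g v"
  shows "f = g"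
proof -
  let ?h = "f - g"
  have h: "?h \<in> sym_alg B" using f g by blast
  have act: "(\<forall>v. ev (sym_act q ?h) v = 0) \<and> sym_act q ?h \<in> sym_alg B" if "q \<in> sym_alg B" for q
    using that
  proof (induction rule: sym_alg_induct)
    case (const c)
    show ?case using eq h by (auto simp: sym_act_const)
  next
    case (var_mult b q)
    let ?d = "sym_act q ?h"
    have "ev (sym_act (sym_var b) ?d) v = 0" for v
    proof -
      have "?d \<in> sym_alg B" using var_mult by blast
      from ev_line_poly[OF this, of v b] obtain p where
        p: "\<And>t. ev ?d (v + t *s b) = poly p t"
        "\<And>t. ev (sym_act (sym_V (*s) B b) ?d) (v + t *s b) = poly (pderiv p) t" by blast
      have "poly p = poly 0" using p(1) var_mult by auto
      then have "p = 0" by (simp only: poly_eq_poly_eq_iff)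
      with p(2)[of 0] var_mult(1) show ?thesis by (simp add: sym_V_basis)
    qed
    with var_mult sym_act_V_sym_alg[of ?d B "(*s)" b] show ?case
      by (simp add: sym_act_mult sym_V_basis)
  qed (auto simp: sym_act_add_left)
  have "Poly_Mapping.lookup ?h m = 0" for m
  proof (rule ccontr)
    assume m: "Poly_Mapping.lookup ?h m \<noteq> 0"
    let ?q = "Poly_Mapping.single m (1::'k)"
    have "Poly_Mapping.keys m \<subseteq> B"
      using h m by (auto simp: sym_alg_def in_keys_iff)
    then have "?q \<in> sym_alg B" by (simp add: sym_alg_def)
    with act have "ev (sym_act ?q ?h) 0 = 0" by blast
    then have "Poly_Mapping.lookup (sym_act ?q ?h) 0 = 0"
      by (simp add: ev_def representation_zero sym_eval_zero)
    with m show False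
      by (simp add: lookup_sym_act_single diff_coeff_self del: lookup_minus)
  qed
  then have "?h = 0" by (intro poly_mapping_eqI) simp
  then show ?thesis by simp
qed

text \<open>
  \<open>f\<close> restricted to the subset \<open>W\<close> has degree less than \<open>e\<close> in the direction \<open>\<eta>\<close>; for \<open>e = 0\<close>
  this means that \<open>f\<close> vanishes on \<open>W\<close>.
\<close>

definition deg_below :: "nat \<Rightarrow> 'v set \<Rightarrow> ('v, 'k) poly_alg \<Rightarrow> 'v \<Rightarrow> bool"
  where "deg_below e W f \<eta> \<longleftrightarrow>
    (\<forall>v\<in>W. \<exists>p. (\<forall>i\<ge>e. coeff p i = 0) \<and> (\<forall>t. ev f (v + t *s \<eta>) = poly p t))"

text \<open>The field is infinite, so the polynomial describing \<open>f\<close> on a line is unique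
  and any description can be used.\<close>

lemma deg_belowD:
  assumes "deg_below e W f \<eta>" "v \<in> W" "\<And>t. ev f (v + t *s \<eta>) = poly p t" "i \<ge> e"
  shows "coeff p i = 0"
proof -
  obtain q where "\<forall>i\<ge>e. coeff q i = 0" "\<And>t. ev f (v + t *s \<eta>) = poly q t"
    using assms(1,2) unfolding deg_below_def by blast
  moreover from this have "poly p = poly q" using assms(3) by auto
  then have "p = q" by (simp only: poly_eq_poly_eq_iff)
  ultimately show ?thesis using assms(4) by blast
qed

text \<open>The bridge from operators to functions: on each line the operator is the
  \<open>e\<close>-fold formal derivative, whose kernel consists of the polynomials of degree less
  than \<open>e\<close>.\<close>

lemma sym_act_V_power_eq_0_iff:
  assumes f: "f \<in> sym_alg B"
  shows "sym_act (sym_V (*s) B \<eta> ^ e) f = 0 \<longleftrightarrow> deg_below e UNIV f \<eta>"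
proof
  assume 0: "sym_act (sym_V (*s) B \<eta> ^ e) f = 0"
  show "deg_below e UNIV f \<eta>"
    unfolding deg_below_def
  proof
    fix v
    obtain p where p: "\<And>t. ev f (v + t *s \<eta>) = poly p t"
      using ev_line_poly[OF f] by metis
    have "poly ((pderiv ^^ e) p) = poly 0"
      using ev_line_pderiv[OF f p, of e] 0 by auto
    then have "(pderiv ^^ e) p = 0" by (simp only: poly_eq_poly_eq_iff)
    with p show "\<exists>p. (\<forall>i\<ge>e. coeff p i = 0) \<and> (\<forall>t. ev f (v + t *s \<eta>) = poly p t)"
      by (auto simp: funpow_pderiv_eq_0_iff)
  qed
next
  assume deg: "deg_below e UNIV f \<eta>"
  show "sym_act (sym_V (*s) B \<eta> ^ e) f = 0"
  proof (rule ev_inject)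
    show "sym_act (sym_V (*s) B \<eta> ^ e) f \<in> sym_alg B"
      using ev_line_poly[OF f] ev_line_pderiv[OF f] by metis
    fix v
    obtain p where p: "\<forall>i\<ge>e. coeff p i = 0" "\<And>t. ev f (v + t *s \<eta>) = poly p t"
      using deg unfolding deg_below_def by blast
    then have "(pderiv ^^ e) p = 0" by (simp add: funpow_pderiv_eq_0_iff)
    then show "ev (sym_act (sym_V (*s) B \<eta> ^ e) f) v = ev 0 v"
      using ev_line_pderiv[OF f p(2), of e 0] by simp
  qed simp
qed

end

context polynomial_functions
begin

section \<open>Degrees in a direction\<close>

lemma deg_below_mono:
  assumes "deg_below e W f \<eta>" "e \<le> e'" "W' \<subseteq> W"
  shows "deg_below e' W' f \<eta>"
  using assms unfolding deg_below_def by (meson le_trans subsetD)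

lemma deg_below_0 [simp]: "deg_below e W 0 \<eta>"
  unfolding deg_below_def by (auto intro!: exI[of _ 0])

lemma deg_below_add:
  assumes "deg_below e W f \<eta>" "deg_below e W g \<eta>"
  shows "deg_below e W (f + g) \<eta>"
  unfolding deg_below_def
proof
  fix v assume "v \<in> W"
  with assms obtain p q where "\<forall>i\<ge>e. coeff p i = 0" "\<forall>t. ev f (v + t *s \<eta>) = poly p t"
    "\<forall>i\<ge>e. coeff q i = 0" "\<forall>t. ev g (v + t *s \<eta>) = poly q t"
    unfolding deg_below_def by metis
  then show "\<exists>p. (\<forall>i\<ge>e. coeff p i = 0) \<and> (\<forall>t. ev (f + g) (v + t *s \<eta>) = poly p t)"
    by (intro exI[of _ "p + q"]) simp
qed

lemma deg_below_const_mult: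
  assumes "deg_below e W f \<eta>"
  shows "deg_below e W (sym_const c * f) \<eta>"
  unfolding deg_below_def
proof
  fix v assume "v \<in> W"
  with assms obtain p where "\<forall>i\<ge>e. coeff p i = 0" "\<forall>t. ev f (v + t *s \<eta>) = poly p t"
    unfolding deg_below_def by metis
  then show "\<exists>p. (\<forall>i\<ge>e. coeff p i = 0) \<and> (\<forall>t. ev (sym_const c * f) (v + t *s \<eta>) = poly p t)"
    by (intro exI[of _ "smult c p"]) simp
qed

lemma deg_below_diff:
  assumes "deg_below e W f \<eta>" "deg_below e W g \<eta>"
  shows "deg_below e W (f - g) \<eta>"
proof -
  have "f - g = f + sym_const (- 1) * g"
    using sym_const_add[of 1 "- 1 :: 'k"] by (simp add: eq_neg_iff_add_eq_0 add.commute)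
  then show ?thesis using assms by (simp only: deg_below_add deg_below_const_mult)
qed

lemma deg_below_span:
  assumes "\<And>g. g \<in> G \<Longrightarrow> deg_below e W g \<eta>" "f \<in> sym_span G"
  shows "deg_below e W f \<eta>"
  using assms(2)
  by (induction rule: sym.span_induct_alt) (auto intro: deg_below_add deg_below_const_mult assms(1))

text \<open>Needed because a normal of a hyperplane is determined only up to a factor.\<close>

lemma deg_below_scale:
  assumes "deg_below e W f \<eta>"
  shows "deg_below e W f (a *s \<eta>)"
  unfolding deg_below_def
proof
  fix v assume "v \<in> W"
  with assms obtain p where "\<forall>i\<ge>e. coeff p i = 0" "\<forall>t. ev f (v + t *s \<eta>) = poly p t"
    unfolding deg_below_def by metis
  then show "\<exists>p. (\<forall>i\<ge>e. coeff p i = 0) \<and> (\<forall>t. ev f (v + t *s a *s \<eta>) = poly p t)"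
    by (intro exI[of _ "pcompose p [:0, a:]"])
      (simp add: coeff_pcompose_linear poly_pcompose mult.commute)
qed

text \<open>Bound 1 along \<xi> makes \<open>f\<close> constant along \<xi> inside \<open>W\<close>,
  so shearing a line by multiples of \<xi> does not change the values on it.\<close>

lemma deg_below_shift:
  assumes W: "subspace W" "\<xi> \<in> W" "\<eta> \<in> W"
    and "deg_below 1 W f \<xi>" and "deg_below e W f \<eta>"
  shows "deg_below e W f (\<eta> + a *s \<xi>)"
  unfolding deg_below_def
proof
  fix v assume v: "v \<in> W"
  with assms obtain p where p: "\<forall>i\<ge>e. coeff p i = 0" "\<And>t. ev f (v + t *s \<eta>) = poly p t"
    unfolding deg_below_def by metis
  have const: "ev f (w + t *s \<xi>) = ev f w" if w: "w \<in> W" for w t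
  proof -
    obtain q where q: "\<forall>i\<ge>1. coeff q i = 0" "\<And>t. ev f (w + t *s \<xi>) = poly q t"
      using assms(4) w unfolding deg_below_def by metis
    then have "degree q = 0" by (metis leading_coeff_0_iff less_one not_le degree_0)
    then obtain d where "q = [:d:]" by (rule degree_eq_zeroE)
    with q(2)[of t] q(2)[of 0] show ?thesis by simp
  qed
  have "ev f (v + t *s (\<eta> + a *s \<xi>)) = poly p t" for t
  proof -
    have *: "v + t *s (\<eta> + a *s \<xi>) = (v + t *s \<eta>) + (t * a) *s \<xi>"
      by (simp add: scale_right_distrib add.assoc)
    have "v + t *s \<eta> \<in> W" using W v by (simp add: subspace_add subspace_scale)
    then show ?thesis unfolding * using const p(2) by simp
  qed
  with p(1) show "\<exists>p. (\<forall>i\<ge>e. coeff p i = 0) \<and> (\<forall>t. ev f (v + t *s (\<eta> + a *s \<xi>)) = poly p t)"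
    by blast
qed

lemma deg_below_mult:
  assumes "deg_below (Suc a) W f \<eta>" "deg_below (Suc b) W g \<eta>"
  shows "deg_below (Suc (a + b)) W (f * g) \<eta>"
  unfolding deg_below_def
proof
  fix v assume "v \<in> W"
  with assms obtain p q where p: "\<forall>i\<ge>Suc a. coeff p i = 0" "\<forall>t. ev f (v + t *s \<eta>) = poly p t"
    and q: "\<forall>i\<ge>Suc b. coeff q i = 0" "\<forall>t. ev g (v + t *s \<eta>) = poly q t"
    unfolding deg_below_def by metis
  have "degree p \<le> a" "degree q \<le> b" using p q by (auto intro: degree_le)
  then have "degree (p * q) \<le> a + b" using degree_mult_le[of p q] by linarith
  then show "\<exists>p. (\<forall>i\<ge>Suc (a + b). coeff p i = 0) \<and> (\<forall>t. ev (f * g) (v + t *s \<eta>) = poly p t)"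
    using p q by (intro exI[of _ "p * q"]) (auto intro: coeff_eq_0)
qed

lemma deg_below_sym_degree: "deg_below (Suc (sym_degree f)) W f \<eta>"
  unfolding deg_below_def
proof
  fix v
  let ?x = "\<lambda>b. [:representation B v b, representation B \<eta> b:]"
  let ?m = "\<lambda>m. \<Prod>b\<in>Poly_Mapping.keys m. ?x b ^ Poly_Mapping.lookup m b"
  let ?p = "\<Sum>m\<in>Poly_Mapping.keys f. smult (Poly_Mapping.lookup f m) (?m m)"
  have "degree (?m m) \<le> monom_deg m" for m
  proof -
    have "degree (?x b ^ n) \<le> n" for b n
      using degree_power_le[of "?x b" n] by (simp split: if_splits)
    then have "(\<Sum>b\<in>Poly_Mapping.keys m. degree (?x b ^ Poly_Mapping.lookup m b)) \<le> monom_deg m"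
      unfolding monom_deg_def by (intro sum_mono) blast
    then show ?thesis
      using degree_prod_sum_le[of "Poly_Mapping.keys m" "\<lambda>b. ?x b ^ Poly_Mapping.lookup m b"]
      by (simp add: o_def)
  qed
  then have "degree ?p \<le> sym_degree f"
    using sym_degree_le_iff[of f "sym_degree f"]
    by (intro degree_sum_le) (auto intro: order.trans[OF degree_smult_le] order.trans)
  moreover have "ev f (v + t *s \<eta>) = poly ?p t" for t
    by (simp add: ev_def sym_eval_def monom_val_def poly_sum poly_prod)
  ultimately show "\<exists>p. (\<forall>i\<ge>Suc (sym_degree f). coeff p i = 0)
      \<and> (\<forall>t. ev f (v + t *s \<eta>) = poly p t)"
    by (intro exI[of _ ?p]) (auto intro!: coeff_eq_0 simp del: coeff_sum)
qed

lemma deg_below_sym_U: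
  assumes "u \<in> dual_space (*s)"
  shows "deg_below (if u \<eta> = 0 then 1 else 2) W (sym_U B u) \<eta>"
  unfolding deg_below_def
proof
  fix v
  have "coeff [:u v, u \<eta>:] i = 0" if "i \<ge> (if u \<eta> = 0 then 1 else 2)" for i
    using that by (auto simp: coeff_pCons split: nat.split if_splits)
  then show "\<exists>p. (\<forall>i\<ge>if u \<eta> = 0 then 1 else 2. coeff p i = 0)
      \<and> (\<forall>t. ev (sym_U B u) (v + t *s \<eta>) = poly p t)"
    by (intro exI[of _ "[:u v, u \<eta>:]"]) (simp add: assms dual_add dual_scale)
qed

text \<open>Base point and direction of the line both move linearly with \<open>s\<close>. The outer
  variable of \<open>q\<close> is \<open>t\<close>, so its coefficients are polynomials in
  \<open>s\<close>.\<close>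

lemma ev_plane_poly:
  assumes "f \<in> sym_alg B"
  obtains q where "\<And>s t. ev f (v + s *s w + t *s (\<eta> + s *s \<xi>)) = poly (poly q [:t:]) s"
proof -
  have "\<exists>q. \<forall>s t. ev f (v + s *s w + t *s (\<eta> + s *s \<xi>)) = poly (poly q [:t:]) s"
    using assms
  proof (induction rule: sym_alg_induct)
    case (const c)
    show ?case by (intro exI[of _ "[:[:c:]:]"]) simp
  next
    case (var_mult b f)
    then obtain q where
      "\<And>s t. ev f (v + s *s w + t *s (\<eta> + s *s \<xi>)) = poly (poly q [:t:]) s" by blast
    then show ?case
      by (intro exI[of _ "[:[:representation B v b, representation B w b:],
          [:representation B \<eta> b, representation B \<xi> b:]:] * q"])
        (simp add: algebra_simps)
  next
    case (add f g)
    then obtain p q where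
      "\<And>s t. ev f (v + s *s w + t *s (\<eta> + s *s \<xi>)) = poly (poly p [:t:]) s"
      "\<And>s t. ev g (v + s *s w + t *s (\<eta> + s *s \<xi>)) = poly (poly q [:t:]) s" by blast
    then show ?case by (intro exI[of _ "p + q"]) simp
  qed
  then show ?thesis using that by blast
qed

text \<open>Each high coefficient in \<open>t\<close> is a polynomial in \<open>s\<close> that
  vanishes outside a finite set; being zero, it also vanishes at \<open>s = 0\<close>.\<close>

lemma deg_below_limit:
  assumes h: "h \<in> sym_alg B" and "finite S"
    and deg: "\<And>s. s \<notin> S \<Longrightarrow> deg_below e {v + s *s w} h (\<eta> + s *s \<xi>)"
  shows "deg_below e {v} h \<eta>"
proof -
  obtain q where q: "\<And>s t. ev h (v + s *s w + t *s (\<eta> + s *s \<xi>)) = poly (poly q [:t:]) s"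
    using ev_plane_poly[OF h] by metis
  define p where "p s = (\<Sum>n\<le>degree q. monom (poly (coeff q n) s) n)" for s
  have poly_p: "ev h (v + s *s w + t *s (\<eta> + s *s \<xi>)) = poly (p s) t" for s t
    unfolding q by (simp add: p_def poly_altdef[of q] poly_sum poly_monom poly_power)
  have coeff_p: "coeff (p s) n = poly (coeff q n) s" for s n
    by (auto simp: p_def coeff_sum sum.delta coeff_eq_0 not_le)
  have "coeff q n = 0" if n: "n \<ge> e" for n
  proof (rule ccontr)
    assume "coeff q n \<noteq> 0"
    then have "finite (S \<union> {s. poly (coeff q n) s = 0})"
      using \<open>finite S\<close> by (simp add: poly_roots_finite)
    then obtain s where s: "s \<notin> S" "poly (coeff q n) s \<noteq> 0"
      using ex_new_if_finite[OF infinite_UNIV_char_0] by blast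
    have "coeff (p s) n = 0"
      by (rule deg_belowD[OF deg[OF s(1)] _ poly_p n]) simp
    with s(2) show False by (simp add: coeff_p)
  qed
  then have "\<forall>i\<ge>e. coeff (p 0) i = 0" by (simp add: coeff_p)
  with poly_p[of 0] show ?thesis unfolding deg_below_def by auto
qed

lemma deg_below_pointwise: "(\<And>v. v \<in> W \<Longrightarrow> deg_below e {v} f \<eta>) \<Longrightarrow> deg_below e W f \<eta>"
  unfolding deg_below_def by blast

text \<open>On a line not contained in \<open>u = 0\<close>, dividing by the restriction of
  \<open>u\<close> lowers the degree by that of a nonzero linear polynomial: 1 if
  \<open>u \<eta>\<close> is nonzero, else 0. Lines inside \<open>u = 0\<close> say nothing about
  \<open>h\<close> directly and are reached as limits of parallel lines displaced along
  \<xi>.\<close>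

lemma deg_below_divide:
  assumes u: "u \<in> dual_space (*s)" and h: "h \<in> sym_alg B" and W: "subspace W" "\<eta> \<in> W"
    and eq: "\<And>v. v \<in> W \<Longrightarrow> ev f v = u v * ev h v"
    and deg: "deg_below e W f \<eta>" and \<xi>: "\<xi> \<in> W" "u \<xi> \<noteq> 0"
  shows "deg_below (if u \<eta> = 0 then e else e - 1) W h \<eta>"
proof -
  have ev_f: "ev f (v + t *s \<eta>) = (u v + t * u \<eta>) * ev h (v + t *s \<eta>)" if "v \<in> W" for v t
    using that W eq[of "v + t *s \<eta>"] u by (simp add: subspace_add subspace_scale dual_add dual_scale)
  have nonzero: "deg_below (if u \<eta> = 0 then e else e - 1) {v} h \<eta>"
    if v: "v \<in> W" and uv: "u \<eta> = 0 \<Longrightarrow> u v \<noteq> 0" for v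
  proof -
    obtain p where p: "\<And>t. ev h (v + t *s \<eta>) = poly p t"
      using ev_line_poly[OF h] by metis
    let ?l = "[:u v, u \<eta>:]"
    have l: "coeff (?l * p) i = 0" if "i \<ge> e" for i
      using ev_f[OF v] by (intro deg_belowD[OF deg v _ that]) (simp add: p algebra_simps)
    have "coeff p i = 0" if i: "i \<ge> (if u \<eta> = 0 then e else e - 1)" for i
    proof (cases "p = 0")
      case False
      have "?l \<noteq> 0" using uv by auto
      then have "degree (?l * p) = degree ?l + degree p" and "?l * p \<noteq> 0"
        using False by (rule degree_mult_eq) (use False \<open>?l \<noteq> 0\<close> no_zero_divisors in blast)
      then have "degree ?l + degree p < e"
        using l[of "degree (?l * p)"] leading_coeff_0_iff[of "?l * p"] by (metis not_le)
      then have "degree p < i" using i by (auto split: if_splits)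
      then show ?thesis by (rule coeff_eq_0)
    qed simp
    with p show ?thesis unfolding deg_below_def by (intro ballI exI[of _ p]) simp
  qed
  show ?thesis
  proof (rule deg_below_pointwise)
    fix v assume v: "v \<in> W"
    show "deg_below (if u \<eta> = 0 then e else e - 1) {v} h \<eta>"
    proof (cases "u \<eta> = 0 \<and> u v = 0")
      case True
      show ?thesis
      \<comment> \<open>The base point moves off the hyperplane \<open>u = 0\<close> while the
        direction stays fixed.\<close>
      proof (rule deg_below_limit[where S = "{0}" and w = \<xi> and \<xi> = 0, OF h])
        fix s assume "s \<notin> {0::'k}"
        then have "u (v + s *s \<xi>) \<noteq> 0" using True \<xi> u by (simp add: dual_add dual_scale)
        moreover have "v + s *s \<xi> \<in> W" using v \<xi> W by (simp add: subspace_add subspace_scale)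
        ultimately show "deg_below (if u \<eta> = 0 then e else e - 1) {v + s *s \<xi>} h (\<eta> + s *s 0)"
          using nonzero by simp
      qed simp
    next
      case False
      with v show ?thesis by (intro nonzero) auto
    qed
  qed
qed

text \<open>If \<open>u \<eta> = 1\<close>, the shifted point is the projection of \<open>v\<close>
  to \<open>u = 0\<close>, so a function vanishing there is a multiple of \<open>u\<close>. No
  coordinates adapted to \<open>u\<close> have to be chosen.\<close>

lemma ev_divide:
  assumes u: "u \<in> dual_space (*s)" and "f \<in> sym_alg B"
  obtains h where "h \<in> sym_alg B" "\<And>v. ev f v - ev f (v - u v *s \<eta>) = u v * ev h v"
proof -
  have "\<exists>h\<in>sym_alg B. \<forall>v. ev f v - ev f (v - u v *s \<eta>) = u v * ev h v"
    using assms(2)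
  proof (induction rule: sym_alg_induct)
    case (const c)
    show ?case by (intro bexI[of _ 0]) simp_all
  next
    case (var_mult b f)
    then obtain h where h: "h \<in> sym_alg B"
      "\<And>v. ev f v - ev f (v - u v *s \<eta>) = u v * ev h v" by blast
    let ?r = "representation B"
    \<comment> \<open>With x the coordinate of \<open>b\<close> and primes for values at the shifted
      point, x f - x' f' = (x - x') f + x' (f - f'); both differences carry a factor
      \<open>u\<close>.\<close>
    let ?h = "sym_const (?r \<eta> b) * f + (sym_var b - sym_const (?r \<eta> b) * sym_U B u) * h"
    have r: "?r (v - u v *s \<eta>) b = ?r v b - u v * ?r \<eta> b" for v
      using representation_add'[of "v - u v *s \<eta>" "u v *s \<eta>" b] by simp
    have f: "ev f (v - u v *s \<eta>) = ev f v - u v * ev h v" for v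
      using h(2)[of v] by (simp add: algebra_simps)
    have "\<forall>v. ev (sym_var b * f) v - ev (sym_var b * f) (v - u v *s \<eta>) = u v * ev ?h v"
      by (simp add: r f u) (simp add: algebra_simps)
    moreover have "?h \<in> sym_alg B"
      using var_mult h by (intro sym_alg_add sym_alg_mult sym_alg_diff) simp_all
    ultimately show ?case by blast
  next
    case (add f g)
    then obtain h h' where "h \<in> sym_alg B" "h' \<in> sym_alg B"
      "\<And>v. ev f v - ev f (v - u v *s \<eta>) = u v * ev h v"
      "\<And>v. ev g v - ev g (v - u v *s \<eta>) = u v * ev h' v" by blast
    then show ?case
      by (intro bexI[of _ "h + h'"])
        (auto simp: distrib_left add_diff_add)
  qed
  then show ?thesis using that by blast
qed

end

section \<open>Deletion and contraction\<close>

locale arrangement = polynomial_functions scale B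
  for scale :: "'k::field_char_0 \<Rightarrow> 'v::ab_group_add \<Rightarrow> 'v" (infixr "*s" 75) and B :: "'v set" +
  fixes X :: "('v \<Rightarrow> 'k) list"
  assumes set_X: "set X \<subseteq> dual_space (*s)"
begin

definition perp :: "nat set \<Rightarrow> 'v set"
  where "perp C = {v. \<forall>i\<in>C. (X ! i) v = 0}"

definition vanishing :: "nat set \<Rightarrow> 'v \<Rightarrow> nat set"
  where "vanishing A \<eta> = {i \<in> A. (X ! i) \<eta> = 0}"

lemma dual_X: "i \<in> ground X \<Longrightarrow> X ! i \<in> dual_space (*s)"
  using set_X by (auto simp: ground_def)

lemma subspace_perp: "C \<subseteq> ground X \<Longrightarrow> subspace (perp C)"
  by (rule subspaceI) (use dual_X in \<open>auto simp: perp_def dual_0 dual_add dual_scale\<close>)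

lemma perp_insert: "perp (insert i C) = {v \<in> perp C. (X ! i) v = 0}"
  by (auto simp: perp_def)

lemma vanishing_contract:
  assumes "i \<in> A" "(X ! i) \<eta> = 0"
  shows "A - {i} - vanishing (A - {i}) \<eta> = A - vanishing A \<eta>"
    and "insert i C \<union> vanishing (A - {i}) \<eta> = C \<union> vanishing A \<eta>"
  using assms by (auto simp: vanishing_def)

lemma deg_below_prod_U:
  assumes "finite Y" "Y \<subseteq> ground X"
  shows "deg_below (Suc (card (Y - vanishing Y \<eta>))) W (prod_U B X Y) \<eta>"
  using assms
proof (induction Y)
  case empty
  have "deg_below (Suc (sym_degree (1 :: ('v, 'k) poly_alg))) W 1 \<eta>" by (rule deg_below_sym_degree)
  then show ?case by (simp add: prod_U_def vanishing_def)
next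
  case (insert i Y)
  have u: "X ! i \<in> dual_space (*s)" using insert.prems by (simp add: dual_X)
  have "insert i Y - vanishing (insert i Y) \<eta> =
      (if (X ! i) \<eta> = 0 then Y - vanishing Y \<eta> else insert i (Y - vanishing Y \<eta>))"
    using insert.hyps by (auto simp: vanishing_def)
  then have card: "Suc (card (insert i Y - vanishing (insert i Y) \<eta>)) =
      Suc ((if (X ! i) \<eta> = 0 then 0 else 1) + card (Y - vanishing Y \<eta>))"
    using insert.hyps by simp
  have "deg_below (Suc (if (X ! i) \<eta> = 0 then 0 else 1)) W (sym_U B (X ! i)) \<eta>"
    using deg_below_sym_U[OF u, of \<eta> W] by (simp split: if_splits add: numeral_2_eq_2)
  from deg_below_mult[OF this insert.IH] insert show ?case
    unfolding card by (simp add: prod_U_def)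
qed

end

text \<open>\<open>c\<close> abstracts the indicator of an upper set as a function of arbitrary
  index sets. Thus minors need neither a lattice of flats nor an upper set of their own.\<close>

locale weighted_arrangement = arrangement scale B X
  for scale :: "'k::field_char_0 \<Rightarrow> 'v::ab_group_add \<Rightarrow> 'v" (infixr "*s" 75) and B :: "'v set"
    and X :: "('v \<Rightarrow> 'k) list" +
  fixes c :: "nat set \<Rightarrow> nat"
  assumes c_mono: "S \<subseteq> T \<Longrightarrow> T \<subseteq> ground X \<Longrightarrow> c S \<le> c T"
    and c_le_1: "c S \<le> 1"
begin

text \<open>
  The generators for the minor that contracts \<open>C\<close> and deletes the complement of \<open>C \<union> A\<close>; its
  polynomials are regarded as functions on \<open>perp C\<close> only.
\<close>

definition gens :: "nat \<Rightarrow> nat set \<Rightarrow> nat set \<Rightarrow> ('v, 'k) poly_alg set"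
  where "gens k C A = {g * prod_U B X Y | g Y.
    Y \<subseteq> A \<and> g \<in> sym_alg B \<and> sym_degree g < k + c (C \<union> (A - Y))}"

lemma gens_subset_sym_alg: "gens k C A \<subseteq> sym_alg B"
  unfolding gens_def by (auto intro: sym_alg_mult)

text \<open>Either \<open>Y\<close> contains every functional of \<open>A\<close> nonzero at \<eta>,
  and then \<open>A - Y\<close> lies in the zero set of \<eta> and monotonicity of \<open>c\<close>
  applies; or one such factor is missing, and the degree saved pays for
  \<open>c \<le> 1\<close>.\<close>

lemma deg_below_gens:
  assumes C: "C \<subseteq> ground X" and A: "A \<subseteq> ground X" and g: "g \<in> sym_span (gens k C A)"
  shows "deg_below (card (A - vanishing A \<eta>) + k + c (C \<union> vanishing A \<eta>)) W g \<eta>"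
  using g
proof (rule deg_below_span[rotated])
  fix g assume "g \<in> gens k C A"
  then obtain f Y where g: "g = f * prod_U B X Y" and Y: "Y \<subseteq> A"
    and deg: "sym_degree f < k + c (C \<union> (A - Y))"
    by (auto simp: gens_def)
  have "finite A" using A by (rule finite_subset) (simp add: ground_def)
  then have "finite Y" using Y by (rule rev_finite_subset)
  let ?y = "card (Y - vanishing Y \<eta>)" and ?m = "card (A - vanishing A \<eta>)"
  have sub: "Y - vanishing Y \<eta> \<subseteq> A - vanishing A \<eta>" using Y by (auto simp: vanishing_def)
  then have le: "?y \<le> ?m" using \<open>finite A\<close> by (intro card_mono) auto
  have "Suc (sym_degree f + ?y) \<le> ?m + k + c (C \<union> vanishing A \<eta>)"
  proof (cases "?y = ?m")
    case True
    then have "Y - vanishing Y \<eta> = A - vanishing A \<eta>"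
      using sub \<open>finite A\<close> by (intro card_subset_eq) auto
    then have "C \<union> (A - Y) \<subseteq> C \<union> vanishing A \<eta>" by auto
    then have "c (C \<union> (A - Y)) \<le> c (C \<union> vanishing A \<eta>)"
      using A C by (intro c_mono) (auto simp: vanishing_def)
    with True deg show ?thesis by simp
  next
    case False
    with le c_le_1[of "C \<union> (A - Y)"] deg show ?thesis by linarith
  qed
  moreover have "deg_below (Suc (sym_degree f + ?y)) W g \<eta>"
    unfolding g using \<open>finite Y\<close> Y A
    by (intro deg_below_mult deg_below_sym_degree deg_below_prod_U) auto
  ultimately show "deg_below (?m + k + c (C \<union> vanishing A \<eta>)) W g \<eta>"
    using deg_below_mono by blast
qed

text \<open>Moving \<open>i\<close> from \<open>A\<close> to \<open>C\<close> leaves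
  \<open>C \<union> (A - Y)\<close> unchanged when \<open>Y\<close> avoids \<open>i\<close>.\<close>

lemma gens_contract: "i \<in> A \<Longrightarrow> gens k (insert i C) (A - {i}) \<subseteq> gens k C A"
proof
  fix x assume i: "i \<in> A" and "x \<in> gens k (insert i C) (A - {i})"
  then obtain g Y where x: "x = g * prod_U B X Y" and Y: "Y \<subseteq> A - {i}" and g: "g \<in> sym_alg B"
    "sym_degree g < k + c (insert i C \<union> (A - {i} - Y))" by (auto simp: gens_def)
  have "insert i C \<union> (A - {i} - Y) = C \<union> (A - Y)" using Y i by auto
  with x Y g show "x \<in> gens k C A" by (auto simp: gens_def)
qed

text \<open>The new factor puts \<open>i\<close> into \<open>Y\<close>, so the complement that
  determines the weight is the same in both minors.\<close>

lemma gens_delete: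
  assumes i: "i \<in> A" and A: "finite A" and g: "g \<in> sym_span (gens k C (A - {i}))"
  shows "sym_U B (X ! i) * g \<in> sym_span (gens k C A)"
  using g
proof (induction rule: sym.span_induct_alt)
  case base
  show ?case by (simp add: sym.span_zero)
next
  case (step a x y)
  from step.hyps(1) obtain g Y where x: "x = g * prod_U B X Y" and Y: "Y \<subseteq> A - {i}"
    and g: "g \<in> sym_alg B" "sym_degree g < k + c (C \<union> (A - {i} - Y))" by (auto simp: gens_def)
  have "finite Y" using Y A by (meson finite_Diff rev_finite_subset)
  then have "sym_U B (X ! i) * x = g * prod_U B X (insert i Y)"
    using Y by (subst prod_U_def, subst prod.insert) (auto simp: x prod_U_def mult_ac)
  moreover have "A - {i} - Y = A - insert i Y" by auto
  ultimately have "sym_U B (X ! i) * x \<in> gens k C A"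
    using g Y i unfolding gens_def by (intro CollectI exI[of _ g] exI[of _ "insert i Y"]) auto
  then have "sym_const a * (sym_U B (X ! i) * x) + sym_U B (X ! i) * y \<in> sym_span (gens k C A)"
    using step.IH by (intro sym.span_add[OF sym.span_scale[OF sym.span_base]])
  then show ?case by (simp add: distrib_left mult_ac)
qed

text \<open>
  Restrict \<open>f\<close> to the hyperplane \<open>x\<^sub>i = 0\<close> and subtract a lift of the element found there: what
  remains is divisible by \<open>x\<^sub>i\<close>, and the quotient is treated by deleting \<open>x\<^sub>i\<close>.
\<close>

lemma deletion_contraction_induct:
  fixes k :: nat and Q :: "nat set \<Rightarrow> nat set \<Rightarrow> ('v, 'k) poly_alg \<Rightarrow> bool"
  assumes A: "A \<subseteq> ground X" and C: "C \<subseteq> ground X"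
    and f: "f \<in> sym_alg B" and Q: "Q C A f"
    and base: "\<And>C f. C \<subseteq> ground X \<Longrightarrow> f \<in> sym_alg B \<Longrightarrow> Q C {} f \<Longrightarrow>
      \<exists>g\<in>sym_span (gens k C {}). \<forall>v\<in>perp C. ev f v = ev g v"
    and contract: "\<And>C A f i. C \<subseteq> ground X \<Longrightarrow> A \<subseteq> ground X \<Longrightarrow> f \<in> sym_alg B \<Longrightarrow>
      Q C A f \<Longrightarrow> i \<in> A \<Longrightarrow> Q (insert i C) (A - {i}) f"
    and diff: "\<And>C A f g. C \<subseteq> ground X \<Longrightarrow> A \<subseteq> ground X \<Longrightarrow> f \<in> sym_alg B \<Longrightarrow>
      Q C A f \<Longrightarrow> g \<in> sym_span (gens k C A) \<Longrightarrow> Q C A (f - g)"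
    and delete: "\<And>C A f h i \<xi>. C \<subseteq> ground X \<Longrightarrow> A \<subseteq> ground X \<Longrightarrow> f \<in> sym_alg B \<Longrightarrow>
      Q C A f \<Longrightarrow> i \<in> A \<Longrightarrow> h \<in> sym_alg B \<Longrightarrow> \<xi> \<in> perp C \<Longrightarrow> (X ! i) \<xi> \<noteq> 0 \<Longrightarrow>
      (\<And>v. v \<in> perp C \<Longrightarrow> ev f v = (X ! i) v * ev h v) \<Longrightarrow> Q C (A - {i}) h"
  shows "\<exists>g\<in>sym_span (gens k C A). \<forall>v\<in>perp C. ev f v = ev g v"
proof -
  have "finite A" using A by (rule finite_subset) (simp add: ground_def)
  then show ?thesis using A C f Q
  proof (induction A arbitrary: C f)
    case empty
    then show ?case by (intro base)
  next
    case (insert i A)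
    let ?A = "insert i A"
    have i: "i \<in> ground X" "?A - {i} = A" "finite ?A" using insert by auto
    have u: "X ! i \<in> dual_space (*s)" using i(1) by (rule dual_X)
    have "Q (insert i C) A f"
      using contract[of C ?A f i] insert.prems i by simp
    then obtain g where g: "g \<in> sym_span (gens k (insert i C) A)"
      "\<forall>v\<in>perp (insert i C). ev f v = ev g v"
      using insert.IH[of "insert i C" f] insert.prems by auto
    have gA: "g \<in> sym_span (gens k C ?A)"
      using g(1) sym.span_mono[OF gens_contract[of i ?A k C]] i(2) by auto
    show ?case
    proof (cases "\<forall>v\<in>perp C. (X ! i) v = 0")
      \<comment> \<open>Here \<open>i\<close> is a loop of the minor: contraction does not shrink
        \<open>perp C\<close>, and \<open>g\<close> already agrees with \<open>f\<close>.\<close>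
      case True
      then have "perp (insert i C) = perp C" by (auto simp: perp_insert)
      with g(2) gA show ?thesis by auto
    next
      case False
      then obtain \<xi> where \<xi>: "\<xi> \<in> perp C" "(X ! i) \<xi> \<noteq> 0" by blast
      have W: "subspace (perp C)" using insert.prems by (intro subspace_perp)
      \<comment> \<open>Normalised so that x_i takes the value 1, which turns the shift in
        \<open>ev_divide\<close> into the projection of \<open>perp C\<close> to
        \<open>perp (insert i C)\<close>.\<close>
      define \<eta> where "\<eta> = inverse ((X ! i) \<xi>) *s \<xi>"
      have \<eta>: "\<eta> \<in> perp C" "(X ! i) \<eta> = 1"
        using \<xi> W u by (auto simp: \<eta>_def subspace_scale dual_scale)
      let ?f = "f - g"
      have f_alg: "?f \<in> sym_alg B"
        using insert.prems(3) gA sym_span_sym_alg[OF gens_subset_sym_alg] by blast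
      then obtain h where h: "h \<in> sym_alg B"
        "\<And>v. ev ?f v - ev ?f (v - (X ! i) v *s \<eta>) = (X ! i) v * ev h v"
        using ev_divide[OF u] by metis
      have fh: "ev ?f v = (X ! i) v * ev h v" if v: "v \<in> perp C" for v
      proof -
        have "v - (X ! i) v *s \<eta> \<in> perp (insert i C)"
          using v \<eta> W u unfolding perp_insert
          by (simp add: subspace_diff subspace_scale dual_diff dual_scale)
        then have "ev ?f (v - (X ! i) v *s \<eta>) = 0" using g(2) by simp
        then show ?thesis using h(2)[of v] by simp
      qed
      have "Q C ?A ?f" using diff[of C ?A f g] insert.prems gA by simp
      then have "Q C A h"
        using delete[of C ?A ?f i h \<xi>] insert.prems f_alg h(1) \<xi> fh i(2) by simp
      then obtain g' where g': "g' \<in> sym_span (gens k C A)" "\<forall>v\<in>perp C. ev h v = ev g' v"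
        using insert.IH[of C h] insert.prems h(1) by auto
      have "sym_U B (X ! i) * g' \<in> sym_span (gens k C ?A)"
        using gens_delete[of i ?A g' k C] g'(1) i by simp
      then have "g + sym_U B (X ! i) * g' \<in> sym_span (gens k C ?A)"
        using gA by (intro sym.span_add)
      moreover have "ev f v = ev (g + sym_U B (X ! i) * g') v" if "v \<in> perp C" for v
        using fh[OF that] g'(2) that u by (simp add: algebra_simps)
      ultimately show ?thesis by blast
    qed
  qed
qed

section \<open>The kernel of the full power ideal\<close>

lemma deg_below_lines_imp_sym_degree:
  assumes f: "f \<in> sym_alg B" and W: "0 \<in> W" and deg: "\<And>\<eta>. \<eta> \<in> W \<Longrightarrow> deg_below e W f \<eta>"
  shows "\<exists>g\<in>sym_alg B. (g = 0 \<or> sym_degree g < e) \<and> (\<forall>v\<in>W. ev f v = ev g v)"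
proof -
  obtain N F where F: "f = (\<Sum>d<N. F d)" "\<And>d. F d \<in> sym_alg B" "\<And>d. sym_degree (F d) \<le> d"
    "\<And>d \<phi> t. sym_eval (\<lambda>b. t * \<phi> b) (F d) = t ^ d * sym_eval \<phi> (F d)"
    using sym_homogeneous_decomp[OF f] by metis
  let ?g = "\<Sum>d\<in>{..<N} \<inter> {..<e}. F d"
  have "ev f v = ev ?g v" if v: "v \<in> W" for v
  proof -
    let ?p = "\<Sum>d<N. monom (ev (F d) v) d"
    have "ev f (0 + t *s v) = poly ?p t" for t
      by (simp add: F(1) ev_def F(4) poly_sum poly_monom mult.commute)
    note coeff_0 = deg_belowD[OF deg[OF v] W this]
    have "ev (F d) v = 0" if "d \<in> {..<N} - {..<N} \<inter> {..<e}" for d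
      using coeff_0[of d] that by (auto simp: coeff_sum)
    then have "(\<Sum>d\<in>{..<N} \<inter> {..<e}. ev (F d) v) = (\<Sum>d<N. ev (F d) v)"
      by (intro sum.mono_neutral_left ballI) simp_all
    then show ?thesis by (simp add: F(1))
  qed
  moreover have "?g \<in> sym_alg B" using F(2) by blast
  moreover have "?g = 0 \<or> sym_degree ?g < e"
  proof (cases e)
    case (Suc n)
    have "sym_degree ?g \<le> n"
      by (intro sym_degree_sum order.trans[OF F(3)]) (auto simp: Suc)
    then show ?thesis by (simp add: Suc)
  qed simp
  ultimately show ?thesis by blast
qed

text \<open>The zero polynomial is listed separately: its \<open>sym_degree\<close> is 0, which is
  not below a bound of 0.\<close>

lemma gens_empty:
  assumes "g \<in> sym_alg B" "g = 0 \<or> sym_degree g < k + c C"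
  shows "g \<in> sym_span (gens k C {})"
proof (cases "g = 0")
  case False
  with assms have "g * prod_U B X {} \<in> gens k C {}" unfolding gens_def by auto
  then show ?thesis by (intro sym.span_base) (simp add: prod_U_def)
qed (simp add: sym.span_zero)

text \<open>The invariant \<open>Q\<close> is the family of conditions of the full power ideal of
  the minor. Contraction keeps exponents, and deletion lowers them correctly where x_i is nonzero.
  Where x_i vanishes only \<open>c\<close> can change: not at all if x_i is redundant, by
  \<open>c_clos\<close>; otherwise \<eta> is tilted.\<close>

theorem deg_below_imp_gens:
  assumes c_clos: "\<And>S i. S \<subseteq> ground X \<Longrightarrow> i \<in> ground X \<Longrightarrow> perp S \<subseteq> {v. (X ! i) v = 0} \<Longrightarrow>
      c (insert i S) = c S"
    and f: "f \<in> sym_alg B"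
    and deg: "\<And>\<eta>. deg_below (card (ground X - vanishing (ground X) \<eta>) + k
      + c (vanishing (ground X) \<eta>)) UNIV f \<eta>"
  shows "\<exists>g\<in>sym_span (gens k {} (ground X)). \<forall>v. ev f v = ev g v"
proof -
  define Q where "Q C A f \<longleftrightarrow> (\<forall>\<eta>\<in>perp C. deg_below (card (A - vanishing A \<eta>) + k
      + c (C \<union> vanishing A \<eta>)) (perp C) f \<eta>)" for C A f
  have "\<exists>g\<in>sym_span (gens k {} (ground X)). \<forall>v\<in>perp {}. ev f v = ev g v"
  proof (rule deletion_contraction_induct[where Q = Q])
    show "Q {} (ground X) f" using deg by (simp add: Q_def perp_def)
  next
    fix C f assume C: "C \<subseteq> ground X" and f: "f \<in> sym_alg B" and Q: "Q C {} f"
    have "0 \<in> perp C" using subspace_perp[OF C] by (rule subspace_0)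
    moreover have "deg_below (k + c C) (perp C) f \<eta>" if "\<eta> \<in> perp C" for \<eta>
      using Q that by (simp add: Q_def vanishing_def)
    ultimately show "\<exists>g\<in>sym_span (gens k C {}). \<forall>v\<in>perp C. ev f v = ev g v"
      using deg_below_lines_imp_sym_degree[OF f] gens_empty by metis
  next
    fix C A f i assume Q: "Q C A f" and i: "i \<in> A"
    show "Q (insert i C) (A - {i}) f"
      unfolding Q_def
    proof
      fix \<eta> assume "\<eta> \<in> perp (insert i C)"
      then have "\<eta> \<in> perp C" "(X ! i) \<eta> = 0" by (auto simp: perp_insert)
      then show "deg_below (card (A - {i} - vanishing (A - {i}) \<eta>) + k
          + c (insert i C \<union> vanishing (A - {i}) \<eta>)) (perp (insert i C)) f \<eta>"
        unfolding vanishing_contract[OF i \<open>(X ! i) \<eta> = 0\<close>]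
        using Q by (auto simp: Q_def perp_insert intro: deg_below_mono)
    qed
  next
    fix C A f g assume "C \<subseteq> ground X" "A \<subseteq> ground X" "Q C A f" "g \<in> sym_span (gens k C A)"
    then show "Q C A (f - g)"
      unfolding Q_def by (intro ballI deg_below_diff[OF _ deg_below_gens]) auto
  next
    fix C A f h i \<xi>
    assume C: "C \<subseteq> ground X" and A: "A \<subseteq> ground X" and Q: "Q C A f" and i: "i \<in> A"
      and h: "h \<in> sym_alg B" and \<xi>: "\<xi> \<in> perp C" "(X ! i) \<xi> \<noteq> 0"
      and eq: "\<And>v. v \<in> perp C \<Longrightarrow> ev f v = (X ! i) v * ev h v"
    have "finite A" using A by (rule finite_subset) (simp add: ground_def)
    have u: "X ! i \<in> dual_space (*s)" using i A by (auto intro: dual_X)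
    note W = subspace_perp[OF C]
    note divide = deg_below_divide[OF u h W _ eq _ \<xi>]
    have generic: "deg_below (card (A - {i} - vanishing (A - {i}) \<eta>) + k
        + c (C \<union> vanishing (A - {i}) \<eta>)) (perp C) h \<eta>"
      if \<eta>: "\<eta> \<in> perp C" "(X ! i) \<eta> \<noteq> 0" for \<eta>
    proof -
      have "vanishing (A - {i}) \<eta> = vanishing A \<eta>" using \<eta> by (auto simp: vanishing_def)
      moreover have "A - {i} - vanishing A \<eta> = A - vanishing A \<eta> - {i}" by auto
      moreover have "i \<in> A - vanishing A \<eta>" using \<eta> i by (simp add: vanishing_def)
      then have "card (A - vanishing A \<eta>) = Suc (card (A - vanishing A \<eta> - {i}))"
        using \<open>finite A\<close> by (intro card.remove) simp_all
      moreover have "deg_below (card (A - vanishing A \<eta>) + k + c (C \<union> vanishing A \<eta>)) (perp C) f \<eta>"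
        using Q \<eta> by (simp add: Q_def)
      from divide[OF \<eta>(1) _ this] have
        "deg_below (card (A - vanishing A \<eta>) + k + c (C \<union> vanishing A \<eta>) - 1) (perp C) h \<eta>"
        using \<eta> by simp
      ultimately show ?thesis by simp
    qed
    show "Q C (A - {i}) h"
      unfolding Q_def
    proof
      fix \<eta> assume \<eta>: "\<eta> \<in> perp C"
      let ?S = "vanishing (A - {i}) \<eta>"
      let ?goal = "deg_below (card (A - {i} - ?S) + k + c (C \<union> ?S)) (perp C) h \<eta>"
      have S: "C \<union> ?S \<subseteq> ground X" using C A by (auto simp: vanishing_def)
      consider "(X ! i) \<eta> \<noteq> 0" | "(X ! i) \<eta> = 0" "perp (C \<union> ?S) \<subseteq> {v. (X ! i) v = 0}"
        | \<zeta> where "(X ! i) \<eta> = 0" "\<zeta> \<in> perp (C \<union> ?S)" "(X ! i) \<zeta> \<noteq> 0" by blast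
      then show ?goal
      proof cases
        case 1
        with \<eta> show ?thesis by (rule generic)
      next
        case 2
        have "c (C \<union> vanishing A \<eta>) = c (C \<union> ?S)"
          using c_clos[OF S _ 2(2)] i A vanishing_contract(2)[OF i 2(1), of C] by auto
        moreover have
          "deg_below (card (A - vanishing A \<eta>) + k + c (C \<union> vanishing A \<eta>)) (perp C) h \<eta>"
          using divide[OF \<eta>, of "card (A - vanishing A \<eta>) + k + c (C \<union> vanishing A \<eta>)"] 2 Q \<eta>
          by (auto simp: Q_def)
        ultimately show ?thesis using vanishing_contract(1)[OF i 2(1)] by simp
      next
        case 3
        \<comment> \<open>The value 0 would leave x_i zero; the quotients are the values of
          \<open>s\<close> at which a functional nonzero at \<eta> would become zero. A zero
          denominator only yields 0 again.\<close>
        let ?bad = "insert 0 ((\<lambda>j. - (X ! j) \<eta> / (X ! j) \<zeta>) ` A)"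
        have \<zeta>C: "\<zeta> \<in> perp C" using 3 by (simp add: perp_def)
        show ?thesis
        proof (rule deg_below_pointwise)
          fix v assume v: "v \<in> perp C"
          show "deg_below (card (A - {i} - ?S) + k + c (C \<union> ?S)) {v} h \<eta>"
          proof (rule deg_below_limit[OF h, where S = ?bad and w = 0 and \<xi> = \<zeta>])
            fix s assume s: "s \<notin> ?bad"
            have val: "(X ! j) (\<eta> + s *s \<zeta>) = (X ! j) \<eta> + s * (X ! j) \<zeta>" if "j \<in> A" for j
              using that A by (subst dual_add[OF dual_X], auto simp: dual_scale[OF dual_X])
            have "vanishing (A - {i}) (\<eta> + s *s \<zeta>) = ?S"
            proof -
              have "(X ! j) \<eta> + s * (X ! j) \<zeta> = 0 \<longleftrightarrow> (X ! j) \<eta> = 0" if j: "j \<in> A - {i}" for j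
              proof (cases "(X ! j) \<eta> = 0")
                case True
                then have "j \<in> ?S" using j by (simp add: vanishing_def)
                then have "(X ! j) \<zeta> = 0" using 3 by (simp add: perp_def)
                with True show ?thesis by simp
              next
                case False
                have "s \<noteq> - (X ! j) \<eta> / (X ! j) \<zeta>" using s j by blast
                with False show ?thesis
                  by (cases "(X ! j) \<zeta> = 0") (auto simp: field_simps add_eq_0_iff)
              qed
              then have "(X ! j) (\<eta> + s *s \<zeta>) = 0 \<longleftrightarrow> (X ! j) \<eta> = 0" if "j \<in> A - {i}" for j
                using val[of j] that by simp
              then show ?thesis unfolding vanishing_def by blast
            qed
            moreover have "\<eta> + s *s \<zeta> \<in> perp C"
              using \<eta> \<zeta>C W by (simp add: subspace_add subspace_scale)
            moreover have "(X ! i) (\<eta> + s *s \<zeta>) \<noteq> 0"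
              using val[OF i] 3 s by simp
            ultimately have "deg_below (card (A - {i} - ?S) + k + c (C \<union> ?S)) (perp C) h
                (\<eta> + s *s \<zeta>)"
              using generic by metis
            then show "deg_below (card (A - {i} - ?S) + k + c (C \<union> ?S)) {v + s *s 0} h
                (\<eta> + s *s \<zeta>)"
              by (rule deg_below_mono) (use v in auto)
          qed (use \<open>finite A\<close> in simp)
        qed
      qed
    qed
  qed (use f in auto)
  then show ?thesis by (simp add: perp_def)
qed

end

section \<open>Hyperplanes and maximal missing sets suffice for k = 0\<close>

context weighted_arrangement
begin

text \<open>
  On the minor, \<open>\<eta>\<close> is determined up to a factor (and up to vectors on which all functionals
  vanish) by the functionals vanishing on it: it is normal to a hyperplane, or all of \<open>A\<close>
  vanishes on it.
\<close>

definition rigid :: "nat set \<Rightarrow> nat set \<Rightarrow> 'v \<Rightarrow> bool"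
  where "rigid C A \<eta> \<longleftrightarrow> (\<forall>\<xi>\<in>perp C. (\<forall>j\<in>vanishing A \<eta>. (X ! j) \<xi> = 0) \<longrightarrow>
    (\<exists>a. \<forall>j\<in>A. (X ! j) \<xi> = a * (X ! j) \<eta>))"

text \<open>One-element enlargements suffice for maximality because \<open>c\<close> is monotone.
  Closedness is not demanded; it follows once \<open>c\<close> comes from a set of flats.\<close>

definition max_missing :: "nat set \<Rightarrow> nat set \<Rightarrow> nat set \<Rightarrow> bool"
  where "max_missing C A S \<longleftrightarrow> S \<subseteq> A \<and> c (C \<union> S) = 0 \<and> (\<forall>i\<in>A - S. c (C \<union> insert i S) = 1)"

text \<open>Since \<open>i\<close> is in the zero set of \<eta>, every test vector already lies in
  \<open>perp (insert i C)\<close>, and the additional proportionality at \<open>i\<close> reads 0 =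
  0.\<close>

lemma rigid_contract:
  assumes i: "i \<in> A" and \<eta>: "(X ! i) \<eta> = 0" and rigid: "rigid (insert i C) (A - {i}) \<eta>"
  shows "rigid C A \<eta>"
  unfolding rigid_def
proof (intro ballI impI)
  fix \<xi> assume \<xi>: "\<xi> \<in> perp C" and van: "\<forall>j\<in>vanishing A \<eta>. (X ! j) \<xi> = 0"
  have "i \<in> vanishing A \<eta>" using i \<eta> by (simp add: vanishing_def)
  with van have "(X ! i) \<xi> = 0" by blast
  moreover from this \<xi> have "\<xi> \<in> perp (insert i C)" by (simp add: perp_insert)
  moreover have "\<forall>j\<in>vanishing (A - {i}) \<eta>. (X ! j) \<xi> = 0" using van by (simp add: vanishing_def)
  ultimately obtain a where "\<forall>j\<in>A - {i}. (X ! j) \<xi> = a * (X ! j) \<eta>" "(X ! i) \<xi> = 0"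
    using rigid unfolding rigid_def by blast
  then show "\<exists>a. \<forall>j\<in>A. (X ! j) \<xi> = a * (X ! j) \<eta>"
    using \<eta> by (intro exI[of _ a]) auto
qed

lemma rigid_delete_imp_contract:
  "rigid C (A - {i}) \<eta> \<Longrightarrow> rigid (insert i C) (A - {i}) \<eta>"
  unfolding rigid_def perp_insert by blast

lemma max_missing_contract:
  assumes "i \<in> A" "max_missing (insert i C) (A - {i}) S"
  shows "max_missing C A (insert i S)"
proof -
  have "C \<union> insert j (insert i S) = insert i C \<union> insert j S" for j by auto
  with assms show ?thesis unfolding max_missing_def by auto
qed

text \<open>Decided by whether adding \<open>i\<close> raises the weight to 1. If it does not, the
  remaining elements still raise it by monotonicity.\<close>

lemma max_missing_delete:
  assumes "i \<in> A" "max_missing C (A - {i}) S" "A \<subseteq> ground X" "C \<subseteq> ground X"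
  shows "max_missing C A S \<or> max_missing C A (insert i S)"
proof -
  have "c (C \<union> insert i S) \<le> 1" by (rule c_le_1)
  then consider "c (C \<union> insert i S) = 1" | "c (C \<union> insert i S) = 0" by linarith
  then show ?thesis
  proof cases
    case 1
    with assms show ?thesis unfolding max_missing_def by auto
  next
    case 2
    have "c (C \<union> insert j (insert i S)) = 1" if j: "j \<in> A - insert i S" for j
    proof -
      have "c (C \<union> insert j S) = 1" using j assms(2) unfolding max_missing_def by auto
      moreover have "c (C \<union> insert j S) \<le> c (C \<union> insert j (insert i S))"
        using assms j unfolding max_missing_def by (intro c_mono) auto
      ultimately show ?thesis using c_le_1[of "C \<union> insert j (insert i S)"] by linarith
    qed
    with 2 assms(1,2) have "max_missing C A (insert i S)" unfolding max_missing_def by auto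
    then show ?thesis ..
  qed
qed

lemma card_vanishing_delete:
  assumes "finite A" "i \<in> A"
  shows "card (A - vanishing A \<eta>) =
    (if (X ! i) \<eta> = 0 then 0 else 1) + card (A - {i} - vanishing (A - {i}) \<eta>)"
proof -
  have "A - vanishing A \<eta> = (if (X ! i) \<eta> = 0 then A - {i} - vanishing (A - {i}) \<eta>
      else insert i (A - {i} - vanishing (A - {i}) \<eta>))"
    using assms by (auto simp: vanishing_def)
  then show ?thesis using assms by simp
qed

lemma deg_below_0D:
  assumes "deg_below 0 W f \<eta>" "v \<in> W"
  shows "ev f v = 0"
proof -
  from bspec[OF assms(1)[unfolded deg_below_def] assms(2)]
  obtain p where p: "\<And>i. coeff p i = 0" "\<And>t. ev f (v + t *s \<eta>) = poly p t" by auto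
  then have "p = 0" by (simp add: poly_eq_iff)
  with p(2)[of 0] show ?thesis by simp
qed

text \<open>\<open>H\<close> takes the bound m + 1 at every rigid direction, whatever its weight;
  the sharper bound m is required by \<open>M\<close>, at one direction for each maximal missing
  set. Asking for a single witness leaves room for any normal selector.\<close>

theorem rigid_deg_below_imp_gens:
  assumes f: "f \<in> sym_alg B"
    and hyp: "\<And>\<eta>. rigid {} (ground X) \<eta> \<Longrightarrow>
      deg_below (card (ground X - vanishing (ground X) \<eta>) + 1) UNIV f \<eta>"
    and mis: "\<And>S. max_missing {} (ground X) S \<Longrightarrow>
      \<exists>\<eta>. vanishing (ground X) \<eta> = S \<and> deg_below (card (ground X - S)) UNIV f \<eta>"
  shows "\<exists>g\<in>sym_span (gens 0 {} (ground X)). \<forall>v. ev f v = ev g v"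
proof -
  define H where "H C A f \<longleftrightarrow> (\<forall>\<eta>\<in>perp C. rigid C A \<eta> \<longrightarrow>
      deg_below (card (A - vanishing A \<eta>) + 1) (perp C) f \<eta>)" for C A f
  define M where "M C A f \<longleftrightarrow> (\<forall>S. max_missing C A S \<longrightarrow>
      (\<exists>\<eta>\<in>perp C. vanishing A \<eta> = S \<and> deg_below (card (A - S)) (perp C) f \<eta>))" for C A f
  have "\<exists>g\<in>sym_span (gens 0 {} (ground X)). \<forall>v\<in>perp {}. ev f v = ev g v"
  proof (rule deletion_contraction_induct[where Q = "\<lambda>C A f. H C A f \<and> M C A f"])
    show "H {} (ground X) f \<and> M {} (ground X) f"
      using hyp mis by (simp add: H_def M_def perp_def)
  next
    fix C f assume C: "C \<subseteq> ground X" and f: "f \<in> sym_alg B" and HM: "H C {} f \<and> M C {} f"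
    have 0: "0 \<in> perp C" using subspace_perp[OF C] by (rule subspace_0)
    \<comment> \<open>With no functionals left every direction is rigid, so \<open>f\<close> is
      constant on \<open>perp C\<close>. If \<open>c C\<close> is 0, the empty set is maximal
      missing and \<open>M\<close> gives bound 0 in some direction, so this constant is 0.\<close>
    have "deg_below 1 (perp C) f \<eta>" if "\<eta> \<in> perp C" for \<eta>
      using HM that by (auto simp: H_def rigid_def vanishing_def)
    then obtain g where g: "g \<in> sym_alg B" "g = 0 \<or> sym_degree g < 1" "\<forall>v\<in>perp C. ev f v = ev g v"
      using deg_below_lines_imp_sym_degree[OF f 0] by blast
    show "\<exists>g\<in>sym_span (gens 0 C {}). \<forall>v\<in>perp C. ev f v = ev g v"
    proof (cases "c C = 0")
      case False
      then have "g = 0 \<or> sym_degree g < 0 + c C" using g(2) by linarith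
      then have "g \<in> sym_span (gens 0 C {})" by (rule gens_empty[OF g(1)])
      with g(3) show ?thesis by (rule bexI)
    next
      case True
      then have "max_missing C {} {}" by (simp add: max_missing_def)
      then obtain \<eta> where "deg_below (card ({} - {} :: nat set)) (perp C) f \<eta>"
        using HM unfolding M_def by blast
      then have "deg_below 0 (perp C) f \<eta>" by simp
      have "ev f v = 0" if "v \<in> perp C" for v
        using \<open>deg_below 0 (perp C) f \<eta>\<close> that by (rule deg_below_0D)
      then show ?thesis by (intro bexI[of _ 0]) (simp_all add: sym.span_zero)
    qed
  next
    fix C A f i assume HM: "H C A f \<and> M C A f" and i: "i \<in> A"
    have "H (insert i C) (A - {i}) f"
      unfolding H_def
    proof (intro ballI impI)
      fix \<eta> assume "\<eta> \<in> perp (insert i C)" and rigid: "rigid (insert i C) (A - {i}) \<eta>"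
      then have \<eta>: "\<eta> \<in> perp C" "(X ! i) \<eta> = 0" by (auto simp: perp_insert)
      then have "deg_below (card (A - vanishing A \<eta>) + 1) (perp C) f \<eta>"
        using HM rigid_contract[OF i \<eta>(2) rigid] by (simp add: H_def)
      then show "deg_below (card (A - {i} - vanishing (A - {i}) \<eta>) + 1) (perp (insert i C)) f \<eta>"
        unfolding vanishing_contract[OF i \<eta>(2)]
        by (rule deg_below_mono) (auto simp: perp_insert)
    qed
    moreover have "M (insert i C) (A - {i}) f"
      unfolding M_def
    proof (intro allI impI)
      fix S assume S: "max_missing (insert i C) (A - {i}) S"
      then obtain \<eta> where \<eta>: "\<eta> \<in> perp C" "vanishing A \<eta> = insert i S"
        "deg_below (card (A - insert i S)) (perp C) f \<eta>"
        using HM max_missing_contract[OF i S] by (auto simp: M_def)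
      have "i \<notin> S" using S by (auto simp: max_missing_def)
      with \<eta>(2) have "(X ! i) \<eta> = 0" "vanishing (A - {i}) \<eta> = S"
        by (auto simp: vanishing_def set_eq_iff)
      moreover have "A - {i} - S = A - insert i S" by auto
      moreover from \<eta>(3) have "deg_below (card (A - insert i S)) (perp (insert i C)) f \<eta>"
        by (rule deg_below_mono) (auto simp: perp_insert)
      ultimately show "\<exists>\<eta>\<in>perp (insert i C). vanishing (A - {i}) \<eta> = S
          \<and> deg_below (card (A - {i} - S)) (perp (insert i C)) f \<eta>"
        using \<eta>(1) by (auto simp: perp_insert)
    qed
    ultimately show "H (insert i C) (A - {i}) f \<and> M (insert i C) (A - {i}) f" ..
  next
    fix C A f g assume C: "C \<subseteq> ground X" and A: "A \<subseteq> ground X" and HM: "H C A f \<and> M C A f"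
      and g: "g \<in> sym_span (gens 0 C A)"
    note deg_g = deg_below_gens[OF C A g]
    have "deg_below (card (A - vanishing A \<eta>) + 1) (perp C) g \<eta>" for \<eta>
      using c_le_1[of "C \<union> vanishing A \<eta>"] by (intro deg_below_mono[OF deg_g[of \<eta> "perp C"]]) simp_all
    then have "H C A (f - g)"
      using HM by (auto simp: H_def intro: deg_below_diff)
    moreover have "M C A (f - g)"
      unfolding M_def
    proof (intro allI impI)
      fix S assume S: "max_missing C A S"
      then obtain \<eta> where \<eta>: "\<eta> \<in> perp C" "vanishing A \<eta> = S"
        "deg_below (card (A - S)) (perp C) f \<eta>" using HM by (auto simp: M_def)
      have "deg_below (card (A - S)) (perp C) g \<eta>"
        using deg_g[of \<eta> "perp C"] S by (simp add: \<eta>(2) max_missing_def)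
      with \<eta> show "\<exists>\<eta>\<in>perp C. vanishing A \<eta> = S \<and> deg_below (card (A - S)) (perp C) (f - g) \<eta>"
        by (blast intro: deg_below_diff)
    qed
    ultimately show "H C A (f - g) \<and> M C A (f - g)" ..
  next
    fix C A f h i \<zeta>
    assume C: "C \<subseteq> ground X" and A: "A \<subseteq> ground X" and HM: "H C A f \<and> M C A f" and i: "i \<in> A"
      and h: "h \<in> sym_alg B" and \<zeta>: "\<zeta> \<in> perp C" "(X ! i) \<zeta> \<noteq> 0"
      and eq: "\<And>v. v \<in> perp C \<Longrightarrow> ev f v = (X ! i) v * ev h v"
    have "finite A" using A by (rule finite_subset) (simp add: ground_def)
    have dual: "X ! j \<in> dual_space (*s)" if "j \<in> A" for j using that A by (auto intro: dual_X)
    note W = subspace_perp[OF C]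
    note divide = deg_below_divide[OF dual[OF i] h W _ eq _ \<zeta>]
    have rigid_h: "deg_below (card (A - {i} - vanishing (A - {i}) \<eta>) + 1) (perp C) h \<eta>"
      if \<eta>: "\<eta> \<in> perp C" "rigid C A \<eta>" for \<eta>
    proof -
      have "deg_below (card (A - vanishing A \<eta>) + 1) (perp C) f \<eta>"
        using HM \<eta> by (simp add: H_def)
      from divide[OF \<eta>(1) _ this] show ?thesis
        using card_vanishing_delete[OF \<open>finite A\<close> i, of \<eta>] by (simp split: if_splits)
    qed
    have "H C (A - {i}) h"
      unfolding H_def
    proof (intro ballI impI)
      fix \<eta> assume \<eta>: "\<eta> \<in> perp C" and rigid: "rigid C (A - {i}) \<eta>"
      show "deg_below (card (A - {i} - vanishing (A - {i}) \<eta>) + 1) (perp C) h \<eta>"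
      proof (cases "rigid C A \<eta>")
        case True
        with \<eta> show ?thesis by (rule rigid_h)
      next
        case False
        txt \<open>Here \<open>i\<close> is a coloop: some \<open>\<theta>\<close> kills the rest of \<open>A\<close> but not \<open>x\<^sub>i\<close>.\<close>
        then obtain \<xi> where \<xi>: "\<xi> \<in> perp C" "\<forall>j\<in>vanishing A \<eta>. (X ! j) \<xi> = 0"
          "\<nexists>a. \<forall>j\<in>A. (X ! j) \<xi> = a * (X ! j) \<eta>" unfolding rigid_def by blast
        have i\<eta>: "(X ! i) \<eta> \<noteq> 0"
          using False rigid_contract[OF i _ rigid_delete_imp_contract[OF rigid]] by blast
        obtain a where a: "\<forall>j\<in>A - {i}. (X ! j) \<xi> = a * (X ! j) \<eta>"
          using rigid \<xi> unfolding rigid_def vanishing_def by blast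
        \<comment> \<open>Rigidity in the deletion makes \<xi> proportional to \<eta> away from
          \<open>i\<close>; the difference is concentrated at \<open>i\<close>, and not zero there,
          since proportionality fails on all of \<open>A\<close>.\<close>
        define \<theta> where "\<theta> = \<xi> - a *s \<eta>"
        have \<theta>: "\<theta> \<in> perp C" using \<xi>(1) \<eta> W by (simp add: \<theta>_def subspace_diff subspace_scale)
        have \<theta>_j: "(X ! j) \<theta> = 0" if "j \<in> A - {i}" for j
          using a dual that by (simp add: \<theta>_def dual_diff dual_scale)
        have \<theta>_i: "(X ! i) \<theta> \<noteq> 0"
        proof
          assume "(X ! i) \<theta> = 0"
          then have "(X ! i) \<xi> = a * (X ! i) \<eta>"
            using dual i by (simp add: \<theta>_def dual_diff dual_scale)
          with a \<xi>(3) show False by blast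
        qed
        \<comment> \<open>The factor makes x_i vanish at \<eta>' without changing the other
          functionals. So \<eta>' is rigid for \<open>A\<close>, and the bound found there is
          carried to \<eta> by shearing along \<theta>.\<close>
        define b where "b = (X ! i) \<eta> / (X ! i) \<theta>"
        define \<eta>' where "\<eta>' = \<eta> - b *s \<theta>"
        have \<eta>': "\<eta>' \<in> perp C" using \<eta> \<theta> W by (simp add: \<eta>'_def subspace_diff subspace_scale)
        have \<eta>'_j: "(X ! j) \<eta>' = (X ! j) \<eta>" if "j \<in> A - {i}" for j
          using \<theta>_j[OF that] dual that by (simp add: \<eta>'_def dual_diff dual_scale)
        have \<eta>'_i: "(X ! i) \<eta>' = 0"
          using \<theta>_i dual i by (simp add: \<eta>'_def dual_diff dual_scale b_def)
        have van: "vanishing (A - {i}) \<eta>' = vanishing (A - {i}) \<eta>"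
          using \<eta>'_j by (auto simp: vanishing_def)
        have "rigid C (A - {i}) \<eta>'"
          using rigid \<eta>'_j unfolding rigid_def van by simp
        then have "rigid C A \<eta>'"
          by (intro rigid_contract[OF i \<eta>'_i] rigid_delete_imp_contract)
        from rigid_h[OF \<eta>' this]
        have deg': "deg_below (card (A - {i} - vanishing (A - {i}) \<eta>) + 1) (perp C) h \<eta>'"
          by (simp only: van)
        \<comment> \<open>Test vectors can be nonzero only at \<open>i\<close>, so proportionality
          to \<theta> is automatic. After division by x_i the bound along \<theta> is 1, as
          \<open>deg_below_shift\<close> requires.\<close>
        have "rigid C A \<theta>"
          unfolding rigid_def
        proof (intro ballI impI)
          fix \<chi> assume "\<forall>j\<in>vanishing A \<theta>. (X ! j) \<chi> = 0"
          then have "\<forall>j\<in>A - {i}. (X ! j) \<chi> = 0" using \<theta>_j by (simp add: vanishing_def)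
          then show "\<exists>d. \<forall>j\<in>A. (X ! j) \<chi> = d * (X ! j) \<theta>"
            using \<theta>_i \<theta>_j by (intro exI[of _ "(X ! i) \<chi> / (X ! i) \<theta>"]) force
        qed
        moreover have eq: "A - {i} - vanishing (A - {i}) \<theta> = {}"
          using \<theta>_j by (auto simp: vanishing_def)
        ultimately have "deg_below 1 (perp C) h \<theta>"
          using rigid_h[OF \<theta>] unfolding eq by simp
        from deg_below_shift[OF W \<theta> \<eta>' this deg', of b] show ?thesis by (simp add: \<eta>'_def)
      qed
    qed
    moreover have "M C (A - {i}) h"
      unfolding M_def
    proof (intro allI impI)
      fix S assume S: "max_missing C (A - {i}) S"
      have "i \<notin> S" "S \<subseteq> A - {i}" using S by (auto simp: max_missing_def)
      show "\<exists>\<eta>\<in>perp C. vanishing (A - {i}) \<eta> = S \<and> deg_below (card (A - {i} - S)) (perp C) h \<eta>"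
        using max_missing_delete[OF i S A C]
      proof
        assume "max_missing C A S"
        then obtain \<eta> where \<eta>: "\<eta> \<in> perp C" "vanishing A \<eta> = S"
          "deg_below (card (A - S)) (perp C) f \<eta>" using HM by (auto simp: M_def)
        have "vanishing (A - {i}) \<eta> = S" "(X ! i) \<eta> \<noteq> 0"
          using \<eta>(2) \<open>i \<notin> S\<close> i by (auto simp: vanishing_def set_eq_iff)
        moreover from this have "card (A - S) = Suc (card (A - {i} - S))"
          using card_vanishing_delete[OF \<open>finite A\<close> i, of \<eta>] \<eta>(2) by simp
        ultimately show ?thesis using divide[OF \<eta>(1) _ \<eta>(3)] \<eta>(1) by auto
      next
        assume "max_missing C A (insert i S)"
        then obtain \<eta> where \<eta>: "\<eta> \<in> perp C" "vanishing A \<eta> = insert i S"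
          "deg_below (card (A - insert i S)) (perp C) f \<eta>" using HM by (auto simp: M_def)
        have "vanishing (A - {i}) \<eta> = S" "(X ! i) \<eta> = 0"
          using \<eta>(2) \<open>i \<notin> S\<close> i by (auto simp: vanishing_def set_eq_iff)
        moreover have "A - {i} - S = A - insert i S" by auto
        ultimately show ?thesis using divide[OF \<eta>(1) _ \<eta>(3)] \<eta>(1) by auto
      qed
    qed
    ultimately show "H C (A - {i}) h \<and> M C (A - {i}) h" ..
  qed (use f in auto)
  then show ?thesis by (simp add: perp_def)
qed

end

section \<open>Homogeneous ideals are determined by their kernels\<close>

lemma sym_ideal_base:
  assumes "g \<in> G"
  shows "g \<in> sym_ideal B G"
  unfolding sym_ideal_def using assms
  by (intro CollectI exI[of _ "{g}"] exI[of _ "\<lambda>_. 1"]) simp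

lemma sym_ideal_zero: "0 \<in> sym_ideal B G"
  unfolding sym_ideal_def by (intro CollectI exI[of _ "{}"] exI[of _ "\<lambda>_. 0"]) simp

lemma sym_ideal_mult:
  assumes "f \<in> sym_ideal B G" "p \<in> sym_alg B"
  shows "p * f \<in> sym_ideal B G"
proof -
  obtain F q where F: "f = (\<Sum>g\<in>F. q g * g)" "finite F" "F \<subseteq> G" "\<forall>g\<in>F. q g \<in> sym_alg B"
    using assms(1) by (auto simp: sym_ideal_def)
  then have "p * f = (\<Sum>g\<in>F. (p * q g) * g)" by (simp add: sum_distrib_left mult.assoc)
  with F assms(2) show ?thesis
    unfolding sym_ideal_def by (intro CollectI exI[of _ F] exI[of _ "\<lambda>g. p * q g"]) auto
qed

lemma sym_ideal_add:
  assumes "f \<in> sym_ideal B G" "f' \<in> sym_ideal B G"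
  shows "f + f' \<in> sym_ideal B G"
proof -
  obtain F q where F: "f = (\<Sum>g\<in>F. q g * g)" "finite F" "F \<subseteq> G" "\<forall>g\<in>F. q g \<in> sym_alg B"
    using assms(1) by (auto simp: sym_ideal_def)
  obtain F' q' where F': "f' = (\<Sum>g\<in>F'. q' g * g)" "finite F'" "F' \<subseteq> G" "\<forall>g\<in>F'. q' g \<in> sym_alg B"
    using assms(2) by (auto simp: sym_ideal_def)
  let ?r = "\<lambda>g. (if g \<in> F then q g else 0) + (if g \<in> F' then q' g else 0)"
  have "f = (\<Sum>g\<in>F \<union> F'. (if g \<in> F then q g else 0) * g)"
    unfolding F(1) using F(2) F'(2) by (intro sum.mono_neutral_cong_left) auto
  moreover have "f' = (\<Sum>g\<in>F \<union> F'. (if g \<in> F' then q' g else 0) * g)"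
    unfolding F'(1) using F(2) F'(2) by (intro sum.mono_neutral_cong_left) auto
  ultimately have "f + f' = (\<Sum>g\<in>F \<union> F'. ?r g * g)"
    by (simp only: sum.distrib distrib_right)
  moreover have "\<forall>g\<in>F \<union> F'. ?r g \<in> sym_alg B"
    using F(4) F'(4) by (intro ballI sym_alg_add) auto
  ultimately show ?thesis
    unfolding sym_ideal_def
    using F F' by (intro CollectI exI[of _ "F \<union> F'"] exI[of _ ?r]) blast
qed

lemma sym_ideal_minimal:
  assumes "G \<subseteq> sym_ideal B G'"
  shows "sym_ideal B G \<subseteq> sym_ideal B G'"
proof
  fix f assume "f \<in> sym_ideal B G"
  then obtain F q where F: "f = (\<Sum>g\<in>F. q g * g)" "finite F" "F \<subseteq> G" "\<forall>g\<in>F. q g \<in> sym_alg B"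
    by (auto simp: sym_ideal_def)
  have "(\<Sum>g\<in>F. q g * g) \<in> sym_ideal B G'"
    using F(2-4) assms
    by (induction F) (auto intro: sym_ideal_zero sym_ideal_add sym_ideal_mult)
  then show "f \<in> sym_ideal B G'" using F(1) by simp
qed

text \<open>Generators suffice because a product of operators acts by composition.\<close>

lemma sym_ker_ideal:
  "sym_ker B (sym_ideal B G) = {f \<in> sym_alg B. \<forall>g\<in>G. sym_act g f = 0}"
proof -
  have "sym_act q f = 0" if q: "q \<in> sym_ideal B G" and f: "\<forall>g\<in>G. sym_act g f = 0" for q f
  proof -
    obtain F p where "q = (\<Sum>g\<in>F. p g * g)" "finite F" "F \<subseteq> G" "\<forall>g\<in>F. p g \<in> sym_alg B"
      using q by (auto simp: sym_ideal_def)
    then show ?thesis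
      using f by (auto simp: sym_act_sum_left sym_act_mult intro!: sum.neutral)
  qed
  then show ?thesis unfolding sym_ker_def by (auto intro: sym_ideal_base)
qed

lemma sym_const_sum: "sym_const (\<Sum>i\<in>I. h i) = (\<Sum>i\<in>I. sym_const (h i))"
  by (induction I rule: infinite_finite_induct) (simp_all add: sym_const_add)

section \<open>Homogeneous elements and the pairing in a fixed degree\<close>

definition homogeneous :: "nat \<Rightarrow> ('v, 'k::field) poly_alg \<Rightarrow> bool"
  where "homogeneous d f \<longleftrightarrow> (\<forall>m\<in>Poly_Mapping.keys f. monom_deg m = d)"

lemma homogeneous_mult:
  assumes "homogeneous d f" "homogeneous e g"
  shows "homogeneous (d + e) (f * g)"
  unfolding homogeneous_def
proof
  fix m assume "m \<in> Poly_Mapping.keys (f * g)"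
  then obtain a b where "a \<in> Poly_Mapping.keys f" "b \<in> Poly_Mapping.keys g" "m = a + b"
    using keys_mult[of f g] by blast
  with assms show "monom_deg m = d + e" by (simp add: homogeneous_def monom_deg_add)
qed

lemma homogeneous_sum: "(\<And>i. i \<in> I \<Longrightarrow> homogeneous d (f i)) \<Longrightarrow> homogeneous d (\<Sum>i\<in>I. f i)"
proof (induction I rule: infinite_finite_induct)
  case (insert i I)
  then show ?case using keys_add[of "f i" "\<Sum>i\<in>I. f i"] by (auto simp: homogeneous_def)
qed (simp_all add: homogeneous_def)

lemma homogeneous_single: "homogeneous (monom_deg m) (Poly_Mapping.single m c)"
  by (simp add: homogeneous_def)

lemma homogeneous_sym_V:
  fixes scale :: "'k::field \<Rightarrow> 'v::ab_group_add \<Rightarrow> 'v"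
  shows "homogeneous 1 (sym_V scale B v)"
  unfolding sym_V_def
proof (rule homogeneous_sum)
  fix b :: 'v
  have "homogeneous 1 (sym_var b :: ('v, 'k) poly_alg)"
    by (simp add: homogeneous_def sym_var_def monom_deg_def)
  then show "homogeneous 1 (sym_const (module.representation scale B v b) * sym_var b)"
    using homogeneous_mult[OF homogeneous_single[of 0]]
    by (fastforce simp: sym_const_def monom_deg_def)
qed

lemma homogeneous_power: "homogeneous d f \<Longrightarrow> homogeneous (e * d) (f ^ e)"
proof (induction e)
  case 0
  show ?case by (simp add: homogeneous_def monom_deg_def)
qed (auto intro: homogeneous_mult)

lemma finite_monoms_of_degree:
  assumes "finite B"
  shows "finite {m. Poly_Mapping.keys m \<subseteq> B \<and> monom_deg m = d}" (is "finite ?M")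
proof (rule finite_imageD)
  let ?r = "\<lambda>m. restrict (Poly_Mapping.lookup m) B"
  have "Poly_Mapping.lookup m b \<le> d" if "m \<in> ?M" for m b
  proof (cases "b \<in> Poly_Mapping.keys m")
    case True
    then have "Poly_Mapping.lookup m b \<le> monom_deg m"
      unfolding monom_deg_def by (intro member_le_sum) auto
    with that show ?thesis by simp
  qed (simp add: in_keys_iff)
  then have "?r ` ?M \<subseteq> B \<rightarrow>\<^sub>E {..d}" by auto
  then show "finite (?r ` ?M)" by (rule finite_subset) (use assms in \<open>auto intro: finite_PiE\<close>)
  show "inj_on ?r ?M"
  proof (rule inj_onI)
    fix m n assume mn: "m \<in> ?M" "n \<in> ?M" and eq: "?r m = ?r n"
    show "m = n"
    proof (rule poly_mapping_eqI)
      fix b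
      show "Poly_Mapping.lookup m b = Poly_Mapping.lookup n b"
      proof (cases "b \<in> B")
        case True
        then show ?thesis using fun_cong[OF eq, of b] by simp
      next
        case False
        then have "b \<notin> Poly_Mapping.keys m" "b \<notin> Poly_Mapping.keys n" using mn by auto
        then show ?thesis by (simp add: in_keys_iff)
      qed
    qed
  qed
qed

lemma keys_sym_act:
  assumes "b \<in> Poly_Mapping.keys (sym_act q f)"
  shows "\<exists>a\<in>Poly_Mapping.keys q. a + b \<in> Poly_Mapping.keys f"
proof (rule ccontr)
  assume none: "\<not> ?thesis"
  have "Poly_Mapping.lookup (Poly_Mapping.single (m - a)
      (Poly_Mapping.lookup q a * Poly_Mapping.lookup f m * of_nat (diff_coeff a m))) b = 0"
    if "a \<in> Poly_Mapping.keys q" "m \<in> Poly_Mapping.keys f" for a m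
  proof (cases "diff_coeff a m = 0")
    case False
    then have "m - a \<noteq> b" using none that diff_coeff_neq_0_imp_add by metis
    then show ?thesis by (simp add: lookup_single)
  qed simp
  then have "Poly_Mapping.lookup (sym_act q f) b = 0"
    unfolding sym_act_def lookup_sum by (intro sum.neutral ballI) blast
  with assms show False by (simp add: in_keys_iff)
qed

text \<open>
  A linear functional on the part of degree \<open>d\<close> that annihilates the ideal is the pairing with a
  polynomial of degree \<open>d\<close>, which then lies in the kernel.
\<close>

lemma kernel_subset_imp_mem_ideal:
  fixes G :: "('v, 'k::field_char_0) poly_alg set"
  assumes B: "finite B"
    and G: "\<And>g. g \<in> G \<Longrightarrow> g \<in> sym_alg B \<and> (\<exists>e. homogeneous e g)"
    and q: "q \<in> sym_alg B" "homogeneous d q"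
    and ker: "\<And>f. f \<in> sym_ker B (sym_ideal B G) \<Longrightarrow> sym_act q f = 0"
  shows "q \<in> sym_ideal B G"
proof (rule ccontr)
  assume "q \<notin> sym_ideal B G"
  \<comment> \<open>Monomial multiples of generators in the degree of \<open>q\<close>; it is enough
    that their span lies inside the ideal.\<close>
  define T where "T = {Poly_Mapping.single a 1 * g | a g e.
    g \<in> G \<and> homogeneous e g \<and> Poly_Mapping.keys a \<subseteq> B \<and> monom_deg a + e = d}"
  have single_alg: "Poly_Mapping.single a y \<in> sym_alg B" if "Poly_Mapping.keys a \<subseteq> B"
    for a and y :: 'k using that by (simp add: sym_alg_def)
  have "sym_span T \<subseteq> sym_ideal B G"
  proof (rule sym.span_minimal)
    show "T \<subseteq> sym_ideal B G"
      unfolding T_def using sym_ideal_mult[OF sym_ideal_base single_alg] by blast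
    show "sym.subspace (sym_ideal B G)"
      by (auto simp: sym.subspace_def intro: sym_ideal_zero sym_ideal_add sym_ideal_mult)
  qed
  with \<open>q \<notin> sym_ideal B G\<close> have qT: "q \<notin> sym_span T" by blast
  interpret pair: vector_space_pair "\<lambda>c (f :: ('v, 'k) poly_alg). sym_const c * f" "(*) :: 'k \<Rightarrow> 'k \<Rightarrow> 'k"
    by (intro vector_space_pair.intro vector_space_sym)
      (unfold_locales, simp_all add: algebra_simps)
  obtain D where D: "D \<subseteq> T" "\<not> sym.dependent D" "T \<subseteq> sym_span D"
    using sym.basis_exists by metis
  have "sym_span T \<subseteq> sym_span D"
    using D(3) by (intro sym.span_minimal) auto
  have "q \<notin> sym_span D" using qT sym.span_mono[OF D(1)] by blast
  then have indep: "\<not> sym.dependent (insert q D)" using D(2) by (intro sym.independent_insertI)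
  \<comment> \<open>Extending from the independent set \<open>insert q D\<close> gives a functional
    that is 1 at \<open>q\<close> and vanishes on the span of \<open>T\<close>.\<close>
  obtain \<phi> where \<phi>: "\<And>x. x \<in> insert q D \<Longrightarrow> \<phi> x = (if x = q then 1 else 0)"
    and lin: "Vector_Spaces.linear (\<lambda>c f. sym_const c * f) (*) \<phi>"
    using pair.linear_independent_extend[OF indep, of "\<lambda>x. if x = q then 1 else 0"] by blast
  interpret \<phi>: Vector_Spaces.linear "\<lambda>c (f :: ('v, 'k) poly_alg). sym_const c * f" "(*)" \<phi>
    by (rule lin)
  have "q \<notin> D" using \<open>q \<notin> sym_span D\<close> sym.span_base by blast
  have \<phi>D: "\<phi> x = 0" if "x \<in> sym_span D" for x
    using that
  proof (induction rule: sym.span_induct_alt)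
    case (step a x y)
    then have "\<phi> x = 0" using \<phi>[of x] \<open>q \<notin> D\<close> by auto
    with step show ?case by (simp add: \<phi>.add \<phi>.scale)
  qed (rule \<phi>.zero)
  have \<phi>T: "\<phi> x = 0" if "x \<in> T" for x using that D(3) by (intro \<phi>D) blast
  let ?M = "{m. Poly_Mapping.keys m \<subseteq> B \<and> monom_deg m = d}"
  have M: "finite ?M" using B by (rule finite_monoms_of_degree)
  \<comment> \<open>Dividing by m! makes the pairing of \<open>f\<close> with the monomial
    \<open>m\<close> equal to \<phi> of that monomial.\<close>
  define f where "f = (\<Sum>m\<in>?M. Poly_Mapping.single m
    (\<phi> (Poly_Mapping.single m 1) / of_nat (diff_coeff m m)))"
  have f_alg: "f \<in> sym_alg B" unfolding f_def by (intro sym_alg_sum single_alg) simp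
  have pairing: "sym_act p f = sym_const (\<phi> p)" if p: "p \<in> sym_alg B" "homogeneous d p" for p
  proof -
    have mono: "sym_act (Poly_Mapping.single a y) f = sym_const (y * \<phi> (Poly_Mapping.single a 1))"
      if a: "a \<in> ?M" for a y
    proof -
      have "sym_act (Poly_Mapping.single a y) f = (\<Sum>m\<in>?M. Poly_Mapping.single (m - a)
          (y * (\<phi> (Poly_Mapping.single m 1) / of_nat (diff_coeff m m)) * of_nat (diff_coeff a m)))"
        unfolding f_def sym_act_sum_right sym_act_single ..
      also have "\<dots> = (\<Sum>m\<in>?M. if m = a then sym_const (y * \<phi> (Poly_Mapping.single a 1)) else 0)"
      proof (intro sum.cong refl)
        fix m assume m: "m \<in> ?M"
        have "m = a" if "diff_coeff a m \<noteq> 0"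
        proof -
          from diff_coeff_neq_0_imp_add[OF that] have "monom_deg m = monom_deg a + monom_deg (m - a)"
            using monom_deg_add by metis
          with a m have "monom_deg (m - a) = 0" by simp
          then have "m - a = 0"
            by (intro poly_mapping_eqI) (auto simp: monom_deg_def in_keys_iff)
          with diff_coeff_neq_0_imp_add[OF that] show "m = a" by simp
        qed
        then show "Poly_Mapping.single (m - a) (y * (\<phi> (Poly_Mapping.single m 1)
            / of_nat (diff_coeff m m)) * of_nat (diff_coeff a m))
          = (if m = a then sym_const (y * \<phi> (Poly_Mapping.single a 1)) else 0)"
          by (cases "diff_coeff a m = 0") (auto simp: diff_coeff_self sym_const_def)
      qed
      also have "\<dots> = sym_const (y * \<phi> (Poly_Mapping.single a 1))" using M a by simp
      finally show ?thesis .
    qed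
    let ?s = "\<lambda>a. Poly_Mapping.single a (Poly_Mapping.lookup p a)"
    have "sym_act p f = (\<Sum>a\<in>Poly_Mapping.keys p. sym_act (?s a) f)"
      by (subst poly_mapping_sum_single[of p]) (rule sym_act_sum_left)
    also have "\<dots> = (\<Sum>a\<in>Poly_Mapping.keys p. sym_const (\<phi> (?s a)))"
    proof (intro sum.cong refl)
      fix a assume "a \<in> Poly_Mapping.keys p"
      then have "a \<in> ?M" using p by (auto simp: sym_alg_def homogeneous_def)
      moreover have "?s a = sym_const (Poly_Mapping.lookup p a) * Poly_Mapping.single a 1"
        by (simp add: sym_const_def mult_single)
      then have "\<phi> (?s a) = Poly_Mapping.lookup p a * \<phi> (Poly_Mapping.single a 1)"
        by (simp only: \<phi>.scale)
      ultimately show "sym_act (?s a) f = sym_const (\<phi> (?s a))" by (simp only: mono)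
    qed
    also have "\<dots> = sym_const (\<Sum>a\<in>Poly_Mapping.keys p. \<phi> (?s a))"
      by (rule sym_const_sum[symmetric])
    also have "(\<Sum>a\<in>Poly_Mapping.keys p. \<phi> (?s a)) = \<phi> p"
      by (subst (2) poly_mapping_sum_single[of p]) (rule \<phi>.sum[symmetric])
    finally show ?thesis .
  qed
  have "sym_act g f = 0" if g: "g \<in> G" for g
  proof -
    obtain e where e: "g \<in> sym_alg B" "homogeneous e g" using G[OF g] by blast
    have "Poly_Mapping.lookup (sym_act g f) b = 0" for b
    proof (rule ccontr)
      assume nz: "Poly_Mapping.lookup (sym_act g f) b \<noteq> 0"
      then obtain a where a: "a \<in> Poly_Mapping.keys g" "a + b \<in> Poly_Mapping.keys f"
        using keys_sym_act by (metis in_keys_iff)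
      have "Poly_Mapping.keys f \<subseteq> ?M"
      proof
        fix m assume "m \<in> Poly_Mapping.keys f"
        then have "(\<Sum>m'\<in>?M. Poly_Mapping.lookup (Poly_Mapping.single m'
            (\<phi> (Poly_Mapping.single m' 1) / of_nat (diff_coeff m' m'))) m) \<noteq> 0"
          by (simp add: f_def in_keys_iff lookup_sum)
        then obtain m' where "m' \<in> ?M" "Poly_Mapping.lookup (Poly_Mapping.single m'
            (\<phi> (Poly_Mapping.single m' 1) / of_nat (diff_coeff m' m'))) m \<noteq> 0"
          by (meson sum.neutral)
        then show "m \<in> ?M" by (auto simp: lookup_single when_def split: if_splits)
      qed
      with a(2) have ab: "Poly_Mapping.keys (a + b) \<subseteq> B" "monom_deg a + monom_deg b = d"
        by (auto simp: monom_deg_add)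
      have b: "Poly_Mapping.keys b \<subseteq> B"
        using ab(1) by (auto simp: in_keys_iff lookup_add)
      have deg: "monom_deg b + e = d"
        using ab(2) a(1) e(2) by (auto simp: homogeneous_def)
      \<comment> \<open>The coefficient of \<open>g\<close> acting on \<open>f\<close> at
        \<open>b\<close> is seen, up to b!, by acting once more with the monomial \<open>b\<close>;
        the product \<open>?b * g\<close> lies in \<open>T\<close>, where \<phi> vanishes.\<close>
      let ?b = "Poly_Mapping.single b (1::'k)"
      have "?b * g \<in> T" unfolding T_def using g e(2) b deg by blast
      moreover have "homogeneous d (?b * g)"
        using homogeneous_mult[OF homogeneous_single e(2), of b 1] deg by simp
      ultimately have "sym_act (?b * g) f = 0"
        using pairing[of "?b * g"] single_alg[OF b] e(1) \<phi>T by auto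
      then have "Poly_Mapping.lookup (sym_act ?b (sym_act g f)) 0 = 0"
        by (simp add: sym_act_mult)
      with nz show False by (simp add: lookup_sym_act_single diff_coeff_self)
    qed
    then show ?thesis by (intro poly_mapping_eqI) simp
  qed
  then have "sym_act q f = 0" using f_alg by (intro ker) (simp add: sym_ker_ideal)
  moreover have "sym_act q f = sym_const 1" using pairing[OF q] \<phi>[of q] by simp
  ultimately show False by simp
qed

lemma sym_ideal_eqI:
  fixes G G' :: "('v, 'k::field_char_0) poly_alg set"
  assumes "finite B"
    and "\<And>g. g \<in> G \<union> G' \<Longrightarrow> g \<in> sym_alg B \<and> (\<exists>e. homogeneous e g)"
    and "sym_ker B (sym_ideal B G) = sym_ker B (sym_ideal B G')"
  shows "sym_ideal B G = sym_ideal B G'"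
proof -
  have "sym_ideal B G1 \<subseteq> sym_ideal B G2"
    if G1: "G1 \<subseteq> G \<union> G'" and G2: "G2 \<subseteq> G \<union> G'"
      and ker: "sym_ker B (sym_ideal B G1) = sym_ker B (sym_ideal B G2)"
    for G1 G2
  proof (rule sym_ideal_minimal, rule subsetI)
    fix g assume g: "g \<in> G1"
    then obtain d where "g \<in> sym_alg B" "homogeneous d g" using G1 assms(2) by blast
    then show "g \<in> sym_ideal B G2"
    proof (rule kernel_subset_imp_mem_ideal[OF assms(1), rotated])
      show "sym_act g f = 0" if "f \<in> sym_ker B (sym_ideal B G2)" for f
        using that g ker[symmetric]
        by (auto simp: sym_ker_ideal)
    qed (use G2 assms(2) in blast)
  qed
  from this[of G G'] this[of G' G] assms(3) show ?thesis by auto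
qed

section \<open>Flats and normals\<close>

text \<open>Ranks are taken in the space of all functions, which need not be finite-dimensional;
  finiteness of \<open>S\<close> replaces that assumption.\<close>

lemma (in vector_space) dim_insert_finite:
  assumes "finite S"
  shows "dim (insert a S) = (if a \<in> span S then dim S else Suc (dim S))"
proof (cases "a \<in> span S")
  case True
  then have "span (insert a S) = span S" by (rule span_redundant)
  then have "dim (insert a S) = dim S" by (rule span_eq_dim)
  with True show ?thesis by simp
next
  case False
  obtain D where D: "D \<subseteq> S" "independent D" "S \<subseteq> span D" "card D = dim S"
    using basis_exists by metis
  have "finite D" using D(1) assms by (rule finite_subset)
  have "a \<notin> span D" using False span_mono[OF D(1)] by blast
  then have "independent (insert a D)" "a \<notin> D"
    using D(2) span_base[of a D] by (auto simp: independent_insert)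
  moreover have "insert a S \<subseteq> span (insert a D)"
    using D(3) span_mono[of D "insert a D"] span_base[of a "insert a D"] by auto
  ultimately have "dim (insert a S) = card (insert a D)"
    using D(1) by (intro dim_unique) auto
  then show ?thesis using False \<open>a \<notin> D\<close> \<open>finite D\<close> D(4) by simp
qed

interpretation func: vector_space "fun_scale :: 'k::field \<Rightarrow> ('v \<Rightarrow> 'k) \<Rightarrow> 'v \<Rightarrow> 'k"
  by unfold_locales (auto simp: fun_scale_def fun_eq_iff algebra_simps)

section \<open>The dual space, its dimension and double annihilators\<close>

context polynomial_functions
begin

lemma subspace_dual: "func.subspace (dual_space (*s))"
proof -
  have "Vector_Spaces.linear (*s) (*) u \<longleftrightarrow> (\<forall>v w. u (v + w) = u v + u w) \<and> (\<forall>a v. u (a *s v) = a * u v)"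
    for u :: "'v \<Rightarrow> 'k"
    unfolding module_hom_iff_linear[symmetric] module_hom_iff
    using module_axioms by (auto simp: module_def algebra_simps)
  then show ?thesis
    by (auto simp: func.subspace_def dual_space_def fun_scale_def algebra_simps)
qed

lemma coordinate_dual: "(\<lambda>v. representation B v b) \<in> dual_space (*s)"
  by (simp add: dual_space_def linear_representation independent_Basis span_Basis)

text \<open>The coordinate functionals form a basis: values at \<open>B\<close> give the expansion
  of a functional, and evaluation at \<open>b\<close> isolates one coefficient.\<close>

lemma dim_dual: "func.dim (dual_space (*s)) = card B"
proof -
  let ?d = "\<lambda>b v. representation B v b"
  have d: "?d b b' = (if b' = b then 1 else 0)" if "b' \<in> B" for b b'
    using that by (simp add: representation_basis independent_Basis)
  have inj: "inj_on ?d B"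
  proof (rule inj_onI)
    fix b b' assume "b \<in> B" "b' \<in> B" "?d b = ?d b'"
    then show "b = b'" using d[of b b] d[of b b'] by (metis zero_neq_one)
  qed
  have eval: "(\<Sum>b\<in>B. fun_scale (a b) (?d b)) v = (\<Sum>b\<in>B. a b * ?d b v)" for a v
  proof -
    have "(\<Sum>b\<in>A. fun_scale (a b) (?d b)) v = (\<Sum>b\<in>A. a b * ?d b v)" if "finite A" for A
      using that by induction (simp_all add: fun_scale_def)
    then show ?thesis using finite_Basis by blast
  qed
  have "dual_space (*s) \<subseteq> func.span (?d ` B)"
  proof
    fix u assume u: "u \<in> dual_space (*s)"
    have "u = (\<Sum>b\<in>B. fun_scale (u b) (?d b))"
    proof
      fix v
      have "u v = u (\<Sum>b\<in>B. representation B v b *s b)" by (simp only: sum_representation)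
      also have "\<dots> = (\<Sum>b\<in>B. u b * ?d b v)"
        by (simp add: dual_sum dual_scale u mult.commute)
      finally show "u v = (\<Sum>b\<in>B. fun_scale (u b) (?d b)) v" unfolding eval .
    qed
    moreover have "(\<Sum>b\<in>B. fun_scale (u b) (?d b)) \<in> func.span (?d ` B)"
      by (intro func.span_sum func.span_scale func.span_base) auto
    ultimately show "u \<in> func.span (?d ` B)" by simp
  qed
  moreover have "\<not> func.dependent (?d ` B)"
  proof (rule func.independent_if_scalars_zero)
    show "finite (?d ` B)" using finite_Basis by simp
    fix a f assume 0: "(\<Sum>x\<in>?d ` B. fun_scale (a x) x) = 0" and f: "f \<in> ?d ` B"
    then obtain b where b: "b \<in> B" "f = ?d b" by blast
    have "0 = (\<Sum>x\<in>?d ` B. fun_scale (a x) x) b" by (simp add: 0)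
    also have "\<dots> = (\<Sum>b'\<in>B. a (?d b') * ?d b' b)"
      using inj by (simp add: sum.reindex eval)
    also have "\<dots> = (\<Sum>b'\<in>B. if b' = b then a f else 0)"
      using b d by (intro sum.cong) auto
    also have "\<dots> = a f" using b(1) finite_Basis by simp
    finally show "a f = 0" by simp
  qed
  moreover have "?d ` B \<subseteq> dual_space (*s)" using coordinate_dual by blast
  ultimately show ?thesis
    using inj by (intro func.dim_unique) (auto simp: card_image)
qed

lemma dual_separates: "(\<And>u. u \<in> dual_space (*s) \<Longrightarrow> u \<eta> = 0) \<Longrightarrow> \<eta> = 0"
  using sum_representation[of \<eta>] coordinate_dual by (metis (no_types, lifting) scale_zero_left sum.neutral)

lemma span_vanish:
  assumes "u \<in> func.span F" "\<And>w. w \<in> F \<Longrightarrow> w v = 0"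
  shows "u v = 0"
  using assms(1)
  by (induction rule: func.span_induct_alt) (simp_all add: fun_scale_def assms(2))

text \<open>If the new \<open>w\<close> is nonzero at a common zero \<xi> of \<open>F\<close>,
  subtracting a multiple of \<open>w\<close> makes \<open>u\<close> vanish at \<xi>, and hence on
  all common zeros of \<open>F\<close>.\<close>

lemma vanish_imp_span:
  assumes "finite F" "F \<subseteq> dual_space (*s)" "u \<in> dual_space (*s)"
    and "\<And>v. \<forall>w\<in>F. w v = 0 \<Longrightarrow> u v = 0"
  shows "u \<in> func.span F"
  using assms
proof (induction F arbitrary: u)
  case empty
  then have "u = 0" by (simp add: fun_eq_iff)
  then show ?case by (simp only: func.span_zero)
next
  case (insert w F)
  have w: "w \<in> dual_space (*s)" using insert.prems by simp
  have mono: "func.span F \<subseteq> func.span (insert w F)" by (rule func.span_mono) auto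
  show ?case
  proof (cases "\<forall>v. (\<forall>w\<in>F. w v = 0) \<longrightarrow> w v = 0")
    case True
    with insert.prems(3) have "u v = 0" if "\<forall>w\<in>F. w v = 0" for v using that by simp
    then have "u \<in> func.span F" using insert by blast
    with mono show ?thesis by blast
  next
    case False
    then obtain \<xi> where \<xi>: "\<forall>w\<in>F. w \<xi> = 0" "w \<xi> \<noteq> 0" by blast
    define a where "a = u \<xi> / w \<xi>"
    let ?u = "u - fun_scale a w"
    have "?u \<in> func.span F"
    proof (rule insert.IH)
      show "?u \<in> dual_space (*s)"
        using insert.prems(2) w subspace_dual by (intro func.subspace_diff func.subspace_scale)
      fix v assume v: "\<forall>w\<in>F. w v = 0"
      \<comment> \<open>Correcting by \<xi> moves a common zero of \<open>F\<close> into the zeros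
        of \<open>w\<close> as well, where the hypothesis on \<open>u\<close> applies.\<close>
      let ?v = "v - (w v / w \<xi>) *s \<xi>"
      have val: "x ?v = x v - w v / w \<xi> * x \<xi>" if "x \<in> dual_space (*s)" for x
        using that by (simp add: dual_diff dual_scale)
      have "\<forall>x\<in>insert w F. x ?v = 0"
      proof
        fix x assume x: "x \<in> insert w F"
        then have "x \<in> dual_space (*s)" using insert.prems(1) by blast
        with x v \<xi> show "x ?v = 0" by (auto simp: val)
      qed
      then have "u ?v = 0" by (rule insert.prems(3))
      then show "?u v = 0" using val[OF insert.prems(2)] \<xi>(2) by (simp add: a_def fun_scale_def field_simps)
    qed (use insert.prems in auto)
    then have "?u \<in> func.span (insert w F)" using mono by blast
    moreover have "fun_scale a w \<in> func.span (insert w F)"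
      by (intro func.span_scale func.span_base) simp
    ultimately have "?u + fun_scale a w \<in> func.span (insert w F)" by (rule func.span_add)
    then show ?thesis by simp
  qed
qed

end

section \<open>Rank, closure and flats in terms of common zeros\<close>

locale spanning_arrangement = arrangement scale B X
  for scale :: "'k::field_char_0 \<Rightarrow> 'v::ab_group_add \<Rightarrow> 'v" (infixr "*s" 75) and B :: "'v set"
    and X :: "('v \<Rightarrow> 'k) list" +
  assumes span_X: "func.span (set X) = dual_space (*s)"
begin

lemma set_X_image: "set X = (!) X ` ground X"
  by (auto simp: ground_def in_set_conv_nth)

lemma finite_ground: "finite (ground X)"
  by (simp add: ground_def)

lemma X_separates:
  assumes "\<And>i. i \<in> ground X \<Longrightarrow> (X ! i) \<eta> = 0"
  shows "\<eta> = 0"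
proof (rule dual_separates)
  fix u assume "u \<in> dual_space (*s)"
  then have "u \<in> func.span (set X)" by (simp add: span_X)
  then show "u \<eta> = 0" by (rule span_vanish) (use assms in \<open>auto simp: set_X_image\<close>)
qed

text \<open>Turns matroid closure into inclusion of zero sets, the form in which the induction meets
  redundancy.\<close>

lemma span_iff_perp:
  assumes "S \<subseteq> ground X" "i \<in> ground X"
  shows "X ! i \<in> func.span ((!) X ` S) \<longleftrightarrow> perp S \<subseteq> {v. (X ! i) v = 0}"
proof
  assume "X ! i \<in> func.span ((!) X ` S)"
  then show "perp S \<subseteq> {v. (X ! i) v = 0}"
    using span_vanish by (fastforce simp: perp_def)
next
  assume sub: "perp S \<subseteq> {v. (X ! i) v = 0}"
  have "finite S" using assms(1) finite_ground by (rule finite_subset)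
  then show "X ! i \<in> func.span ((!) X ` S)"
    using assms sub by (intro vanish_imp_span) (auto simp: perp_def intro: dual_X)
qed

lemma rank_insert:
  assumes "S \<subseteq> ground X" "i \<in> ground X"
  shows "rank X (insert i S) = (if perp S \<subseteq> {v. (X ! i) v = 0} then rank X S else Suc (rank X S))"
proof -
  have "finite ((!) X ` S)" using assms(1) finite_ground by (meson finite_imageI finite_subset)
  then show ?thesis
    unfolding rank_def image_insert by (simp only: func.dim_insert_finite span_iff_perp[OF assms])
qed

lemma clos_eq: "S \<subseteq> ground X \<Longrightarrow> clos X S = {i \<in> ground X. perp S \<subseteq> {v. (X ! i) v = 0}}"
  unfolding clos_def by (intro Collect_cong conj_cong refl) (simp add: rank_insert)

lemma clos_subset: "S \<subseteq> ground X \<Longrightarrow> S \<subseteq> clos X S"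
  by (auto simp: clos_eq perp_def)

lemma clos_ground: "clos X S \<subseteq> ground X"
  by (auto simp: clos_def)

lemma perp_clos: "S \<subseteq> ground X \<Longrightarrow> perp (clos X S) = perp S"
  using clos_subset[of S] by (auto simp: clos_eq perp_def)

lemma clos_mono:
  assumes "S \<subseteq> T" "T \<subseteq> ground X"
  shows "clos X S \<subseteq> clos X T"
proof -
  have "perp T \<subseteq> perp S" using assms(1) by (auto simp: perp_def)
  with assms show ?thesis by (auto simp: clos_eq)
qed

lemma clos_cong_perp: "S \<subseteq> ground X \<Longrightarrow> T \<subseteq> ground X \<Longrightarrow> perp S = perp T \<Longrightarrow> clos X S = clos X T"
  by (simp add: clos_eq)

lemma clos_flat: "S \<subseteq> ground X \<Longrightarrow> clos X S \<in> flats X"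
  using clos_ground clos_cong_perp[OF clos_ground _ perp_clos] by (auto simp: flats_def)

lemma flats_clos: "C \<in> flats X \<Longrightarrow> clos X C = C" "C \<in> flats X \<Longrightarrow> C \<subseteq> ground X"
  by (auto simp: flats_def)

lemma ground_flat: "ground X \<in> flats X"
  using clos_subset[of "ground X"] clos_ground by (auto simp: flats_def)

lemma flat_of_eq: "flat_of X \<eta> = vanishing (ground X) \<eta>"
  by (auto simp: flat_of_def vanishing_def)

lemma flat_of_flat: "flat_of X \<eta> \<in> flats X"
proof -
  have "flat_of X \<eta> \<subseteq> ground X" by (auto simp: flat_of_def)
  moreover from this have "clos X (flat_of X \<eta>) \<subseteq> flat_of X \<eta>"
    by (auto simp: clos_eq flat_of_def perp_def)
  ultimately show ?thesis using clos_subset by (auto simp: flats_def)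
qed

lemma flat_of_ground_iff: "flat_of X \<eta> = ground X \<longleftrightarrow> \<eta> = 0"
proof
  assume "flat_of X \<eta> = ground X"
  then show "\<eta> = 0" by (intro X_separates) (auto simp: flat_of_def)
qed (auto simp: flat_of_def dual_0 dual_X)

text \<open>Adding \<open>j\<close> raises the rank by exactly one and already gives a spanning
  set.\<close>

lemma rank_corank_1:
  assumes "C \<subseteq> ground X" "j \<in> ground X - clos X C" "clos X (insert j C) = ground X"
  shows "rank X C + 1 = card B"
proof -
  have j: "j \<in> ground X" and sub: "insert j C \<subseteq> ground X" using assms by auto
  have "\<not> perp C \<subseteq> {v. (X ! j) v = 0}" using assms(1,2) by (auto simp: clos_eq)
  then have "rank X (insert j C) = rank X C + 1" using assms(1) j by (simp add: rank_insert)
  moreover have "func.span ((!) X ` insert j C) = dual_space (*s)"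
  proof
    show "func.span ((!) X ` insert j C) \<subseteq> dual_space (*s)"
      unfolding span_X[symmetric] set_X_image using sub by (intro func.span_mono) auto
    have "set X \<subseteq> func.span ((!) X ` insert j C)"
    proof -
      have "X ! i \<in> func.span ((!) X ` insert j C)" if i: "i \<in> ground X" for i
        using i assms(3) span_iff_perp[OF sub i] clos_eq[OF sub] by auto
      then show ?thesis by (auto simp: set_X_image)
    qed
    then show "dual_space (*s) \<subseteq> func.span ((!) X ` insert j C)"
      unfolding span_X[symmetric] by (intro func.span_minimal) auto
  qed
  then have "rank X (insert j C) = card B"
    unfolding rank_def using func.dim_span[of "(!) X ` insert j C"] dim_dual by simp
  ultimately show ?thesis by simp
qed

lemma hyperplaneI:
  assumes "C \<in> flats X" "j \<in> ground X - C" "clos X (insert j C) = ground X"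
  shows "C \<in> hyperplanes (*s) X"
  using rank_corank_1[of C j] assms by (auto simp: hyperplanes_def flats_clos)

lemma hyperplane_neq_ground:
  assumes "C \<in> hyperplanes (*s) X"
  shows "C \<noteq> ground X"
proof
  assume "C = ground X"
  then have "rank X C = func.dim (func.span (set X))"
    by (simp add: rank_def set_X_image)
  then have "rank X C = card B" by (simp only: span_X dim_dual)
  with assms show False by (simp add: hyperplanes_def)
qed

end

section \<open>Power ideals\<close>

definition weight :: "('v \<Rightarrow> 'k::field) list \<Rightarrow> nat set set \<Rightarrow> nat set \<Rightarrow> nat"
  where "weight X J S = (if clos X S \<in> J then 1 else 0)"

lemma int_weight: "chi X J S = int (weight X J S)"
  by (simp add: chi_def weight_def)

lemma exponent_weight: "k \<ge> 0 \<Longrightarrow>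
    exponent X k J C = card (ground X - C) + nat k + weight X J C"
  by (simp add: exponent_def codeg_def int_weight nat_add_distrib)

context spanning_arrangement
begin

lemma sym_ker_power_ideal: "sym_ker B (power_ideal (*s) B X k J) =
  {f \<in> sym_alg B. \<forall>\<eta>. \<eta> \<noteq> 0 \<longrightarrow> deg_below (exponent X k J (flat_of X \<eta>)) UNIV f \<eta>}"
  unfolding power_ideal_def sym_ker_ideal by (auto simp: sym_act_V_power_eq_0_iff[symmetric])

lemma sym_ker_power_ideal': "sym_ker B (power_ideal' (*s) B X k J E) =
  {f \<in> sym_alg B. \<forall>C \<in> hyperplanes (*s) X \<union> max_missing_flats X J.
    deg_below (exponent X k J C) UNIV f (E C)}"
  unfolding power_ideal'_def sym_ker_ideal by (auto simp: sym_act_V_power_eq_0_iff[symmetric])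

lemma weighted:
  assumes "upper_set X J"
  shows "weighted_arrangement (*s) B X (weight X J)"
proof unfold_locales
  fix S T assume "S \<subseteq> T" "T \<subseteq> ground X"
  then have "clos X S \<in> J \<longrightarrow> clos X T \<in> J"
    using assms clos_mono clos_flat by (auto simp: upper_set_def)
  then show "weight X J S \<le> weight X J T" by (simp add: weight_def)
qed (simp add: weight_def)

lemma clos_insert_redundant:
  assumes "S \<subseteq> ground X" "i \<in> ground X" "perp S \<subseteq> {v. (X ! i) v = 0}"
  shows "clos X (insert i S) = clos X S"
  using assms by (intro clos_cong_perp) (auto simp: perp_insert)

lemma ground_mem: "upper_set X J \<Longrightarrow> J \<noteq> {} \<Longrightarrow> ground X \<in> J"
  using ground_flat by (fastforce simp: upper_set_def flats_def)

lemma weight_insert: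
  assumes "S \<subseteq> ground X" "i \<in> clos X S"
  shows "weight X J (insert i S) = weight X J S"
  using assms clos_insert_redundant[of S i] by (auto simp: weight_def clos_eq)

text \<open>The strict bound in \<open>gens\<close> also covers k = 0: it admits exactly the
  constants when the weight is 1 and nothing when it is 0, and scalar factors do not affect the
  span.\<close>

lemma P_space_eq_span_gens:
  assumes "upper_set X J" "k \<ge> 0"
  shows "P_space B X k J = sym_span (weighted_arrangement.gens B X (weight X J) (nat k) {} (ground X))"
proof -
  interpret weighted_arrangement "(*s)" B X "weight X J" by (rule weighted) fact
  show ?thesis
  proof (cases "k = 0")
    case False
    have "int (sym_degree g) \<le> chi X J S + k - 1 \<longleftrightarrow> sym_degree g < nat k + weight X J S"
      for g :: "('v, 'k) poly_alg" and S
      using assms(2) by (auto simp: int_weight)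
    then show ?thesis
      using False assms(2) by (simp add: P_space_def P_gens_def gens_def conj_ac)
  next
    case True
    have P: "P_gens B X k J = {prod_U B X Y | Y. Y \<subseteq> ground X \<and> weight X J (ground X - Y) = 1}"
      using True by (auto simp: P_gens_def weight_def split: if_splits)
    have "P_gens B X k J \<subseteq> gens 0 {} (ground X)"
    proof
      fix p assume "p \<in> P_gens B X k J"
      then obtain Y where Y: "p = prod_U B X Y" "Y \<subseteq> ground X" "weight X J (ground X - Y) = 1"
        unfolding P by blast
      then show "p \<in> gens 0 {} (ground X)"
        unfolding gens_def by (intro CollectI exI[of _ 1] exI[of _ Y]) simp
    qed
    moreover have "gens 0 {} (ground X) \<subseteq> sym_span (P_gens B X k J)"
    proof
      fix p assume "p \<in> gens 0 {} (ground X)"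
      then obtain g Y where g: "p = g * prod_U B X Y" "Y \<subseteq> ground X"
        "sym_degree g < weight X J (ground X - Y)" by (auto simp: gens_def)
      then have "sym_degree g = 0" "weight X J (ground X - Y) = 1"
        using c_le_1[of "ground X - Y"] by linarith+
      from \<open>sym_degree g = 0\<close> obtain a where "g = sym_const a" by (rule sym_degree_0_const)
      moreover have "prod_U B X Y \<in> P_gens B X k J"
        unfolding P using g(2) \<open>weight X J (ground X - Y) = 1\<close> by blast
      ultimately have "p = sym_const a * prod_U B X Y" "prod_U B X Y \<in> P_gens B X k J"
        using g(1) by simp_all
      then show "p \<in> sym_span (P_gens B X k J)" by (simp add: sym.span_scale sym.span_base)
    qed
    ultimately have "sym_span (P_gens B X k J) = sym_span (gens 0 {} (ground X))"
      by (intro antisym sym.span_minimal sym.subspace_span) (use sym.span_superset in blast)+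
    then show ?thesis using True by (simp add: P_space_def)
  qed
qed

lemma P_space_subset_alg: "P_space B X k J \<subseteq> sym_alg B"
  unfolding P_space_def by (intro sym_span_sym_alg) (auto simp: P_gens_def intro: sym_alg_mult)

text \<open>For k = -1 the condition defining the generators, taken at the flat of \<eta>, is itself
  the required count of factors nonzero at \<eta>.\<close>

lemma P_space_subset_ker:
  assumes J: "upper_set X J" and k: "k \<ge> - 1"
  shows "P_space B X k J \<subseteq> sym_ker B (power_ideal (*s) B X k J)"
proof (cases "k \<ge> 0")
  case True
  interpret weighted_arrangement "(*s)" B X "weight X J" by (rule weighted) fact
  show ?thesis
  proof
    fix f assume f: "f \<in> P_space B X k J"
    then have "f \<in> sym_span (gens (nat k) {} (ground X))"
      using P_space_eq_span_gens[OF J True] by simp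
    from deg_below_gens[OF _ _ this]
    have "deg_below (exponent X k J (flat_of X \<eta>)) UNIV f \<eta>" for \<eta>
      by (simp add: exponent_weight[OF True] flat_of_eq)
    then show "f \<in> sym_ker B (power_ideal (*s) B X k J)"
      using f P_space_subset_alg by (auto simp: sym_ker_power_ideal)
  qed
next
  case False
  with k have k: "k = - 1" by simp
  have "deg_below (exponent X (- 1) J (flat_of X \<eta>)) UNIV f \<eta>"
    if f: "f \<in> P_space B X k J" and \<eta>: "\<eta> \<noteq> 0" for f \<eta>
    using f unfolding P_space_def
  proof (rule deg_below_span[rotated])
    fix p assume "p \<in> P_gens B X k J"
    then obtain Y where p: "p = prod_U B X Y" and Y: "Y \<subseteq> ground X"
      "\<forall>C\<in>flats X - {ground X}. int (card (Y - C)) < codeg X C - 1 + chi X J C"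
      by (auto simp: P_gens_def k)
    let ?C = "flat_of X \<eta>"
    have "?C \<in> flats X - {ground X}"
      using \<eta> by (simp add: flat_of_flat flat_of_ground_iff)
    then have "int (card (Y - ?C)) < codeg X ?C - 1 + chi X J ?C" using Y(2) by blast
    moreover have "Y - vanishing Y \<eta> = Y - ?C"
      using Y(1) by (auto simp: vanishing_def flat_of_def)
    ultimately have le: "Suc (card (Y - vanishing Y \<eta>)) \<le> exponent X (- 1) J ?C"
      by (simp add: exponent_def)
    have "finite Y" using Y(1) finite_ground by (rule finite_subset)
    then show "deg_below (exponent X (- 1) J ?C) UNIV p \<eta>"
      unfolding p by (intro deg_below_mono[OF deg_below_prod_U[where W = UNIV] le] Y(1)) simp_all
  qed
  with P_space_subset_alg[of k J] show ?thesis
    by (auto simp: sym_ker_power_ideal k)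
qed

lemma exponent_mono: "codeg X C + k + chi X J C \<le> codeg X C + k' + chi X J' C \<Longrightarrow>
    exponent X k J C \<le> exponent X k' J' C"
  by (simp add: exponent_def nat_mono)

text \<open>
  When \<open>J\<close> contains all hyperplanes, the conditions that define \<open>S(X,-1,J)\<close> at the smaller flats
  follow from those at the hyperplanes: both spaces are the central one.
\<close>

lemma P_space_central_subset:
  assumes H: "hyperplanes (*s) X \<subseteq> J"
  shows "P_space B X 0 {ground X} \<subseteq> P_space B X (- 1) J"
proof -
  have "prod_U B X Y \<in> P_gens B X (- 1) J"
    if Y: "Y \<subseteq> ground X" "clos X (ground X - Y) = ground X" for Y
  proof -
    have "int (card (Y - C)) < codeg X C - 1 + chi X J C" if C: "C \<in> flats X - {ground X}" for C
    proof -
      \<comment> \<open>Since m(C) is the sum of the sizes of \<open>Y - C\<close> and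
        \<open>?R\<close>, the claim says |R| + \<chi>(C) > 1. The complement of \<open>Y\<close>
        spans, so \<open>?R\<close> is nonempty; a single element forces \<open>C\<close> to be a
        hyperplane, and then \<chi>(C) = 1.\<close>
      let ?R = "ground X - Y - C"
      have sub: "C \<subseteq> ground X" "clos X C = C" using C flats_clos by auto
      have "ground X - C = (Y - C) \<union> ?R" using Y(1) by auto
      then have "codeg X C = int (card (Y - C) + card ?R)"
        unfolding codeg_def using Y(1) finite_ground
        by (subst card_Un_disjoint[symmetric]) (auto intro: finite_subset)
      moreover have "card ?R \<noteq> 0"
      proof
        assume "card ?R = 0"
        then have "ground X - Y \<subseteq> C" using finite_ground by auto
        then have "ground X \<subseteq> C" using clos_mono[OF _ sub(1)] Y(2) sub(2) by blast
        then show False using C sub by blast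
      qed
      moreover have "C \<in> J" if 1: "card ?R = 1"
      proof -
        obtain j where j: "?R = {j}" using 1 by (auto simp: card_1_singleton_iff)
        then have jC: "j \<in> ground X - C" by blast
        then have "insert j C \<subseteq> ground X" using sub by blast
        moreover have "ground X - Y \<subseteq> insert j C" using j by blast
        ultimately have "ground X \<subseteq> clos X (insert j C)" using clos_mono Y(2) by blast
        then have "clos X (insert j C) = ground X" using clos_ground by blast
        with jC C have "C \<in> hyperplanes (*s) X" by (intro hyperplaneI) auto
        with H show ?thesis by blast
      qed
      ultimately show ?thesis
        by (cases "card ?R = 1") (auto simp: chi_def sub(2))
    qed
    then show ?thesis using Y(1) by (auto simp: P_gens_def)
  qed
  then show ?thesis
    unfolding P_space_def by (intro sym.span_mono) (auto simp: P_gens_def)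
qed

lemma upper_set_ground: "upper_set X {ground X}"
  using ground_flat by (auto simp: upper_set_def flats_def)

lemma ker_subset_P_space_nonneg:
  assumes J: "upper_set X J" "J \<noteq> {}" and k: "k \<ge> 0"
  shows "sym_ker B (power_ideal (*s) B X k J) \<subseteq> P_space B X k J"
proof
  interpret weighted_arrangement "(*s)" B X "weight X J" by (rule weighted) fact
  fix f assume "f \<in> sym_ker B (power_ideal (*s) B X k J)"
  then have f: "f \<in> sym_alg B"
    and deg: "\<And>\<eta>. \<eta> \<noteq> 0 \<Longrightarrow> deg_below (exponent X k J (flat_of X \<eta>)) UNIV f \<eta>"
    by (auto simp: sym_ker_power_ideal)
  \<comment> \<open>The ideal has no generator for \<eta> = 0, but the induction wants all
    directions. A constant line only needs a bound of at least 1, which holds because the ground set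
    lies in \<open>J\<close>.\<close>
  have deg_0: "deg_below (exponent X k J (flat_of X 0)) UNIV f 0"
  proof -
    have "flat_of X 0 = ground X" by (simp add: flat_of_ground_iff)
    moreover have "clos X (ground X) = ground X" using ground_flat by (rule flats_clos)
    ultimately have "exponent X k J (flat_of X 0) \<ge> 1"
      using k ground_mem[OF J] by (simp add: exponent_weight weight_def)
    then have "\<forall>i\<ge>exponent X k J (flat_of X 0). coeff [:a:] i = 0" for a :: 'k
      by (auto simp: coeff_pCons split: nat.split)
    then show ?thesis unfolding deg_below_def
      by (intro ballI exI[of _ "[:ev f v:]" for v]) simp
  qed
  have "\<exists>g\<in>sym_span (gens (nat k) {} (ground X)). \<forall>v. ev f v = ev g v"
  proof (rule deg_below_imp_gens[OF _ f])
    fix S i assume "S \<subseteq> ground X" "i \<in> ground X" "perp S \<subseteq> {v. (X ! i) v = 0}"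
    then show "weight X J (insert i S) = weight X J S"
      by (simp add: weight_def clos_insert_redundant)
  next
    fix \<eta>
    show "deg_below (card (ground X - vanishing (ground X) \<eta>) + nat k
        + weight X J (vanishing (ground X) \<eta>)) UNIV f \<eta>"
      using deg[of \<eta>] deg_0 by (cases "\<eta> = 0") (simp_all add: exponent_weight[OF k] flat_of_eq)
  qed
  then obtain g where g: "g \<in> P_space B X k J" "\<And>v. ev f v = ev g v"
    using P_space_eq_span_gens[OF J(1) k] by auto
  then have "f = g" using f P_space_subset_alg by (intro ev_inject) auto
  with g show "f \<in> P_space B X k J" by simp
qed

text \<open>For k = -1 the exponent m - 1 + \<chi> is at most m, so the kernel is contained in the
  one for k = 0 and the upper set \<open>{ground X}\<close>; the central space then returns to
  \<open>J\<close>.\<close>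

lemma ker_subset_P_space:
  assumes J: "upper_set X J" "J \<noteq> {}" and k: "k \<ge> - 1"
    and H: "k = - 1 \<Longrightarrow> hyperplanes (*s) X \<subseteq> J"
  shows "sym_ker B (power_ideal (*s) B X k J) \<subseteq> P_space B X k J"
proof (cases "k = - 1")
  case True
  have "sym_ker B (power_ideal (*s) B X k J) \<subseteq> sym_ker B (power_ideal (*s) B X 0 {ground X})"
    unfolding sym_ker_power_ideal
  proof (intro subsetI CollectI conjI allI impI; elim CollectE conjE)
    fix f and \<eta> :: 'v assume "\<forall>\<eta>. \<eta> \<noteq> 0 \<longrightarrow> deg_below (exponent X k J (flat_of X \<eta>)) UNIV f \<eta>" "\<eta> \<noteq> 0"
    then have "deg_below (exponent X k J (flat_of X \<eta>)) UNIV f \<eta>" by blast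
    moreover have "exponent X k J (flat_of X \<eta>) \<le> exponent X 0 {ground X} (flat_of X \<eta>)"
      by (rule exponent_mono) (auto simp: chi_def True)
    ultimately show "deg_below (exponent X 0 {ground X} (flat_of X \<eta>)) UNIV f \<eta>"
      by (rule deg_below_mono) simp
  qed
  also have "\<dots> \<subseteq> P_space B X 0 {ground X}"
    by (intro ker_subset_P_space_nonneg upper_set_ground) auto
  also have "\<dots> \<subseteq> P_space B X k J"
    using P_space_central_subset[OF H[OF True]] True by simp
  finally show ?thesis .
next
  case False
  with k J show ?thesis by (intro ker_subset_P_space_nonneg) auto
qed

lemma normal_selectorD: "normal_selector X E \<Longrightarrow> C \<in> flats X \<Longrightarrow> flat_of X (E C) = C"
  by (simp add: normal_selector_def)

text \<open>A hyperplane is a proper flat, and so is a missing flat because \<open>J\<close>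
  contains the ground set. Hence \<open>E C\<close> is nonzero and its power is one of the
  generators of the full ideal.\<close>

lemma ker_subset_ker':
  assumes J: "upper_set X J" "J \<noteq> {}" and E: "normal_selector X E"
  shows "sym_ker B (power_ideal (*s) B X k J) \<subseteq> sym_ker B (power_ideal' (*s) B X k J E)"
proof -
  have "flat_of X (E C) = C \<and> E C \<noteq> 0" if C: "C \<in> hyperplanes (*s) X \<union> max_missing_flats X J" for C
  proof -
    have "C \<in> flats X" using C by (auto simp: hyperplanes_def max_missing_flats_def)
    then have "flat_of X (E C) = C" by (rule normal_selectorD[OF E])
    moreover have "C \<noteq> ground X"
      using C hyperplane_neq_ground ground_mem[OF J] by (auto simp: max_missing_flats_def)
    ultimately show ?thesis using flat_of_ground_iff by metis
  qed
  then show ?thesis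
    unfolding sym_ker_power_ideal sym_ker_power_ideal' by fastforce
qed

text \<open>Rigidity over the whole arrangement says that the vectors killed by the flat of \<eta>
  form a line. One further functional leaves only 0, and all nonzero normals are
  proportional.\<close>

lemma rigid_normal:
  assumes J: "upper_set X J" and E: "normal_selector X E"
    and rigid: "weighted_arrangement.rigid X {} (ground X) \<eta>" and \<eta>: "\<eta> \<noteq> 0"
  shows "flat_of X \<eta> \<in> hyperplanes (*s) X" and "\<exists>a. \<eta> = a *s E (flat_of X \<eta>)"
proof -
  interpret weighted_arrangement "(*s)" B X "weight X J" by (rule weighted) fact
  let ?C = "flat_of X \<eta>"
  have C: "?C \<in> flats X" "?C \<subseteq> ground X" by (rule flat_of_flat, auto simp: flat_of_def)
  have "?C \<noteq> ground X" using \<eta> by (simp add: flat_of_ground_iff)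
  with C(2) obtain j where j: "j \<in> ground X - ?C" by blast
  have scalar: "\<exists>a. \<forall>i\<in>ground X. (X ! i) \<xi> = a * (X ! i) \<eta>" if "\<forall>i\<in>?C. (X ! i) \<xi> = 0" for \<xi>
    using rigid that unfolding rigid_def flat_of_eq by (simp add: perp_def)
  have "perp (insert j ?C) \<subseteq> {0}"
  proof
    fix \<xi> assume \<xi>: "\<xi> \<in> perp (insert j ?C)"
    then have "\<forall>i\<in>?C. (X ! i) \<xi> = 0" by (simp add: perp_def)
    then obtain a where a: "\<forall>i\<in>ground X. (X ! i) \<xi> = a * (X ! i) \<eta>"
      using scalar by blast
    have "a * (X ! j) \<eta> = 0" using a j \<xi> by (auto simp: perp_def)
    then have "a = 0" using j by (auto simp: flat_of_def)
    with a show "\<xi> \<in> {0}" using X_separates[of \<xi>] by simp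
  qed
  then have "perp (insert j ?C) \<subseteq> {v. (X ! i) v = 0}" if "i \<in> ground X" for i
    using dual_0[OF dual_X[OF that]] by blast
  then have "clos X (insert j ?C) = ground X"
    using j C(2) by (subst clos_eq) auto
  with C(1) j show "?C \<in> hyperplanes (*s) X" by (intro hyperplaneI)
  have EC: "flat_of X (E ?C) = ?C" using normal_selectorD[OF E C(1)] .
  then have "\<forall>i\<in>?C. (X ! i) (E ?C) = 0" by (metis (mono_tags, lifting) flat_of_def mem_Collect_eq)
  then obtain a where a: "\<forall>i\<in>ground X. (X ! i) (E ?C) = a * (X ! i) \<eta>" using scalar by blast
  have "a \<noteq> 0"
  proof
    assume "a = 0"
    then have "E ?C = 0" using a by (intro X_separates) simp
    then show False using EC \<open>?C \<noteq> ground X\<close> flat_of_ground_iff by metis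
  qed
  have "E ?C - a *s \<eta> = 0"
    using a by (intro X_separates) (simp add: dual_X dual_diff dual_scale)
  then have "\<eta> = inverse a *s E ?C" using \<open>a \<noteq> 0\<close> by simp
  then show "\<exists>a. \<eta> = a *s E ?C" ..
qed

text \<open>Elements of the closure do not change the weight, so maximality makes \<open>S\<close>
  closed. A larger missing flat would contain the closure of some \<open>insert i S\<close>, which
  is in \<open>J\<close>.\<close>

lemma max_missing_flat:
  assumes J: "upper_set X J" and S: "weighted_arrangement.max_missing (weight X J) {} (ground X) S"
  shows "S \<in> max_missing_flats X J"
proof -
  interpret weighted_arrangement "(*s)" B X "weight X J" by (rule weighted) fact
  have sub: "S \<subseteq> ground X" and 0: "weight X J S = 0"
    and 1: "\<And>i. i \<in> ground X - S \<Longrightarrow> weight X J (insert i S) = 1"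
    using S by (auto simp: max_missing_def)
  have "clos X S \<subseteq> S"
  proof
    fix i assume i: "i \<in> clos X S"
    then have "weight X J (insert i S) = 0" using weight_insert[OF sub] 0 by simp
    with 1 i clos_ground show "i \<in> S" by fastforce
  qed
  then have clos: "clos X S = S" using clos_subset[OF sub] by blast
  have "C = S" if C: "C \<in> flats X" "C \<notin> J" "S \<subseteq> C" for C
  proof (rule ccontr)
    assume "C \<noteq> S"
    with C obtain i where i: "i \<in> C - S" by blast
    have CX: "C \<subseteq> ground X" "clos X C = C" using flats_clos C by auto
    have "clos X (insert i S) \<in> J" using 1[of i] i CX by (auto simp: weight_def split: if_splits)
    moreover have "clos X (insert i S) \<subseteq> C" using clos_mono[of "insert i S" C] C i CX by auto
    ultimately have "C \<in> J" using J C(1) by (auto simp: upper_set_def)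
    with C show False by simp
  qed
  moreover have "S \<notin> J" using 0 clos by (auto simp: weight_def split: if_splits)
  ultimately show ?thesis using sub clos by (auto simp: max_missing_flats_def flats_def)
qed

text \<open>For this upper set, missing means not spanning, so maximal missing sets are hyperplanes;
  these occur among the generators of the smaller ideal for every \<open>J\<close>.\<close>

lemma hyperplane_missing_only_ground:
  assumes S: "weighted_arrangement.max_missing (weight X {ground X}) {} (ground X) S"
  shows "S \<in> hyperplanes (*s) X"
proof -
  interpret weighted_arrangement "(*s)" B X "weight X {ground X}"
    by (rule weighted) (rule upper_set_ground)
  have flat: "S \<in> flats X" "S \<noteq> ground X"
    using max_missing_flat[OF upper_set_ground S] by (auto simp: max_missing_flats_def)
  then obtain j where j: "j \<in> ground X - S" using flats_clos by blast
  then have "clos X (insert j S) = ground X"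
    using S by (auto simp: max_missing_def weight_def split: if_splits)
  with flat j show ?thesis by (intro hyperplaneI)
qed

text \<open>
  Both cases of the second half at once: \<open>J0\<close> is \<open>J\<close> for \<open>k = 0\<close>, and consists of the ground set
  alone for \<open>k = -1\<close>.
\<close>

lemma ker'_subset_P_space_aux:
  assumes J0: "upper_set X J0" "J0 \<noteq> {}" and E: "normal_selector X E"
    and hyp: "\<And>C. C \<in> hyperplanes (*s) X \<Longrightarrow> exponent X k J C \<le> card (ground X - C) + 1"
    and mis: "\<And>S. weighted_arrangement.max_missing (weight X J0) {} (ground X) S \<Longrightarrow>
      S \<in> hyperplanes (*s) X \<union> max_missing_flats X J \<and> exponent X k J S \<le> card (ground X - S)"
  shows "sym_ker B (power_ideal' (*s) B X k J E) \<subseteq> P_space B X 0 J0"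
proof
  interpret weighted_arrangement "(*s)" B X "weight X J0" by (rule weighted) fact
  fix f assume "f \<in> sym_ker B (power_ideal' (*s) B X k J E)"
  then have f: "f \<in> sym_alg B"
    and deg: "\<And>C. C \<in> hyperplanes (*s) X \<union> max_missing_flats X J \<Longrightarrow>
      deg_below (exponent X k J C) UNIV f (E C)"
    by (auto simp: sym_ker_power_ideal')
  have "\<exists>g\<in>sym_span (gens 0 {} (ground X)). \<forall>v. ev f v = ev g v"
  proof (rule rigid_deg_below_imp_gens[OF f])
    fix \<eta> assume rigid: "rigid {} (ground X) \<eta>"
    show "deg_below (card (ground X - vanishing (ground X) \<eta>) + 1) UNIV f \<eta>"
    proof (cases "\<eta> = 0")
      case True
      have "\<forall>i\<ge>n + 1. coeff [:a:] i = 0" for a :: 'k and n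
        by (auto simp: coeff_pCons split: nat.split)
      then show ?thesis unfolding deg_below_def True
        by (intro ballI exI[of _ "[:ev f v:]" for v]) simp
    next
      case False
      let ?C = "flat_of X \<eta>"
      from rigid_normal[OF J0(1) E rigid False] obtain a where
        C: "?C \<in> hyperplanes (*s) X" and a: "\<eta> = a *s E ?C" by blast
      \<comment> \<open>The ideal bounds the degree only along the selected normal; \<eta> is a
        multiple of it.\<close>
      have "deg_below (exponent X k J ?C) UNIV f (a *s E ?C)"
        using C by (intro deg_below_scale deg) simp
      then have "deg_below (exponent X k J ?C) UNIV f \<eta>" using a by simp
      then show ?thesis unfolding flat_of_eq[symmetric]
        by (rule deg_below_mono) (use hyp[OF C] in simp_all)
    qed
  next
    fix S assume "max_missing {} (ground X) S"
    note S = mis[OF this]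
    then have "S \<in> flats X" by (auto simp: hyperplanes_def max_missing_flats_def)
    moreover have "deg_below (card (ground X - S)) UNIV f (E S)"
      by (rule deg_below_mono[OF deg[of S]]) (use S in simp_all)
    ultimately show "\<exists>\<eta>. vanishing (ground X) \<eta> = S \<and> deg_below (card (ground X - S)) UNIV f \<eta>"
      using normal_selectorD[OF E] flat_of_eq by metis
  qed
  then obtain g where g: "g \<in> P_space B X 0 J0" "\<And>v. ev f v = ev g v"
    using P_space_eq_span_gens[OF J0(1), of 0] by auto
  then have "f = g" using f P_space_subset_alg by (intro ev_inject) auto
  with g show "f \<in> P_space B X 0 J0" by simp
qed

text \<open>For k = 0 the exponents are at most m + 1, and equal to m at missing flats. For k = -1
  they are at most m at every set, as the induction with \<open>{ground X}\<close> requires, and the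
  central space embeds in the one for \<open>J\<close>.\<close>

lemma ker'_subset_P_space:
  assumes J: "upper_set X J" "J \<noteq> {}" and k: "k \<in> {- 1, 0}"
    and H: "k = - 1 \<Longrightarrow> hyperplanes (*s) X \<subseteq> J" and E: "normal_selector X E"
  shows "sym_ker B (power_ideal' (*s) B X k J E) \<subseteq> P_space B X k J"
proof (cases "k = 0")
  case True
  have "sym_ker B (power_ideal' (*s) B X k J E) \<subseteq> P_space B X 0 J"
  proof (rule ker'_subset_P_space_aux[OF J E])
    show "exponent X k J C \<le> card (ground X - C) + 1" for C
      by (simp add: True exponent_weight weight_def)
    fix S assume "weighted_arrangement.max_missing (weight X J) {} (ground X) S"
    from max_missing_flat[OF J(1) this] have S: "S \<in> max_missing_flats X J" .
    then have "weight X J S = 0"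
      using flats_clos by (auto simp: max_missing_flats_def weight_def)
    with S show "S \<in> hyperplanes (*s) X \<union> max_missing_flats X J
        \<and> exponent X k J S \<le> card (ground X - S)"
      by (simp add: True exponent_weight)
  qed
  with True show ?thesis by simp
next
  case False
  with k have k: "k = - 1" by simp
  have exp: "exponent X k J C \<le> card (ground X - C)" for C
    by (simp add: k exponent_def codeg_def chi_def nat_le_iff)
  have "sym_ker B (power_ideal' (*s) B X k J E) \<subseteq> P_space B X 0 {ground X}"
  proof (rule ker'_subset_P_space_aux[OF upper_set_ground _ E])
    show "exponent X k J C \<le> card (ground X - C) + 1" for C
      using exp[of C] by simp
  qed (use exp hyperplane_missing_only_ground in auto)
  with P_space_central_subset[OF H[OF k]] show ?thesis by (auto simp: k)
qed

lemma power_ideal'_cong_kernel: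
  assumes "sym_ker B (power_ideal' (*s) B X k J E) = sym_ker B (power_ideal' (*s) B X k J E')"
  shows "power_ideal' (*s) B X k J E = power_ideal' (*s) B X k J E'"
proof -
  have "sym_V (*s) B v ^ e \<in> sym_alg B \<and> (\<exists>d. homogeneous d (sym_V (*s) B v ^ e))" for v e
    using homogeneous_power[OF homogeneous_sym_V] by (blast intro: sym_alg_power sym_alg_sym_V)
  with assms show ?thesis
    unfolding power_ideal'_def by (intro sym_ideal_eqI finite_Basis) blast+
qed

end

theorem mainTheorem1:
  fixes scale :: "'k::field_char_0 \<Rightarrow> 'v::ab_group_add \<Rightarrow> 'v"
    and B :: "'v set"
    and X :: "('v \<Rightarrow> 'k) list"
    and J :: "nat set set"
    and k :: int
  assumes "finite_dimensional_vector_space scale B"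
    and "vector_space.dim scale (UNIV :: 'v set) \<ge> 1"
    and "set X \<subseteq> dual_space scale"
    and "module.span fun_scale (set X) = dual_space scale"
    and "k \<ge> -1"
    and "upper_set X J" and "J \<noteq> {}"
    and "k = -1 \<Longrightarrow> hyperplanes scale X \<subseteq> J"
  shows "P_space B X k J = sym_ker B (power_ideal scale B X k J)
    \<and> (\<forall>E. normal_selector X E \<longrightarrow>
        sym_ker B (power_ideal scale B X k J) \<subseteq> sym_ker B (power_ideal' scale B X k J E))
    \<and> (k \<in> {-1, 0} \<longrightarrow>
        (\<forall>E E'. normal_selector X E \<longrightarrow> normal_selector X E' \<longrightarrow>
          power_ideal' scale B X k J E = power_ideal' scale B X k J E') \<and>
        (\<forall>E. normal_selector X E \<longrightarrow>
          P_space B X k J = sym_ker B (power_ideal scale B X k J) \<and>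
          sym_ker B (power_ideal scale B X k J) = sym_ker B (power_ideal' scale B X k J E)))"
proof -
  interpret finite_dimensional_vector_space scale B by fact
  interpret spanning_arrangement scale B X
    by unfold_locales (use assms(3,4) in auto)
  have PK: "P_space B X k J = sym_ker B (power_ideal scale B X k J)"
  proof
    show "P_space B X k J \<subseteq> sym_ker B (power_ideal scale B X k J)"
      using assms(6,5) by (rule P_space_subset_ker)
    show "sym_ker B (power_ideal scale B X k J) \<subseteq> P_space B X k J"
      using assms(6,7,5,8) by (rule ker_subset_P_space)
  qed
  have KK': "sym_ker B (power_ideal scale B X k J) \<subseteq> sym_ker B (power_ideal' scale B X k J E)"
    if "normal_selector X E" for E
    using assms(6,7) that by (rule ker_subset_ker')
  have K'K: "sym_ker B (power_ideal' scale B X k J E) = sym_ker B (power_ideal scale B X k J)"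
    if k: "k \<in> {-1, 0}" and E: "normal_selector X E" for E
  proof
    show "sym_ker B (power_ideal' scale B X k J E) \<subseteq> sym_ker B (power_ideal scale B X k J)"
      unfolding PK[symmetric] using assms(6,7) k assms(8) E by (rule ker'_subset_P_space)
  qed (rule KK'[OF E])
  show ?thesis
  proof (intro conjI impI allI)
    fix E E' assume "k \<in> {-1, 0}" "normal_selector X E" "normal_selector X E'"
    then show "power_ideal' scale B X k J E = power_ideal' scale B X k J E'"
      by (intro power_ideal'_cong_kernel) (simp only: K'K)
  qed (use PK KK' K'K in simp_all)
qed

end
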